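(* For every $\alpha>0$ and every $u\in\mathcal S'(\mathbb R^d)$, $$WF_\alpha^{\mathrm G}(u)=WF(u),$$ where $WF(u)$ denotes Hörmander's classical $C^\infty$ wavefront set and $WF_\alpha^{\mathrm G}(u)$ the subdyadic Gabor wavefront set.
   Context: Conventions: $\widehat f(\eta)=\int_{\mathbb R^d}f(t)e^{-it\cdot\eta}\,dt$; $\langle f,g\rangle=\int f\overline g$, extended to a sesquilinear pairing of $\mathcal S'$ with $\mathcal S$; $B(c,r)$ is a Euclidean ball; $\langle\xi\rangle=(1+|\xi|^2)^{1/2}$. Subdyadic lattice at scale $\rho\in(0,\rho_0]$. Here $\rho_0,a>0$ are fixed sufficiently small constants and $b>0$ a fixed constant, depending only on $d,\alpha$. For $n\in\mathbb N_0$ let $A_n=\{2^n\le|\xi|<2^{n+1}\}$, $h_n=\rho2^{n(1-\alpha)}$. Partition $\mathbb R^d$ into half-open cubes of side $h_n$ and choose one point of $A_n$ in each cube meeting $A_n$ (candidates). Order all candidates first by $n$ and arbitrarily inside each annulus, and process them in this order, retaining a candidate $\xi$ exactly when the ball $\{|\eta-\xi|<a\rho|\xi|^{1-\alpha}\}$ is disjoint from all such balls of previously retained candidates. Enumerate the retained points as $\{\xi_k\}_{k\in\mathbb N}$ and set $x_j^k=b\rho|\xi_k|^{\alpha-1}j$, $j\in\mathbb Z^d$; $\Omega_\alpha=\{(x_j^k,\xi_k)\}$. There is a constant $A_{\mathrm{cov}}>1$ depending only on $d,\alpha$ such that the balls $\{|\eta-\xi_k|\le A_{\mathrm{cov}}\rho|\xi_k|^{1-\alpha}\}$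 cover $\{|\eta|\ge1\}$. A subdyadic frame pair $(\phi,\Omega_\alpha)$ is fixed: $\phi\in\mathcal S(\mathbb R^d)$ is real-valued, even, $L^2$-normalized, with $\widehat\phi\in C_c^\infty$, $\operatorname{supp}\widehat\phi\subset B(0,R_1)$, $|\widehat\phi|\ge m_0>0$ on $\{|\zeta|\le R_0\}$, where $3\cdot2^{\max\{\alpha-1,0\}}<R_0<R_1$; and $\Omega_\alpha$ is a subdyadic lattice at a scale $\rho_\ast\le\rho_0$, i.e. $\Omega_\alpha=\{(x_j^k,\xi_k):k\in\mathbb N,\ j\in\mathbb Z^d\}$ where the $\xi_k$ are the centers retained by the selection procedure run with $\rho=\rho_\ast$ and $x_j^k=b\rho_\ast|\xi_k|^{\alpha-1}j$, with $A_{\mathrm{cov}}\rho_\ast<R_0$ and $b\rho_\ast R_1<\pi$. Packets: $\phi_{x,\xi}(t)=|\xi|^{\frac d2(1-\alpha)}\phi((t-x)|\xi|^{1-\alpha})e^{it\cdot\xi}$. Block energy: for $v\in\mathcal E'(\mathbb R^d)$, $\mathcal E_k^\phi(v)=\big(\sum_{j\in\mathbb Z^d}|\langle v,\phi_{x_j^k,\xi_k}\rangle|^2\big)^{1/2}$. Subdyadic Gabor regularity: $u\in\mathcal S'(\mathbb R^d)$ is subdyadically Gabor-regular of type $\alpha$ at $(x_0,\xi_0)\in\mathbb R^d\times(\mathbb R^d\setminus\{0\})$ if there exist $\chi\in C_c^\infty(\mathbb R^d)$ with $\chi\equiv1$ in a neighbourhood of $x_0$, an open cone $\Gamma\subset\mathbb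 R^d\setminus\{0\}$ containing $\xi_0$, and $R>0$ such that for every $N>0$ there is $C_N>0$ with $\mathcal E_k^\phi(\chi u)\le C_N\langle\xi_k\rangle^{-N}$ whenever $\xi_k\in\Gamma$ and $|\xi_k|\ge R$. The subdyadic Gabor wavefront set $WF_\alpha^{\mathrm G}(u)$ is the set of $(x_0,\xi_0)\in\mathbb R^d\times(\mathbb R^d\setminus\{0\})$ at which $u$ is not subdyadically Gabor-regular of type $\alpha$. Classical wavefront set: $(x_0,\xi_0)\notin WF(u)$ iff there are $\chi\in C_c^\infty$ with $\chi\equiv1$ near $x_0$ and an open cone $\Gamma\ni\xi_0$ with $|\widehat{\chi u}(\eta)|\le C_M\langle\eta\rangle^{-M}$ for all $\eta\in\Gamma$ and all $M>0$. *)

theory Defs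
  imports "HOL-Analysis.Analysis"
begin

section \<open>Schwartz functions and tempered distributions\<close>

text \<open>Multi-indices are lists of basis directions: \<open>iter_partial [i\<^sub>1, \<dots>, i\<^sub>m] f\<close> is
  \<open>\<partial>\<^bsub>i\<^sub>1\<^esub> \<dots> \<partial>\<^bsub>i\<^sub>m\<^esub> f\<close>. The value of \<open>frechet_derivative\<close> is only meaningful
  at points of differentiability, which \<open>smooth_fun\<close> demands of every iterated partial.\<close>

definition partial_deriv :: "'a::euclidean_space \<Rightarrow> ('a \<Rightarrow> complex) \<Rightarrow> 'a \<Rightarrow> complex" where
  "partial_deriv i f = (\<lambda>x. frechet_derivative f (at x) i)"

primrec iter_partial :: "'a::euclidean_space list \<Rightarrow> ('a \<Rightarrow> complex) \<Rightarrow> 'a \<Rightarrow> complex" where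
  "iter_partial [] f = f"
| "iter_partial (i # is) f = partial_deriv i (iter_partial is f)"

definition smooth_fun :: "('a::euclidean_space \<Rightarrow> complex) \<Rightarrow> bool" where
  "smooth_fun f \<longleftrightarrow> (\<forall>is\<in>lists Basis. \<forall>x. iter_partial is f differentiable (at x))"

definition supp :: "('a::euclidean_space \<Rightarrow> complex) \<Rightarrow> 'a set" where
  "supp f = closure {x. f x \<noteq> 0}"

definition test_function :: "('a::euclidean_space \<Rightarrow> complex) \<Rightarrow> bool" where
  "test_function f \<longleftrightarrow> smooth_fun f \<and> compact (supp f)"

definition bracket :: "'a::euclidean_space \<Rightarrow> real" where
  "bracket x = sqrt (1 + (norm x)\<^sup>2)"

definition schwartz :: "('a::euclidean_space \<Rightarrow> complex) \<Rightarrow> bool" where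
  "schwartz f \<longleftrightarrow> smooth_fun f \<and>
     (\<forall>is\<in>lists Basis. \<forall>N::nat. \<exists>C. \<forall>x. bracket x ^ N * norm (iter_partial is f x) \<le> C)"

definition schwartz_seminorm :: "nat \<Rightarrow> ('a::euclidean_space \<Rightarrow> complex) \<Rightarrow> real" where
  "schwartz_seminorm N f =
     (SUP (is, x) \<in> {is \<in> lists Basis. length is \<le> N} \<times> UNIV.
        bracket x ^ N * norm (iter_partial is f x))"

text \<open>Distributions are linear (not antilinear) functionals; their values outside the Schwartz
  space are irrelevant. Continuity is the usual bound by one of the defining seminorms.\<close>

definition tempered_distribution :: "(('a::euclidean_space \<Rightarrow> complex) \<Rightarrow> complex) \<Rightarrow> bool" where
  "tempered_distribution u \<longleftrightarrow>
     (\<forall>f g. schwartz f \<longrightarrow> schwartz g \<longrightarrow> u (\<lambda>t. f t + g t) = u f + u g) \<and>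
     (\<forall>c f. schwartz f \<longrightarrow> u (\<lambda>t. c * f t) = c * u f) \<and>
     (\<exists>N C. \<forall>f. schwartz f \<longrightarrow> norm (u f) \<le> C * schwartz_seminorm N f)"

text \<open>The sesquilinear pairing \<open>\<langle>u, g\<rangle>\<close> that extends \<open>\<integral> u * cnj g\<close>.\<close>

definition pairing ::
    "(('a::euclidean_space \<Rightarrow> complex) \<Rightarrow> complex) \<Rightarrow> ('a \<Rightarrow> complex) \<Rightarrow> complex" where
  "pairing u g = u (\<lambda>t. cnj (g t))"

text \<open>If \<open>\<psi>\<close> is a test function, then \<open>dist_mult \<psi> u\<close> is compactly supported, and the formula
  below is also its extension to all smooth functions \<open>f\<close>, because \<open>\<psi> * f\<close> is a test function.\<close>

definition dist_mult ::
    "('a::euclidean_space \<Rightarrow> complex) \<Rightarrow> (('a \<Rightarrow> complex) \<Rightarrow> complex) \<Rightarrow> ('a \<Rightarrow> complex) \<Rightarrow> complex" where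
  "dist_mult \<psi> u = (\<lambda>f. u (\<lambda>t. \<psi> t * f t))"

definition fourier :: "('a::euclidean_space \<Rightarrow> complex) \<Rightarrow> 'a \<Rightarrow> complex" where
  "fourier f \<eta> = (\<integral>t. f t * exp (- (\<i> * complex_of_real (t \<bullet> \<eta>))) \<partial>lborel)"

text \<open>The Fourier transform of a compactly supported distribution \<open>v\<close>, which is the function
  obtained by applying \<open>v\<close> to the smooth exponentials.\<close>

definition fourier_dist ::
    "(('a::euclidean_space \<Rightarrow> complex) \<Rightarrow> complex) \<Rightarrow> 'a \<Rightarrow> complex" where
  "fourier_dist v \<eta> = v (\<lambda>t. exp (- (\<i> * complex_of_real (t \<bullet> \<eta>))))"


section \<open>The classical wavefront set\<close>

text \<open>Unlike the library's \<open>cone\<close> and \<open>conic\<close>, an open cone here lives in the complement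
  of the origin.\<close>

definition open_cone :: "'a::euclidean_space set \<Rightarrow> bool" where
  "open_cone \<Gamma> \<longleftrightarrow> open \<Gamma> \<and> 0 \<notin> \<Gamma> \<and> (\<forall>\<xi>\<in>\<Gamma>. \<forall>c>0. c *\<^sub>R \<xi> \<in> \<Gamma>)"

definition cutoff_at :: "'a::euclidean_space \<Rightarrow> ('a \<Rightarrow> complex) \<Rightarrow> bool" where
  "cutoff_at x\<^sub>0 \<psi> \<longleftrightarrow> test_function \<psi> \<and> (\<forall>\<^sub>F t in nhds x\<^sub>0. \<psi> t = 1)"

definition WF :: "(('a::euclidean_space \<Rightarrow> complex) \<Rightarrow> complex) \<Rightarrow> ('a \<times> 'a) set" where
  "WF u = {(x\<^sub>0, \<xi>\<^sub>0). \<xi>\<^sub>0 \<noteq> 0 \<and>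
     \<not> (\<exists>\<psi> \<Gamma>. cutoff_at x\<^sub>0 \<psi> \<and> open_cone \<Gamma> \<and> \<xi>\<^sub>0 \<in> \<Gamma> \<and>
          (\<forall>M::real. M > 0 \<longrightarrow> (\<exists>C. \<forall>\<eta>\<in>\<Gamma>.
             norm (fourier_dist (dist_mult \<psi> u) \<eta>) \<le> C * bracket \<eta> powr (- M))))}"


section \<open>Subdyadic lattices\<close>

definition annulus :: "nat \<Rightarrow> 'a::euclidean_space set" where
  "annulus n = {\<xi>. 2 ^ n \<le> norm \<xi> \<and> norm \<xi> < 2 ^ (n + 1)}"

definition half_open_cube :: "real \<Rightarrow> 'a::euclidean_space \<Rightarrow> 'a set" where
  "half_open_cube h c = {x. \<forall>i\<in>Basis. c \<bullet> i \<le> x \<bullet> i \<and> x \<bullet> i < c \<bullet> i + h}"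

definition cube_partition :: "real \<Rightarrow> 'a::euclidean_space set set \<Rightarrow> bool" where
  "cube_partition h P \<longleftrightarrow> partition_on UNIV P \<and> (\<forall>Q\<in>P. \<exists>c. Q = half_open_cube h c)"

text \<open>The set of candidates for the partitions \<open>P n\<close>, where \<open>sel n Q\<close> is the point chosen
  in the cube \<open>Q\<close>.\<close>

definition candidates ::
    "(nat \<Rightarrow> 'a::euclidean_space set set) \<Rightarrow> (nat \<Rightarrow> 'a set \<Rightarrow> 'a) \<Rightarrow> 'a set" where
  "candidates P sel = {sel n Q |n Q. Q \<in> P n \<and> Q \<inter> annulus n \<noteq> {}}"

definition selection_ball :: "real \<Rightarrow> real \<Rightarrow> real \<Rightarrow> 'a::euclidean_space \<Rightarrow> 'a set" where
  "selection_ball \<alpha> \<rho> a \<xi> = ball \<xi> (a * \<rho> * norm \<xi> powr (1 - \<alpha>))"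

text \<open>Greedy selection along a sequence \<open>c\<close>: \<open>retained_before \<alpha> \<rho> a c m\<close> is the set of those
  indices \<open>l < m\<close> for which \<open>c l\<close> has been retained.\<close>

primrec retained_before ::
    "real \<Rightarrow> real \<Rightarrow> real \<Rightarrow> (nat \<Rightarrow> 'a::euclidean_space) \<Rightarrow> nat \<Rightarrow> nat set" where
  "retained_before \<alpha> \<rho> a c 0 = {}"
| "retained_before \<alpha> \<rho> a c (Suc m) =
     (if \<forall>l\<in>retained_before \<alpha> \<rho> a c m.
           selection_ball \<alpha> \<rho> a (c m) \<inter> selection_ball \<alpha> \<rho> a (c l) = {}
      then insert m (retained_before \<alpha> \<rho> a c m) else retained_before \<alpha> \<rho> a c m)"

definition retained_points ::
    "real \<Rightarrow> real \<Rightarrow> real \<Rightarrow> (nat \<Rightarrow> 'a::euclidean_space) \<Rightarrow> 'a set" where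
  "retained_points \<alpha> \<rho> a c = c ` (\<Union>m. retained_before \<alpha> \<rho> a c m)"

text \<open>\<open>\<xi>\<close> enumerates the centers produced by some run of the selection procedure at scale \<open>\<rho>\<close>.
  The processing order is the injective sequence \<open>c\<close> of all candidates (every annulus contains
  only finitely many of them, so an order that refines the order of the annuli has type
  \<open>\<omega>\<close>).\<close>

definition subdyadic_centers ::
    "real \<Rightarrow> real \<Rightarrow> real \<Rightarrow> (nat \<Rightarrow> 'a::euclidean_space) \<Rightarrow> bool" where
  "subdyadic_centers \<alpha> \<rho> a \<xi> \<longleftrightarrow>
     (\<exists>P sel c.
        (\<forall>n. cube_partition (\<rho> * 2 powr (real n * (1 - \<alpha>))) (P n)) \<and>
        (\<forall>n. \<forall>Q\<in>P n. Q \<inter> annulus n \<noteq> {} \<longrightarrow> sel n Q \<in> Q \<inter> annulus n) \<and>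
        bij_betw c UNIV (candidates P sel) \<and>
        (\<forall>i j m n. c i \<in> annulus m \<longrightarrow> c j \<in> annulus n \<longrightarrow> m < n \<longrightarrow> i < j) \<and>
        bij_betw \<xi> UNIV (retained_points \<alpha> \<rho> a c))"

text \<open>\<open>A\<close> is a covering constant for all lattices at scales \<open>\<rho> \<le> \<rho>\<^sub>0\<close>. This is the only way in
  which the smallness of \<open>\<rho>\<^sub>0\<close> and \<open>a\<close> enters; \<open>covering_constant_exists\<close> below shows that
  there is such a constant as soon as they are small.\<close>

definition covering_constant ::
    "'a::euclidean_space itself \<Rightarrow> real \<Rightarrow> real \<Rightarrow> real \<Rightarrow> real \<Rightarrow> bool" where
  "covering_constant T \<alpha> \<rho>\<^sub>0 a A \<longleftrightarrow> A > 1 \<and>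
     (\<forall>\<rho> (\<xi>::nat \<Rightarrow> 'a). 0 < \<rho> \<longrightarrow> \<rho> \<le> \<rho>\<^sub>0 \<longrightarrow> subdyadic_centers \<alpha> \<rho> a \<xi> \<longrightarrow>
        {\<eta>. norm \<eta> \<ge> 1} \<subseteq> (\<Union>k. cball (\<xi> k) (A * \<rho> * norm (\<xi> k) powr (1 - \<alpha>))))"


section \<open>Subdyadic frame pairs and the Gabor wavefront set\<close>

text \<open>The lattice consists of the points \<open>(node \<alpha> b \<rho> \<xi> k j, \<xi> k)\<close> with \<open>k\<close> a natural number
  and \<open>j \<in> int_lattice\<close>.\<close>

definition int_lattice :: "'a::euclidean_space set" where
  "int_lattice = {j. \<forall>i\<in>Basis. j \<bullet> i \<in> \<int>}"

definition node ::
    "real \<Rightarrow> real \<Rightarrow> real \<Rightarrow> (nat \<Rightarrow> 'a::euclidean_space) \<Rightarrow> nat \<Rightarrow> 'a \<Rightarrow> 'a" where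
  "node \<alpha> b \<rho> \<xi> k j = (b * \<rho> * norm (\<xi> k) powr (\<alpha> - 1)) *\<^sub>R j"

definition packet ::
    "real \<Rightarrow> ('a::euclidean_space \<Rightarrow> complex) \<Rightarrow> 'a \<Rightarrow> 'a \<Rightarrow> 'a \<Rightarrow> complex" where
  "packet \<alpha> \<phi> x \<xi> = (\<lambda>t. complex_of_real (norm \<xi> powr (real DIM('a) / 2 * (1 - \<alpha>))) *
     \<phi> (norm \<xi> powr (1 - \<alpha>) *\<^sub>R (t - x)) * exp (\<i> * complex_of_real (t \<bullet> \<xi>)))"

definition subdyadic_frame_pair ::
    "real \<Rightarrow> real \<Rightarrow> real \<Rightarrow> real \<Rightarrow> real \<Rightarrow>
     ('a::euclidean_space \<Rightarrow> complex) \<Rightarrow> real \<Rightarrow> (nat \<Rightarrow> 'a) \<Rightarrow> bool" where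
  "subdyadic_frame_pair \<alpha> \<rho>\<^sub>0 a b A \<phi> \<rho> \<xi> \<longleftrightarrow>
     schwartz \<phi> \<and> (\<forall>t. \<phi> t \<in> \<real>) \<and> (\<forall>t. \<phi> (- t) = \<phi> t) \<and>
     (\<integral>t. (norm (\<phi> t))\<^sup>2 \<partial>lborel) = 1 \<and>
     test_function (fourier \<phi>) \<and>
     0 < \<rho> \<and> \<rho> \<le> \<rho>\<^sub>0 \<and> subdyadic_centers \<alpha> \<rho> a \<xi> \<and>
     (\<exists>R\<^sub>0 R\<^sub>1 m\<^sub>0. 3 * 2 powr (max (\<alpha> - 1) 0) < R\<^sub>0 \<and> R\<^sub>0 < R\<^sub>1 \<and> m\<^sub>0 > 0 \<and>
        supp (fourier \<phi>) \<subseteq> ball 0 R\<^sub>1 \<and>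
        (\<forall>\<zeta>. norm \<zeta> \<le> R\<^sub>0 \<longrightarrow> norm (fourier \<phi> \<zeta>) \<ge> m\<^sub>0) \<and>
        A * \<rho> < R\<^sub>0 \<and> b * \<rho> * R\<^sub>1 < pi)"

definition packet_coeff ::
    "real \<Rightarrow> real \<Rightarrow> ('a::euclidean_space \<Rightarrow> complex) \<Rightarrow> real \<Rightarrow> (nat \<Rightarrow> 'a) \<Rightarrow>
     (('a \<Rightarrow> complex) \<Rightarrow> complex) \<Rightarrow> nat \<Rightarrow> 'a \<Rightarrow> complex" where
  "packet_coeff \<alpha> b \<phi> \<rho> \<xi> v k j = pairing v (packet \<alpha> \<phi> (node \<alpha> b \<rho> \<xi> k j) (\<xi> k))"

definition block_energy ::
    "real \<Rightarrow> real \<Rightarrow> ('a::euclidean_space \<Rightarrow> complex) \<Rightarrow> real \<Rightarrow> (nat \<Rightarrow> 'a) \<Rightarrow>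
     (('a \<Rightarrow> complex) \<Rightarrow> complex) \<Rightarrow> nat \<Rightarrow> real" where
  "block_energy \<alpha> b \<phi> \<rho> \<xi> v k =
     sqrt (\<Sum>\<^sub>\<infinity>j\<in>int_lattice. (norm (packet_coeff \<alpha> b \<phi> \<rho> \<xi> v k j))\<^sup>2)"

text \<open>Since \<open>infsum\<close> is \<open>0\<close> for divergent sums, the convergence of the sum that defines the block
  energy is stated along with the bound.\<close>

definition gabor_regular ::
    "real \<Rightarrow> real \<Rightarrow> ('a::euclidean_space \<Rightarrow> complex) \<Rightarrow> real \<Rightarrow> (nat \<Rightarrow> 'a) \<Rightarrow>
     (('a \<Rightarrow> complex) \<Rightarrow> complex) \<Rightarrow> 'a \<Rightarrow> 'a \<Rightarrow> bool" where
  "gabor_regular \<alpha> b \<phi> \<rho> \<xi> u x\<^sub>0 \<xi>\<^sub>0 \<longleftrightarrow>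
     (\<exists>\<psi> \<Gamma> R. cutoff_at x\<^sub>0 \<psi> \<and> open_cone \<Gamma> \<and> \<xi>\<^sub>0 \<in> \<Gamma> \<and> R > 0 \<and>
        (\<forall>N::real. N > 0 \<longrightarrow> (\<exists>C>0. \<forall>k. \<xi> k \<in> \<Gamma> \<longrightarrow> norm (\<xi> k) \<ge> R \<longrightarrow>
           (\<lambda>j. (norm (packet_coeff \<alpha> b \<phi> \<rho> \<xi> (dist_mult \<psi> u) k j))\<^sup>2) summable_on int_lattice \<and>
           block_energy \<alpha> b \<phi> \<rho> \<xi> (dist_mult \<psi> u) k \<le> C * bracket (\<xi> k) powr (- N))))"

definition WF_Gabor ::
    "real \<Rightarrow> real \<Rightarrow> ('a::euclidean_space \<Rightarrow> complex) \<Rightarrow> real \<Rightarrow> (nat \<Rightarrow> 'a) \<Rightarrow>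
     (('a \<Rightarrow> complex) \<Rightarrow> complex) \<Rightarrow> ('a \<times> 'a) set" where
  "WF_Gabor \<alpha> b \<phi> \<rho> \<xi> u = {(x\<^sub>0, \<xi>\<^sub>0). \<xi>\<^sub>0 \<noteq> 0 \<and> \<not> gabor_regular \<alpha> b \<phi> \<rho> \<xi> u x\<^sub>0 \<xi>\<^sub>0}"


section \<open>Existence of covering constants\<close>

lemma powr_comparable:
  fixes x y p :: real
  assumes "0 < x" "0 < y" "x \<le> 2 * y" "y \<le> 2 * x"
  shows "x powr p \<le> 2 powr \<bar>p\<bar> * y powr p"
proof (cases "p \<ge> 0")
  case True
  have "x powr p \<le> (2 * y) powr p"
    using assms True by (intro powr_mono2) auto
  then show ?thesis using assms True by (simp add: powr_mult)
next
  case False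
  have "x powr p \<le> (y / 2) powr p"
    using assms False by (intro powr_mono2') auto
  also have "\<dots> = 2 powr (- p) * y powr p"
    using assms by (simp add: powr_divide powr_minus field_simps)
  finally show ?thesis using False by simp
qed

lemma annulus_exists:
  fixes \<eta> :: "'a::euclidean_space"
  assumes "norm \<eta> \<ge> 1"
  shows "\<exists>n. \<eta> \<in> annulus n"
proof -
  obtain N where N: "norm \<eta> < 2 ^ N"
    using real_arch_pow[of 2 "norm \<eta>"] by auto
  define n where "n = (LEAST n. norm \<eta> < 2 ^ n)"
  have n: "norm \<eta> < 2 ^ n" unfolding n_def using N by (rule LeastI)
  then have "n \<noteq> 0" using assms by (cases n) auto
  then obtain m where m: "n = Suc m" by (cases n) auto
  have "\<not> norm \<eta> < 2 ^ m"
    using not_less_Least[of m "\<lambda>n. norm \<eta> < 2 ^ n"] m n_def by auto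
  then show ?thesis using n m by (auto simp: annulus_def not_less)
qed

lemma half_open_cube_diam:
  fixes x y c :: "'a::euclidean_space"
  assumes "x \<in> half_open_cube h c" "y \<in> half_open_cube h c"
  shows "dist x y \<le> real DIM('a) * h"
proof -
  have "norm (x - y) \<le> (\<Sum>i\<in>Basis. \<bar>(x - y) \<bullet> i\<bar>)" by (rule norm_le_l1)
  also have "\<dots> \<le> (\<Sum>i\<in>(Basis::'a set). h)"
  proof (rule sum_mono)
    fix i :: 'a assume "i \<in> Basis"
    with assms have "c \<bullet> i \<le> x \<bullet> i" "x \<bullet> i < c \<bullet> i + h" "c \<bullet> i \<le> y \<bullet> i" "y \<bullet> i < c \<bullet> i + h"
      by (auto simp: half_open_cube_def)
    then show "\<bar>(x - y) \<bullet> i\<bar> \<le> h" by (simp add: inner_diff_left)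
  qed
  finally show ?thesis by (simp add: dist_norm)
qed

lemma norm_powr_le:
  assumes "\<alpha> > 0" "norm x \<ge> 1"
  shows "norm x powr (1 - \<alpha>) \<le> norm x"
  using powr_mono[of "1 - \<alpha>" 1 "norm x"] assms by (simp add: powr_one)

lemma covering_constant_exists:
  assumes "\<alpha> > 0"
  shows "\<exists>A. \<forall>\<rho>\<^sub>0 a. 0 < \<rho>\<^sub>0 \<longrightarrow> \<rho>\<^sub>0 \<le> 1 / 4 \<longrightarrow> 0 < a \<longrightarrow> a \<le> 1 \<longrightarrow>
           covering_constant TYPE('a::euclidean_space) \<alpha> \<rho>\<^sub>0 a A"
proof -
  define K where "K = 2 powr \<bar>1 - \<alpha>\<bar>"
  define D where "D = real DIM('a)"
  define A where "A = D * K * K + K + 1"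
  have K: "K \<ge> 1" by (simp add: K_def ge_one_powr_ge_zero)
  have D: "D \<ge> 1" using DIM_positive[where 'a='a] unfolding D_def by linarith
  have DK0: "D * K \<ge> 0" using K D by simp
  have DK: "D * K \<ge> 0" "D * K * K \<ge> D * K" using DK0 mult_left_mono[OF K DK0] by auto
  have A: "A > 1" "A \<ge> D * K" using K DK unfolding A_def by linarith+
  have *: "\<exists>k. \<eta> \<in> cball (\<xi> k) (A * \<rho> * norm (\<xi> k) powr (1 - \<alpha>))"
    if \<rho>: "0 < \<rho>" "\<rho> \<le> 1 / 4" and a: "0 < a" "a \<le> 1"
      and sc: "subdyadic_centers \<alpha> \<rho> a \<xi>" and \<eta>: "norm \<eta> \<ge> 1"
    for \<rho> a and \<xi> :: "nat \<Rightarrow> 'a" and \<eta> :: 'a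
  proof -
    obtain P sel c where
      P: "\<forall>n. cube_partition (\<rho> * 2 powr (real n * (1 - \<alpha>))) (P n)"
      and sel': "\<forall>n. \<forall>Q\<in>P n. Q \<inter> annulus n \<noteq> {} \<longrightarrow> sel n Q \<in> Q \<inter> annulus n"
      and c: "bij_betw c UNIV (candidates P sel)"
      and \<xi>: "bij_betw \<xi> UNIV (retained_points \<alpha> \<rho> a c)"
      using sc unfolding subdyadic_centers_def by (elim exE conjE) (rule that)
    have sel: "sel n Q \<in> Q \<inter> annulus n" if "Q \<in> P n" "Q \<inter> annulus n \<noteq> {}" for n Q
      using sel' that by simp
    define r where "r x = norm x powr (1 - \<alpha>)" for x :: 'a
    have r0: "r x \<ge> 0" for x by (simp add: r_def)
    obtain n where n: "\<eta> \<in> annulus n" using annulus_exists[OF \<eta>] by blast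
    obtain Q where Q: "Q \<in> P n" "\<eta> \<in> Q"
    proof -
      have "\<Union> (P n) = UNIV"
        using P[rule_format, of n] by (simp add: cube_partition_def partition_on_def)
      then have "\<eta> \<in> \<Union> (P n)" by simp
      with that show ?thesis by blast
    qed
    obtain q where q: "Q = half_open_cube (\<rho> * 2 powr (real n * (1 - \<alpha>))) q"
      using P[rule_format, of n] Q by (auto simp: cube_partition_def)
    have ne: "Q \<inter> annulus n \<noteq> {}" using n Q by auto
    define x where "x = sel n Q"
    have x: "x \<in> Q" "x \<in> annulus n" using sel[OF Q(1) ne] by (auto simp: x_def)
    have cand: "norm z \<ge> 1" if z: "z \<in> candidates P sel" for z
    proof -
      obtain m S where S: "z = sel m S" "S \<in> P m" "S \<inter> annulus m \<noteq> {}"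
        using z unfolding candidates_def by blast
      have "z \<in> annulus m" using sel[OF S(2,3)] S(1) by auto
      then have "2 ^ m \<le> norm z" by (simp add: annulus_def)
      moreover have "(1::real) \<le> 2 ^ m" by simp
      ultimately show ?thesis by linarith
    qed
    have xc: "x \<in> candidates P sel" using Q ne unfolding candidates_def x_def by blast
    then obtain m where m: "x = c m" using c by (auto simp: bij_betw_def)
    have "2 powr (real n * (1 - \<alpha>)) = (2 ^ n) powr (1 - \<alpha>)"
      by (simp add: powr_powr[symmetric] powr_realpow)
    also have "\<dots> \<le> K * r x"
      unfolding K_def r_def using x(2) cand[OF xc] by (intro powr_comparable) (auto simp: annulus_def)
    finally have "\<rho> * 2 powr (real n * (1 - \<alpha>)) \<le> \<rho> * (K * r x)"
      using \<rho> by (intro mult_left_mono) auto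
    then have "D * (\<rho> * 2 powr (real n * (1 - \<alpha>))) \<le> D * (\<rho> * (K * r x))"
      by (rule mult_left_mono) (use D in simp)
    moreover have "dist x \<eta> \<le> D * (\<rho> * 2 powr (real n * (1 - \<alpha>)))"
      unfolding D_def using half_open_cube_diam[of x _ q \<eta>] x Q q by auto
    ultimately have dx: "dist x \<eta> \<le> D * K * \<rho> * r x" by (simp add: mult_ac)
    have ret: "\<exists>k. \<xi> k = c l" if "l \<in> retained_before \<alpha> \<rho> a c i" for l i
    proof -
      have "c l \<in> retained_points \<alpha> \<rho> a c" using that unfolding retained_points_def by blast
      also have "\<dots> = range \<xi>" using \<xi> by (simp add: bij_betw_def)
      finally show ?thesis by auto
    qed
    show ?thesis
    proof (cases "m \<in> retained_before \<alpha> \<rho> a c (Suc m)")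
      case True
      then obtain k where k: "\<xi> k = x" using ret m by metis
      have "D * K * (\<rho> * r x) \<le> A * (\<rho> * r x)"
        by (rule mult_right_mono) (use A(2) \<rho> r0 in auto)
      then have "dist x \<eta> \<le> A * \<rho> * r x" using dx by (simp add: mult_ac)
      then show ?thesis using k by (auto simp: r_def intro!: exI[of _ k])
    next
      case False
      then obtain l where l: "l \<in> retained_before \<alpha> \<rho> a c m"
        and "selection_ball \<alpha> \<rho> a (c m) \<inter> selection_ball \<alpha> \<rho> a (c l) \<noteq> {}"
        by (auto split: if_splits)
      then obtain z where z: "dist x z < a * \<rho> * r x" "dist (c l) z < a * \<rho> * r (c l)"
        unfolding selection_ball_def r_def m by auto
      define y where "y = c l"
      have "y \<in> candidates P sel" using c by (auto simp: bij_betw_def y_def)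
      then have n1: "norm x \<ge> 1" "norm y \<ge> 1" using cand xc by auto
      have a\<rho>: "a * \<rho> \<le> 1 / 4" "a * \<rho> \<ge> 0" "a * \<rho> \<le> \<rho>"
        using mult_mono[of a 1 \<rho> "1/4"] mult_right_mono[of a 1 \<rho>] a \<rho> by auto
      have dxy: "dist x y < a * \<rho> * (r x + r y)"
        using z dist_triangle2[of x y z] by (simp add: y_def algebra_simps)
      have rn: "r x \<le> norm x" "r y \<le> norm y"
        using n1 assms unfolding r_def by (auto intro: norm_powr_le)
      have "a * \<rho> * (r x + r y) \<le> 1 / 4 * (norm x + norm y)"
        by (rule mult_mono) (use a\<rho> r0[of x] r0[of y] rn in auto)
      with dxy have d: "dist x y < (norm x + norm y) / 4" by simp
      have "norm x \<le> norm y + dist x y" "norm y \<le> norm x + dist x y"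
        using norm_triangle_sub[of x y] norm_triangle_sub[of y x]
        by (auto simp: dist_norm norm_minus_commute)
      note nxy = this
      have "norm x \<le> 2 * norm y"
        using d n1 nxy(1) by (simp add: field_simps)
      moreover have "norm y \<le> 2 * norm x"
        using d n1 nxy(2) by (simp add: field_simps)
      ultimately have rxy: "r x \<le> K * r y"
        unfolding r_def K_def using n1 by (intro powr_comparable) auto
      have "dist \<eta> y \<le> D * K * \<rho> * r x + a * \<rho> * (r x + r y)"
        using dx dxy dist_triangle[of \<eta> y x] by (simp add: dist_commute)
      also have "\<dots> \<le> D * K * \<rho> * r x + \<rho> * (r x + r y)"
        by (intro add_left_mono mult_right_mono) (use a\<rho> r0[of x] r0[of y] in auto)
      also have "\<dots> \<le> D * K * \<rho> * (K * r y) + \<rho> * (K * r y + r y)"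
        by (rule add_mono; rule mult_left_mono) (use rxy \<rho> DK in auto)
      also have "\<dots> = A * \<rho> * r y" by (simp add: A_def algebra_simps)
      finally have "dist y \<eta> \<le> A * \<rho> * r y" by (simp add: dist_commute)
      moreover obtain k where "\<xi> k = y" using ret[OF l] y_def by metis
      ultimately show ?thesis by (auto simp: r_def intro!: exI[of _ k])
    qed
  qed
  have "covering_constant TYPE('a) \<alpha> \<rho>\<^sub>0 a A"
    if "0 < \<rho>\<^sub>0" "\<rho>\<^sub>0 \<le> 1 / 4" "0 < a" "a \<le> 1" for \<rho>\<^sub>0 a
    unfolding covering_constant_def
  proof (intro conjI allI impI subsetI)
    fix \<rho> and \<xi> :: "nat \<Rightarrow> 'a" and \<eta> :: 'a
    assume "0 < \<rho>" "\<rho> \<le> \<rho>\<^sub>0" "subdyadic_centers \<alpha> \<rho> a \<xi>" "\<eta> \<in> {\<eta>. 1 \<le> norm \<eta>}"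
    then have "\<exists>k. \<eta> \<in> cball (\<xi> k) (A * \<rho> * norm (\<xi> k) powr (1 - \<alpha>))"
      using * that by simp
    then show "\<eta> \<in> (\<Union>k. cball (\<xi> k) (A * \<rho> * norm (\<xi> k) powr (1 - \<alpha>)))" by blast
  qed (fact A(1))
  then show ?thesis by blast
qed

end

theory Submission
  imports Defs "HOL-Probability.Probability"
begin

text \<open>Let \<open>V\<close> be the Fourier transform of the compactly supported distribution \<open>\<psi> u\<close> and
  \<open>h = norm (\<xi> k) powr (1 - \<alpha>)\<close>. By Fourier inversion for \<open>\<phi>\<close>, the packet coefficients of
  \<open>\<psi> u\<close> at the frequency \<open>\<xi> k\<close> are, up to a factor, the Fourier coefficients of
  \<open>G \<zeta> = fourier \<phi> \<zeta> * V (\<xi> k + h \<zeta>)\<close> on the cube of side \<open>2 pi / (b \<rho>)\<close>, which contains the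
  support of \<open>G\<close> because \<open>b \<rho> R\<^sub>1 < pi\<close>. Hence by Parseval the squared block energy is
  \<open>(h / (2 pi b \<rho>)) ^ d\<close> times the integral of \<open>|G|\<^sup>2\<close>.

  Since \<open>\<alpha> > 0\<close>, the ball of radius \<open>R\<^sub>1 h\<close> around \<open>\<xi> k\<close> stays in a slightly larger cone once
  \<open>\<xi> k\<close> is large, so decay of \<open>V\<close> gives decay of the block energies. Conversely every large \<open>\<eta>\<close> is
  \<open>\<xi> k + h \<zeta>\<close> for some \<open>k\<close> and some \<open>\<zeta>\<close> well inside the ball where \<open>fourier \<phi>\<close> is bounded
  below. As \<open>V\<close> is Lipschitz with a polynomially growing constant, a value \<open>m = |V \<eta>|\<close> forces
  \<open>L\<^sup>2\<close> mass of order \<open>m ^ (d + 2)\<close> up to a power of \<open>|\<eta>|\<close>, so rapid decay of the block energies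
  forces rapid decay of \<open>V\<close>. The same cutoff \<open>\<psi>\<close> serves in both directions.\<close>

section \<open>Fourier inversion\<close>

text \<open>Both regularity conditions become conditions on the single function \<open>V\<close>.
  Hence no change of cutoff is called for; only the cone shrinks, to make room for the sublinear
  radius of the frequency blocks. One obstacle is the passage from an L2 mean to a point value. A
  value \<open>m\<close> persists as at least \<open>m / 2\<close> on a cube whose side is
  \<open>m\<close> divided by a power of |\<eta>|, so the mean controls \<open>m ^ 2\<close> times
  the volume \<open>m ^ d\<close>. The root of order \<open>d + 2\<close> and the power of |\<eta>|
  are harmless because every rate of decay is at disposal. The other obstacle is that
  \<open>u\<close> is known only through one seminorm bound: it can be moved inside a frequency
  integral only after \<open>\<psi> t * osc \<eta> t\<close> has been shown to depend on \<eta> in a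
  locally Lipschitz way with respect to the seminorms. The same estimate yields the Lipschitz bound
  for \<open>V\<close>. Packets need not have compact support, but their products with \<psi> are
  superpositions of these functions over a compact cube of frequencies.\<close>

lemma
  fixes f :: "'a::euclidean_space \<Rightarrow> real \<Rightarrow> 'b::{real_normed_field,banach,second_countable_topology}"
  assumes int: "\<And>i. i \<in> Basis \<Longrightarrow> integrable lborel (f i)"
  shows integrable_lborel_prod: "integrable lborel (\<lambda>x. \<Prod>i\<in>Basis. f i (x \<bullet> i))"
    and integral_lborel_prod:
      "(\<integral>x. (\<Prod>i\<in>Basis. f i (x \<bullet> i)) \<partial>lborel) = (\<Prod>i\<in>Basis. \<integral>x. f i x \<partial>lborel)"
proof -
  interpret product_sigma_finite "\<lambda>_::'a. lborel :: real measure" ..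
  let ?P = "\<Pi>\<^sub>M i\<in>(Basis::'a set). (lborel :: real measure)"
  \<comment> \<open>\<open>?T\<close> rebuilds a vector from its coordinates; by
    \<open>lborel_eq\<close> Lebesgue measure is the image of the product measure under it, so the
    product formula for integrals transfers.\<close>
  let ?T = "\<lambda>g. \<Sum>b\<in>Basis. g b *\<^sub>R b :: 'a"
  have fm [measurable]: "f i \<in> borel_measurable borel" if "i \<in> Basis" for i
    using int[OF that] by simp
  have T [measurable]: "?T \<in> measurable ?P borel" by measurable
  have m: "(\<lambda>x. \<Prod>i\<in>Basis. f i (x \<bullet> i)) \<in> borel_measurable borel"
    by measurable
  have eq: "(\<Prod>i\<in>Basis. f i (?T x \<bullet> i)) = (\<Prod>i\<in>Basis. f i (x i))" for x
    by (intro prod.cong refl) (simp add: inner_sum_left inner_Basis if_distrib sum.delta' cong: if_cong)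
  show "integrable lborel (\<lambda>x. \<Prod>i\<in>Basis. f i (x \<bullet> i))"
    by (subst lborel_eq) (simp add: integrable_distr_eq[OF T m] eq product_integrable_prod int)
  show "(\<integral>x. (\<Prod>i\<in>Basis. f i (x \<bullet> i)) \<partial>lborel) = (\<Prod>i\<in>Basis. \<integral>x. f i x \<partial>lborel)"
    by (subst (1) lborel_eq) (simp add: integral_distr[OF T m] eq product_integral_prod int)
qed

lemma integral_lborel_affine:
  fixes f :: "'a::euclidean_space \<Rightarrow> 'b::{banach, second_countable_topology}"
  assumes [measurable]: "f \<in> borel_measurable borel" and "c \<noteq> 0"
  shows "(\<integral>x. f x \<partial>lborel) = \<bar>c\<bar> ^ DIM('a) *\<^sub>R (\<integral>x. f (t + c *\<^sub>R x) \<partial>lborel)"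
proof -
  have "(\<integral>x. f x \<partial>lborel) = (\<integral>x. f x \<partial>density (distr lborel borel (\<lambda>x. t + c *\<^sub>R x)) (\<lambda>_. \<bar>c\<bar>^DIM('a)))"
    using lborel_affine[OF assms(2), of t] by simp
  also have "\<dots> = (\<integral>x. \<bar>c\<bar>^DIM('a) *\<^sub>R f (t + c *\<^sub>R x) \<partial>lborel)"
    by (subst integral_density) (auto simp: integral_distr)
  finally show ?thesis by simp
qed

lemma integrable_lborel_affine:
  fixes f :: "'a::euclidean_space \<Rightarrow> 'b::{banach, second_countable_topology}"
  assumes "integrable lborel f" and "c \<noteq> 0"
  shows "integrable lborel (\<lambda>x. f (t + c *\<^sub>R x))"
proof -
  have [measurable]: "f \<in> borel_measurable borel" using assms(1) by simp
  have "integrable (density (distr lborel borel (\<lambda>x. t + c *\<^sub>R x)) (\<lambda>_. \<bar>c\<bar>^DIM('a))) f"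
    using lborel_affine[OF assms(2), of t] assms(1) by simp
  then have "integrable lborel (\<lambda>x. \<bar>c\<bar>^DIM('a) *\<^sub>R f (t + c *\<^sub>R x))"
    by (subst (asm) integrable_density) (auto simp: integrable_distr_eq)
  then have "integrable lborel (\<lambda>x. (1 / \<bar>c\<bar>^DIM('a)) *\<^sub>R (\<bar>c\<bar>^DIM('a) *\<^sub>R f (t + c *\<^sub>R x)))"
    by (rule integrable_scaleR_right)
  then show ?thesis using assms(2) by simp
qed

section \<open>Gaussian functions and their Fourier transforms\<close>

definition gauss :: "'a::euclidean_space \<Rightarrow> real" where
  "gauss x = exp (- (norm x)\<^sup>2 / 2)"

lemma gauss_measurable [measurable]: "gauss \<in> borel_measurable borel"
  unfolding gauss_def by measurable

lemma norm_square_eq_sum_Basis: "(norm x)\<^sup>2 = (\<Sum>i\<in>Basis. (x \<bullet> i)\<^sup>2)"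
  for x :: "'a::euclidean_space"
  unfolding power2_norm_eq_inner euclidean_inner[of x x] by (simp add: power2_eq_square)

lemma gauss_eq_prod_exp: "gauss x = (\<Prod>i\<in>Basis. exp (- (x \<bullet> i)\<^sup>2 / 2))"
  for x :: "'a::euclidean_space"
  unfolding gauss_def norm_square_eq_sum_Basis
  by (simp add: sum_negf sum_divide_distrib flip: exp_sum)

lemma gauss_eq_prod:
  "gauss x = sqrt (2 * pi) ^ DIM('a) * (\<Prod>i\<in>Basis. std_normal_density (x \<bullet> i))"
  for x :: "'a::euclidean_space"
  unfolding gauss_eq_prod_exp
  by (simp add: std_normal_density_def prod.distrib prod_dividef power_divide)

text \<open>The characteristic function of the standard normal distribution, rewritten as a Lebesgue
  integral against the density; integrability is included because the product formula asks for
  it.\<close>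

lemma integral_std_normal_iexp:
  "integrable lborel (\<lambda>x. complex_of_real (std_normal_density x) * exp (\<i> * complex_of_real (y * x)))"
  "(\<integral>x. complex_of_real (std_normal_density x) * exp (\<i> * complex_of_real (y * x)) \<partial>lborel)
     = complex_of_real (exp (- y\<^sup>2 / 2))"
proof -
  have i: "integrable lborel (\<lambda>x. complex_of_real (std_normal_density x))"
    using integrable_std_normal_moment[of 0] by simp
  show "integrable lborel (\<lambda>x. complex_of_real (std_normal_density x) * exp (\<i> * complex_of_real (y * x)))"
    by (rule Bochner_Integration.integrable_bound[OF i]) (auto simp: norm_mult)
  have "char std_normal_distribution y = (\<integral>x. std_normal_density x *\<^sub>R exp (\<i> * complex_of_real (y * x)) \<partial>lborel)"
    unfolding char_def by (subst integral_density) auto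
  then show "(\<integral>x. complex_of_real (std_normal_density x) * exp (\<i> * complex_of_real (y * x)) \<partial>lborel)
     = complex_of_real (exp (- y\<^sup>2 / 2))"
    by (simp add: char_std_normal_distribution scaleR_conv_of_real)
qed

text \<open>The Gaussian and the character both split into factors of one coordinate each, which
  reduces the claim to the normal density on the line. The power of \<open>sqrt (2 * pi)\<close>
  undoes the normalization of that density.\<close>

lemma fourier_gauss:
  fixes y :: "'a::euclidean_space"
  shows "integrable lborel (\<lambda>x::'a. complex_of_real (gauss x) * exp (\<i> * complex_of_real (y \<bullet> x)))"
    and "(\<integral>x. complex_of_real (gauss x) * exp (\<i> * complex_of_real (y \<bullet> x)) \<partial>lborel)
           = complex_of_real (sqrt (2 * pi) ^ DIM('a) * gauss y)"
proof -
  let ?f = "\<lambda>i x. complex_of_real (std_normal_density x) * exp (\<i> * complex_of_real ((y \<bullet> i) * x))"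
  have e: "complex_of_real (gauss x) * exp (\<i> * complex_of_real (y \<bullet> x))
      = complex_of_real (sqrt (2 * pi) ^ DIM('a)) * (\<Prod>i\<in>Basis. ?f i (x \<bullet> i))" for x :: 'a
    by (simp add: gauss_eq_prod prod.distrib euclidean_inner[of y x] sum_distrib_left flip: exp_sum)
  show "integrable lborel (\<lambda>x::'a. complex_of_real (gauss x) * exp (\<i> * complex_of_real (y \<bullet> x)))"
    unfolding e by (intro integrable_mult_right integrable_lborel_prod integral_std_normal_iexp)
  have "(\<integral>x. (\<Prod>i\<in>Basis. ?f i (x \<bullet> i)) \<partial>lborel) = (\<Prod>i\<in>Basis. complex_of_real (exp (- (y \<bullet> i)\<^sup>2 / 2)))"
    by (subst integral_lborel_prod) (simp_all only: integral_std_normal_iexp)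
  also have "\<dots> = complex_of_real (gauss y)"
    unfolding gauss_eq_prod_exp by (simp only: of_real_prod)
  finally show "(\<integral>x. complex_of_real (gauss x) * exp (\<i> * complex_of_real (y \<bullet> x)) \<partial>lborel)
           = complex_of_real (sqrt (2 * pi) ^ DIM('a) * gauss y)"
    unfolding e by simp
qed

lemma integrable_gauss: "integrable lborel (gauss :: 'a::euclidean_space \<Rightarrow> real)"
  using integrable_Re[OF fourier_gauss(1)[of "0::'a"]] by simp

text \<open>Damping the frequency integral by \<open>gauss (\<epsilon> *\<^sub>R \<zeta>)\<close>
  makes Fubini applicable; in the other order the frequency integral is a Gaussian of width
  \<epsilon> around \<open>t\<close>, an approximate identity. Integrability of
  \<open>fourier f\<close> controls the limit on the damped side, continuity and boundedness of
  \<open>f\<close> the limit on the other.\<close>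

theorem fourier_inversion:
  fixes f :: "'a::euclidean_space \<Rightarrow> complex"
  assumes f: "integrable lborel f" and cont: "continuous_on UNIV f" and bdd: "\<And>x. norm (f x) \<le> B"
    and fh: "integrable lborel (fourier f)"
  shows "(\<integral>\<zeta>. fourier f \<zeta> * exp (\<i> * complex_of_real (t \<bullet> \<zeta>)) \<partial>lborel)
           = complex_of_real ((2 * pi) ^ DIM('a)) * f t"
proof -
  define s where "s = sqrt (2 * pi) ^ DIM('a)"
  have s: "s * s = (2 * pi) ^ DIM('a)"
    unfolding s_def power_mult_distrib[symmetric] by simp
  have [measurable]: "f \<in> borel_measurable borel" "fourier f \<in> borel_measurable borel"
    using f fh by simp_all
  let ?L = "\<lambda>\<epsilon>. \<integral>\<zeta>. fourier f \<zeta> * exp (\<i> * complex_of_real (t \<bullet> \<zeta>)) * complex_of_real (gauss (\<epsilon> *\<^sub>R \<zeta>)) \<partial>lborel"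
  let ?R = "\<lambda>\<epsilon>. \<integral>x. f (t + (-\<epsilon>) *\<^sub>R x) * complex_of_real (gauss x) \<partial>lborel"
  have eq: "?L \<epsilon> = complex_of_real s * ?R \<epsilon>" if \<epsilon>: "\<epsilon> > 0" for \<epsilon>
  proof -
    have gi: "integrable lborel (\<lambda>\<zeta>::'a. complex_of_real (gauss (\<epsilon> *\<^sub>R \<zeta>)))"
      using integrable_lborel_affine[OF integrable_gauss, of \<epsilon> "0::'a"] \<epsilon> by simp
    let ?F = "\<lambda>\<zeta> y. f y * exp (- (\<i> * complex_of_real (y \<bullet> \<zeta>))) * (exp (\<i> * complex_of_real (t \<bullet> \<zeta>)) * complex_of_real (gauss (\<epsilon> *\<^sub>R \<zeta>)))"
    have F: "integrable (lborel \<Otimes>\<^sub>M lborel) (case_prod ?F)"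
    proof (rule lborel_pair.Fubini_integrable)
      show "case_prod ?F \<in> borel_measurable (lborel \<Otimes>\<^sub>M lborel)" by measurable
      have "(\<lambda>x. \<integral>y. norm (case (x, y) of (\<zeta>, y) \<Rightarrow> ?F \<zeta> y) \<partial>lborel) = (\<lambda>x. (\<integral>y. norm (f y) \<partial>lborel) * norm (complex_of_real (gauss (\<epsilon> *\<^sub>R x))))"
        by (simp add: norm_mult)
      then show "integrable lborel (\<lambda>x. \<integral>y. norm (case (x, y) of (\<zeta>, y) \<Rightarrow> ?F \<zeta> y) \<partial>lborel)"
        using gi integrable_norm[OF gi] by simp
      show "AE x in lborel. integrable lborel (\<lambda>y. case (x, y) of (\<zeta>, y) \<Rightarrow> ?F \<zeta> y)"
      proof (rule AE_I2)
        fix x :: 'a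
        show "integrable lborel (\<lambda>y. case (x, y) of (\<zeta>, y) \<Rightarrow> ?F \<zeta> y)"
          unfolding prod.case
          by (intro integrable_mult_left, rule Bochner_Integration.integrable_bound[OF f])
             (auto simp: norm_mult)
      qed
    qed
    have "?L \<epsilon> = (\<integral>\<zeta>. (\<integral>y. ?F \<zeta> y \<partial>lborel) \<partial>lborel)"
      unfolding fourier_def integral_mult_left_zero by (simp add: mult.assoc)
    also have "\<dots> = (\<integral>y. (\<integral>\<zeta>. ?F \<zeta> y \<partial>lborel) \<partial>lborel)"
      using lborel_pair.Fubini_integral[OF F] by simp
    also have "\<dots> = (\<integral>y. f y * complex_of_real (s / \<epsilon> ^ DIM('a) * gauss ((1 / \<epsilon>) *\<^sub>R (t - y))) \<partial>lborel)"
    proof (rule Bochner_Integration.integral_cong[OF refl])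
      fix y :: 'a
      let ?H = "\<lambda>x::'a. complex_of_real (gauss x) * exp (\<i> * complex_of_real ((1 / \<epsilon>) *\<^sub>R (t - y) \<bullet> x))"
      have [measurable]: "?H \<in> borel_measurable borel" by measurable
      have "(\<integral>\<zeta>. ?F \<zeta> y \<partial>lborel) = f y * (\<integral>\<zeta>. ?H (0 + \<epsilon> *\<^sub>R \<zeta>) \<partial>lborel)"
      proof (subst integral_mult_right_zero[symmetric], rule Bochner_Integration.integral_cong[OF refl])
        fix \<zeta>
        have "exp (- (\<i> * complex_of_real (y \<bullet> \<zeta>))) * exp (\<i> * complex_of_real (t \<bullet> \<zeta>)) = exp (\<i> * complex_of_real ((1 / \<epsilon>) *\<^sub>R (t - y) \<bullet> (0 + \<epsilon> *\<^sub>R \<zeta>)))"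
          using \<epsilon> by (simp add: inner_diff_left algebra_simps flip: exp_add)
        then show "?F \<zeta> y = f y * ?H (0 + \<epsilon> *\<^sub>R \<zeta>)" by (simp add: mult_ac)
      qed
      also have "(\<integral>\<zeta>. ?H (0 + \<epsilon> *\<^sub>R \<zeta>) \<partial>lborel) = (\<integral>x. ?H x \<partial>lborel) / \<epsilon> ^ DIM('a)"
        using integral_lborel_affine[of ?H \<epsilon> 0] \<epsilon> by (simp add: scaleR_conv_of_real)
      also have "(\<integral>x. ?H x \<partial>lborel) = complex_of_real (s * gauss ((1 / \<epsilon>) *\<^sub>R (t - y)))"
        unfolding s_def by (rule fourier_gauss)
      finally show "(\<integral>\<zeta>. ?F \<zeta> y \<partial>lborel) = f y * complex_of_real (s / \<epsilon> ^ DIM('a) * gauss ((1 / \<epsilon>) *\<^sub>R (t - y)))"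
        by simp
    qed
    \<comment> \<open>Substituting \<open>t - \<epsilon> *\<^sub>R x\<close> for \<open>y\<close>
      turns the shrinking Gaussian into a fixed weight, so that \<epsilon> survives only inside
      \<open>f\<close>; the Jacobian cancels \<open>\<epsilon> ^ DIM('a)\<close>.\<close>
    also have "\<dots> = \<epsilon> ^ DIM('a) *\<^sub>R (\<integral>x. f (t + (-\<epsilon>) *\<^sub>R x) * complex_of_real (s / \<epsilon> ^ DIM('a) * gauss ((1 / \<epsilon>) *\<^sub>R (t - (t + (-\<epsilon>) *\<^sub>R x)))) \<partial>lborel)"
      by (subst integral_lborel_affine[where c = "-\<epsilon>" and t = t]) (use \<epsilon> in auto)
    also have "\<dots> = \<epsilon> ^ DIM('a) *\<^sub>R (\<integral>x. complex_of_real (s / \<epsilon> ^ DIM('a)) * (f (t + (-\<epsilon>) *\<^sub>R x) * complex_of_real (gauss x)) \<partial>lborel)"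
      using \<epsilon> by (intro arg_cong[where f = "\<lambda>x. _ *\<^sub>R x"] Bochner_Integration.integral_cong refl) simp
    also have "\<dots> = complex_of_real s * ?R \<epsilon>"
      using \<epsilon> by (subst integral_mult_right_zero) (simp add: scaleR_conv_of_real)
    finally show ?thesis .
  qed
  \<comment> \<open>A sequence decreasing to 0 replaces the limit in \<epsilon>, as dominated
    convergence is formulated for sequences.\<close>
  let ?e = "\<lambda>n::nat. 1 / real (Suc n)"
  have e0: "?e \<longlonglongrightarrow> 0" using LIMSEQ_inverse_real_of_nat by (simp add: inverse_eq_divide)
  have "(\<lambda>n. ?L (?e n)) \<longlonglongrightarrow> (\<integral>\<zeta>. fourier f \<zeta> * exp (\<i> * complex_of_real (t \<bullet> \<zeta>)) \<partial>lborel)"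
  proof (rule integral_dominated_convergence[where w = "\<lambda>\<zeta>. norm (fourier f \<zeta>)"])
    show "AE x in lborel. (\<lambda>n. fourier f x * exp (\<i> * complex_of_real (t \<bullet> x)) * complex_of_real (gauss (?e n *\<^sub>R x))) \<longlonglongrightarrow> fourier f x * exp (\<i> * complex_of_real (t \<bullet> x))"
    proof (rule AE_I2)
      fix x :: 'a
      have "(\<lambda>n. fourier f x * exp (\<i> * complex_of_real (t \<bullet> x)) * complex_of_real (gauss (?e n *\<^sub>R x))) \<longlonglongrightarrow> fourier f x * exp (\<i> * complex_of_real (t \<bullet> x)) * complex_of_real (exp (- (norm (0 *\<^sub>R x))\<^sup>2 / 2))"
        unfolding gauss_def by (intro tendsto_intros e0) auto
      then show "(\<lambda>n. fourier f x * exp (\<i> * complex_of_real (t \<bullet> x)) * complex_of_real (gauss (?e n *\<^sub>R x))) \<longlonglongrightarrow> fourier f x * exp (\<i> * complex_of_real (t \<bullet> x))" by simp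
    qed
    show "\<And>n. AE x in lborel. norm (fourier f x * exp (\<i> * complex_of_real (t \<bullet> x)) * complex_of_real (gauss (?e n *\<^sub>R x))) \<le> norm (fourier f x)"
      by (auto simp: norm_mult gauss_def intro!: mult_left_le)
    show "\<And>n. (\<lambda>x. fourier f x * exp (\<i> * complex_of_real (t \<bullet> x)) * complex_of_real (gauss (?e n *\<^sub>R x))) \<in> borel_measurable lborel"
      by measurable
    show "(\<lambda>x. fourier f x * exp (\<i> * complex_of_real (t \<bullet> x))) \<in> borel_measurable lborel"
      by measurable
    show "integrable lborel (\<lambda>\<zeta>. norm (fourier f \<zeta>))"
      using fh by (rule integrable_norm)
  qed
  moreover have "(\<lambda>n. ?L (?e n)) = (\<lambda>n. complex_of_real s * ?R (?e n))"
    by (intro ext eq) simp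
  moreover have "(\<lambda>n. complex_of_real s * ?R (?e n)) \<longlonglongrightarrow> complex_of_real s * (\<integral>x. f t * complex_of_real (gauss (x::'a)) \<partial>lborel)"
  proof (rule tendsto_mult_left, rule integral_dominated_convergence[where w = "\<lambda>x::'a. B * gauss x"])
    show "AE x in lborel. (\<lambda>n. f (t + - ?e n *\<^sub>R x) * complex_of_real (gauss x)) \<longlonglongrightarrow> f t * complex_of_real (gauss x)"
    proof (rule AE_I2)
      fix x :: 'a
      have "(\<lambda>n. t + - ?e n *\<^sub>R x) \<longlonglongrightarrow> t + - 0 *\<^sub>R x" by (intro tendsto_intros e0)
      then have "(\<lambda>n. f (t + - ?e n *\<^sub>R x)) \<longlonglongrightarrow> f t"
        by (intro continuous_on_tendsto_compose[OF cont]) auto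
      then show "(\<lambda>n. f (t + - ?e n *\<^sub>R x) * complex_of_real (gauss x)) \<longlonglongrightarrow> f t * complex_of_real (gauss x)"
        by (intro tendsto_intros)
    qed
    show "AE x in lborel. norm (f (t + - ?e n *\<^sub>R x) * complex_of_real (gauss x)) \<le> B * gauss x" for n
      by (auto simp: norm_mult gauss_def intro!: bdd)
    show "integrable lborel (\<lambda>x::'a. B * gauss x)" by (intro integrable_mult_right integrable_gauss)
    show "(\<lambda>x::'a. f t * complex_of_real (gauss x)) \<in> borel_measurable lborel" by measurable
    show "(\<lambda>x. f (t + - ?e n *\<^sub>R x) * complex_of_real (gauss x)) \<in> borel_measurable lborel" for n by measurable
  qed
  ultimately have "(\<integral>\<zeta>. fourier f \<zeta> * exp (\<i> * complex_of_real (t \<bullet> \<zeta>)) \<partial>lborel)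
      = complex_of_real s * (\<integral>x. f t * complex_of_real (gauss (x::'a)) \<partial>lborel)"
    by (metis (no_types, lifting) LIMSEQ_unique)
  \<comment> \<open>The total mass of \<open>gauss\<close> is its transform at 0, which is
    \<open>s\<close> once more.\<close>
  also have "\<dots> = complex_of_real (s * s) * f t"
    using fourier_gauss(2)[of "0::'a"] by (simp add: s_def gauss_def)
  finally show ?thesis unfolding s .
qed

section \<open>Fourier series on a cube\<close>

lemma int_lattice_add: "j \<in> int_lattice \<Longrightarrow> k \<in> int_lattice \<Longrightarrow> j + k \<in> int_lattice"
  by (auto simp: int_lattice_def inner_add_left)

lemma int_lattice_diff: "j \<in> int_lattice \<Longrightarrow> k \<in> int_lattice \<Longrightarrow> j - k \<in> int_lattice"
  by (auto simp: int_lattice_def inner_diff_left)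

lemma int_lattice_uminus: "j \<in> int_lattice \<Longrightarrow> - j \<in> int_lattice"
  by (auto simp: int_lattice_def)

lemma zero_in_int_lattice: "0 \<in> int_lattice"
  by (auto simp: int_lattice_def)

lemma Basis_subset_int_lattice: "i \<in> Basis \<Longrightarrow> i \<in> int_lattice"
  by (auto simp: int_lattice_def inner_Basis)

text \<open>With this sign, integrating against the conjugate of \<open>trig_exp \<beta> j\<close>
  produces the phase that a packet acquires by translation to the node with index
  \<open>j\<close>.\<close>

definition trig_exp :: "real \<Rightarrow> 'a::euclidean_space \<Rightarrow> 'a \<Rightarrow> complex" where
  "trig_exp \<beta> j x = exp (- (\<i> * complex_of_real (\<beta> * (j \<bullet> x))))"

text \<open>Centred at the origin with half side \<open>T\<close>, so that
  \<open>cube (pi / \<beta>)\<close> is a full period cell of all \<open>trig_exp \<beta> j\<close>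
  with \<open>j\<close> in \<open>int_lattice\<close>.\<close>

definition cube :: "real \<Rightarrow> 'a::euclidean_space set" where
  "cube T = cbox (- (T *\<^sub>R One)) (T *\<^sub>R One)"

lemma mem_cube: "x \<in> cube T \<longleftrightarrow> (\<forall>i\<in>Basis. \<bar>x \<bullet> i\<bar> \<le> T)"
  by (auto simp: cube_def mem_box abs_le_iff minus_le_iff)

lemma continuous_on_trig_exp [continuous_intros]: "continuous_on A (trig_exp \<beta> j)"
  unfolding trig_exp_def by (intro continuous_intros)

lemma trig_exp_add: "trig_exp \<beta> (j + k) x = trig_exp \<beta> j x * trig_exp \<beta> k x"
  by (simp add: trig_exp_def inner_add_left algebra_simps flip: exp_add)

lemma trig_exp_mult_cnj: "trig_exp \<beta> j x * cnj (trig_exp \<beta> k x) = trig_exp \<beta> (j - k) x"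
  by (simp add: trig_exp_def inner_diff_left algebra_simps exp_cnj flip: exp_add)

text \<open>For nonzero \<open>m\<close> the antiderivative takes equal values at the two ends,
  because the exponents there differ by \<open>2 * pi * \<i> * m\<close>.\<close>

lemma integral_iexp_full_period:
  fixes \<beta> :: real and m :: int
  assumes "\<beta> > 0"
  shows "((\<lambda>y. exp (- (\<i> * complex_of_real (\<beta> * (real_of_int m * y))))) has_integral
           (if m = 0 then complex_of_real (2 * pi / \<beta>) else 0)) {- (pi / \<beta>)..pi / \<beta>}"
proof (cases "m = 0")
  case True
  have "((\<lambda>y. 1) has_integral (measure lborel {- (pi / \<beta>)..pi / \<beta>} *\<^sub>R (1::complex))) {- (pi / \<beta>)..pi / \<beta>}"
    by (rule has_integral_const_real)
  then show ?thesis using True assms by (simp add: scaleR_conv_of_real)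
next
  case False
  define c where "c = - (\<i> * complex_of_real (\<beta> * real_of_int m))"
  have c: "c \<noteq> 0" using False assms by (simp add: c_def)
  have d: "((\<lambda>y. exp (c * complex_of_real y) / c) has_vector_derivative exp (c * complex_of_real y)) (at y within S)"
    for y S
    using c by (auto intro!: derivative_eq_intros has_vector_derivative_real_field simp: field_simps)
  have "((\<lambda>y. exp (c * complex_of_real y)) has_integral
      exp (c * complex_of_real (pi / \<beta>)) / c - exp (c * complex_of_real (- (pi / \<beta>))) / c) {- (pi / \<beta>)..pi / \<beta>}"
    by (rule fundamental_theorem_of_calculus[OF _ d]) (use assms in auto)
  moreover have "exp (c * complex_of_real (- (pi / \<beta>))) = exp (c * complex_of_real (pi / \<beta>))"
  proof (subst exp_eq, rule exI[of _ "m"])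
    show "c * complex_of_real (- (pi / \<beta>)) = c * complex_of_real (pi / \<beta>) + complex_of_real (of_int (2 * m) * pi) * \<i>"
      using assms by (simp add: c_def field_simps)
  qed
  ultimately show ?thesis using False by (simp add: c_def mult_ac)
qed

lemma has_integral_trig_exp:
  fixes j :: "'a::euclidean_space"
  assumes \<beta>: "\<beta> > 0" and j: "j \<in> int_lattice"
  shows "(trig_exp \<beta> j has_integral (if j = 0 then complex_of_real ((2 * pi / \<beta>) ^ DIM('a)) else 0)) (cube (pi / \<beta>))"
proof -
  \<comment> \<open>The indicator of the interval is part of each factor. The product over the
    coordinates is then the indicator of the cube times the character, and the product formula on
    the whole space applies.\<close>
  define f where "f i y = indicat_real {- (pi / \<beta>)..pi / \<beta>} y *\<^sub>R exp (- (\<i> * complex_of_real (\<beta> * ((j \<bullet> i) * y))))" for i y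
  have fi: "integrable lborel (f i)" for i
    unfolding f_def by (intro borel_integrable_compact continuous_intros) auto
  have f1: "(\<integral>y. f i y \<partial>lborel) = (if j \<bullet> i = 0 then complex_of_real (2 * pi / \<beta>) else 0)" if "i \<in> Basis" for i
  proof -
    obtain m where m: "j \<bullet> i = real_of_int m" using j \<open>i \<in> Basis\<close> by (auto simp: int_lattice_def elim: Ints_cases)
    have si: "set_integrable lborel {- (pi / \<beta>)..pi / \<beta>} (\<lambda>y. exp (- (\<i> * complex_of_real (\<beta> * ((j \<bullet> i) * y)))))"
      using fi[of i] unfolding set_integrable_def f_def .
    have "(\<integral>y. f i y \<partial>lborel) = integral {- (pi / \<beta>)..pi / \<beta>} (\<lambda>y. exp (- (\<i> * complex_of_real (\<beta> * ((j \<bullet> i) * y)))))"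
      using set_borel_integral_eq_integral(2)[OF si] unfolding set_lebesgue_integral_def f_def .
    also have "\<dots> = (if m = 0 then complex_of_real (2 * pi / \<beta>) else 0)"
      unfolding m by (rule integral_unique[OF integral_iexp_full_period[OF \<beta>]])
    finally show ?thesis by (simp add: m)
  qed
  have eq: "indicat_real (cube (pi / \<beta>)) x *\<^sub>R trig_exp \<beta> j x = (\<Prod>i\<in>Basis. f i (x \<bullet> i))" for x :: 'a
  proof (cases "x \<in> cube (pi / \<beta>)")
    case True
    then have "(\<Prod>i\<in>Basis. f i (x \<bullet> i)) = (\<Prod>i\<in>Basis. exp (- (\<i> * complex_of_real (\<beta> * ((j \<bullet> i) * (x \<bullet> i))))))"
      by (intro prod.cong) (auto simp: f_def mem_cube abs_le_iff indicator_def minus_le_iff)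
    also have "\<dots> = trig_exp \<beta> j x"
      unfolding trig_exp_def euclidean_inner[of j x]
      by (simp add: sum_distrib_left sum_negf flip: exp_sum)
    finally show ?thesis using True by simp
  next
    case False
    then obtain i where "i \<in> Basis" "\<not> \<bar>x \<bullet> i\<bar> \<le> pi / \<beta>" by (auto simp: mem_cube)
    then have "f i (x \<bullet> i) = 0" by (auto simp: f_def indicator_def abs_le_iff)
    then show ?thesis using False \<open>i \<in> Basis\<close> by (auto simp: prod_zero_iff)
  qed
  have si: "set_integrable lborel (cube (pi / \<beta>)) (trig_exp \<beta> j)"
    unfolding set_integrable_def eq by (rule integrable_lborel_prod[OF fi])
  have "integral (cube (pi / \<beta>)) (trig_exp \<beta> j) = (\<Prod>i\<in>Basis. \<integral>y. f i y \<partial>lborel)"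
    using set_borel_integral_eq_integral(2)[OF si]
    unfolding set_lebesgue_integral_def eq integral_lborel_prod[OF fi] by simp
  also have "\<dots> = (\<Prod>i\<in>Basis. if j \<bullet> i = 0 then complex_of_real (2 * pi / \<beta>) else 0)"
    by (rule prod.cong) (auto simp: f1)
  also have "\<dots> = (if j = 0 then complex_of_real ((2 * pi / \<beta>) ^ DIM('a)) else 0)"
  proof (cases "j = 0")
    case False
    then obtain i where "i \<in> Basis" "j \<bullet> i \<noteq> 0" using euclidean_all_zero_iff[of j] by blast
    then show ?thesis using False by (auto simp: prod_zero_iff)
  qed simp
  finally show ?thesis
    using integrable_integral[OF set_borel_integral_eq_integral(1)[OF si]] by simp
qed

text \<open>Orthogonality of the characters and completing the square. The coefficients
  \<open>a\<close> are left arbitrary on purpose: \<open>a j = c j / V\<close> gives Bessel's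
  inequality, and for any other choice the last summand is nonnegative, so that the squared distance
  dominates the Bessel defect.\<close>

lemma L2_distance_trig_sum:
  fixes G :: "'a::euclidean_space \<Rightarrow> complex"
  assumes \<beta>: "\<beta> > 0" and G: "continuous_on (cube (pi / \<beta>)) G"
    and F: "finite F" "F \<subseteq> int_lattice"
  defines "V \<equiv> (2 * pi / \<beta>) ^ DIM('a)"
    and "c j \<equiv> integral (cube (pi / \<beta>)) (\<lambda>x. G x * cnj (trig_exp \<beta> j x))"
  shows "integral (cube (pi / \<beta>)) (\<lambda>x. (norm (G x - (\<Sum>j\<in>F. a j * trig_exp \<beta> j x)))\<^sup>2)
    = integral (cube (pi / \<beta>)) (\<lambda>x. (norm (G x))\<^sup>2) - (\<Sum>j\<in>F. (norm (c j))\<^sup>2) / V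
      + V * (\<Sum>j\<in>F. (norm (a j - c j / V))\<^sup>2)"
proof -
  let ?Q = "cube (pi / \<beta>) :: 'a set"
  define S where "S x = (\<Sum>j\<in>F. a j * trig_exp \<beta> j x)" for x
  have V: "V > 0" using \<beta> by (simp add: V_def)
  have S: "continuous_on ?Q S" unfolding S_def by (intro continuous_intros)
  have ct: "(\<lambda>x. f x) integrable_on ?Q" if "continuous_on ?Q f" for f :: "'a \<Rightarrow> complex"
    using that unfolding cube_def by (rule integrable_continuous)
  have ctr: "(\<lambda>x. f x) integrable_on ?Q" if "continuous_on ?Q f" for f :: "'a \<Rightarrow> real"
    using that unfolding cube_def by (rule integrable_continuous)
  have hc: "((\<lambda>x. G x * cnj (trig_exp \<beta> j x)) has_integral c j) ?Q" for j
    unfolding c_def by (intro integrable_integral ct continuous_intros G)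
  have GG: "((\<lambda>x. G x * cnj (G x)) has_integral complex_of_real (integral ?Q (\<lambda>x. (norm (G x))\<^sup>2))) ?Q"
  proof -
    have "((\<lambda>x. (norm (G x))\<^sup>2) has_integral integral ?Q (\<lambda>x. (norm (G x))\<^sup>2)) ?Q"
      by (intro integrable_integral ctr continuous_intros G)
    from has_integral_linear[OF this bounded_linear_of_real[where 'a=complex]]
    show ?thesis unfolding o_def complex_norm_square .
  qed
  have NN: "((\<lambda>x. (G x - S x) * cnj (G x - S x)) has_integral
      complex_of_real (integral ?Q (\<lambda>x. (norm (G x - S x))\<^sup>2))) ?Q"
  proof -
    have "((\<lambda>x. (norm (G x - S x))\<^sup>2) has_integral integral ?Q (\<lambda>x. (norm (G x - S x))\<^sup>2)) ?Q"
      by (intro integrable_integral ctr continuous_intros G S)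
    from has_integral_linear[OF this bounded_linear_of_real[where 'a=complex]]
    show ?thesis unfolding o_def complex_norm_square .
  qed
  have "((\<lambda>x. \<Sum>j\<in>F. cnj (a j) * (G x * cnj (trig_exp \<beta> j x))) has_integral (\<Sum>j\<in>F. cnj (a j) * c j)) ?Q"
    by (intro has_integral_sum F has_integral_mult_right hc)
  then have GS: "((\<lambda>x. G x * cnj (S x)) has_integral (\<Sum>j\<in>F. cnj (a j) * c j)) ?Q"
    by (simp add: S_def sum_distrib_left mult_ac)
  from has_integral_linear[OF this bounded_linear_cnj]
  have SG: "((\<lambda>x. S x * cnj (G x)) has_integral (\<Sum>j\<in>F. a j * cnj (c j))) ?Q"
    by (simp add: o_def mult_ac)
  have "((\<lambda>x. \<Sum>j\<in>F. \<Sum>k\<in>F. a j * cnj (a k) * trig_exp \<beta> (j - k) x) has_integral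
      (\<Sum>j\<in>F. \<Sum>k\<in>F. a j * cnj (a k) * (if j - k = 0 then complex_of_real V else 0))) ?Q"
    unfolding V_def using F
    by (intro has_integral_sum has_integral_mult_right has_integral_trig_exp \<beta> int_lattice_diff) auto
  moreover have "(\<Sum>j\<in>F. \<Sum>k\<in>F. a j * cnj (a k) * trig_exp \<beta> (j - k) x) = S x * cnj (S x)" for x
    unfolding S_def cnj_sum sum_product trig_exp_mult_cnj[symmetric] by (simp add: mult_ac)
  moreover have "(\<Sum>j\<in>F. \<Sum>k\<in>F. a j * cnj (a k) * (if j - k = 0 then complex_of_real V else 0))
      = (\<Sum>j\<in>F. a j * cnj (a j) * complex_of_real V)"
    using F by (intro sum.cong refl) (simp add: if_distrib sum.delta cong: if_cong)
  ultimately have SS: "((\<lambda>x. S x * cnj (S x)) has_integral (\<Sum>j\<in>F. a j * cnj (a j) * complex_of_real V)) ?Q"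
    by simp
  have *: "((\<lambda>x. (G x * cnj (G x) - G x * cnj (S x)) - (S x * cnj (G x) - S x * cnj (S x))) has_integral
      (complex_of_real (integral ?Q (\<lambda>x. (norm (G x))\<^sup>2)) - (\<Sum>j\<in>F. cnj (a j) * c j))
       - ((\<Sum>j\<in>F. a j * cnj (c j)) - (\<Sum>j\<in>F. a j * cnj (a j) * complex_of_real V))) ?Q"
    by (intro has_integral_diff GG GS SG SS)
  have "(\<lambda>x. (G x * cnj (G x) - G x * cnj (S x)) - (S x * cnj (G x) - S x * cnj (S x)))
      = (\<lambda>x. (G x - S x) * cnj (G x - S x))"
    by (auto simp: algebra_simps)
  note * = *[unfolded this]
  have "complex_of_real (integral ?Q (\<lambda>x. (norm (G x - S x))\<^sup>2)) =
      (complex_of_real (integral ?Q (\<lambda>x. (norm (G x))\<^sup>2)) - (\<Sum>j\<in>F. cnj (a j) * c j))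
       - ((\<Sum>j\<in>F. a j * cnj (c j)) - (\<Sum>j\<in>F. a j * cnj (a j) * complex_of_real V))"
    by (rule has_integral_unique[OF NN *])
  also have "\<dots> = complex_of_real (integral ?Q (\<lambda>x. (norm (G x))\<^sup>2)) +
      (\<Sum>j\<in>F. a j * cnj (a j) * V - a j * cnj (c j) - cnj (a j) * c j)"
    by (simp add: sum_subtractf)
  also have "(\<Sum>j\<in>F. a j * cnj (a j) * V - a j * cnj (c j) - cnj (a j) * c j)
      = (\<Sum>j\<in>F. V * complex_of_real ((norm (a j - c j / V))\<^sup>2) - complex_of_real ((norm (c j))\<^sup>2) / V)"
    using V by (intro sum.cong refl) (simp add: complex_norm_square field_simps del: of_real_power)
  also have "\<dots> = complex_of_real (V * (\<Sum>j\<in>F. (norm (a j - c j / V))\<^sup>2) - (\<Sum>j\<in>F. (norm (c j))\<^sup>2) / V)"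
    by (simp add: sum_subtractf sum_distrib_left sum_divide_distrib)
  finally have "complex_of_real (integral ?Q (\<lambda>x. (norm (G x - S x))\<^sup>2)) = complex_of_real
      (integral ?Q (\<lambda>x. (norm (G x))\<^sup>2) + (V * (\<Sum>j\<in>F. (norm (a j - c j / V))\<^sup>2) - (\<Sum>j\<in>F. (norm (c j))\<^sup>2) / V))"
    by simp
  then show ?thesis unfolding of_real_eq_iff S_def by simp
qed

section \<open>Uniform density of trigonometric polynomials\<close>

definition trig_poly :: "real \<Rightarrow> ('a::euclidean_space \<Rightarrow> complex) \<Rightarrow> bool" where
  "trig_poly \<beta> f \<longleftrightarrow> (\<exists>F a. finite F \<and> F \<subseteq> int_lattice \<and> (\<forall>x. f x = (\<Sum>j\<in>F. a j * trig_exp \<beta> j x)))"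

lemma trig_poly_monomial: "j \<in> int_lattice \<Longrightarrow> trig_poly \<beta> (\<lambda>x. c * trig_exp \<beta> j x)"
  unfolding trig_poly_def by (intro exI[of _ "{j}"] exI[of _ "\<lambda>_. c"]) auto

lemma trig_poly_add:
  assumes "trig_poly \<beta> f" "trig_poly \<beta> g"
  shows "trig_poly \<beta> (\<lambda>x. f x + g x)"
proof -
  obtain F a where F: "finite F" "F \<subseteq> int_lattice" "\<And>x. f x = (\<Sum>j\<in>F. a j * trig_exp \<beta> j x)"
    using assms(1) unfolding trig_poly_def by blast
  obtain K b where K: "finite K" "K \<subseteq> int_lattice" "\<And>x. g x = (\<Sum>j\<in>K. b j * trig_exp \<beta> j x)"
    using assms(2) unfolding trig_poly_def by blast
  let ?a = "\<lambda>j. if j \<in> F then a j else 0" and ?b = "\<lambda>j. if j \<in> K then b j else 0"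
  have "f x + g x = (\<Sum>j\<in>F \<union> K. (?a j + ?b j) * trig_exp \<beta> j x)" for x
  proof -
    have "f x = (\<Sum>j\<in>F \<union> K. ?a j * trig_exp \<beta> j x)"
      unfolding F(3) using F K by (intro sum.mono_neutral_cong_left) auto
    moreover have "g x = (\<Sum>j\<in>F \<union> K. ?b j * trig_exp \<beta> j x)"
      unfolding K(3) using F K by (intro sum.mono_neutral_cong_left) auto
    ultimately show ?thesis by (simp add: sum.distrib distrib_right)
  qed
  then show ?thesis unfolding trig_poly_def using F K
    by (intro exI[of _ "F \<union> K"] exI[of _ "\<lambda>j. ?a j + ?b j"]) auto
qed

lemma trig_poly_const: "trig_poly \<beta> (\<lambda>x. c)"
  using trig_poly_monomial[OF zero_in_int_lattice, of \<beta> c] by (simp add: trig_exp_def)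

lemma trig_poly_sum:
  "finite A \<Longrightarrow> (\<And>i. i \<in> A \<Longrightarrow> trig_poly \<beta> (f i)) \<Longrightarrow> trig_poly \<beta> (\<lambda>x. \<Sum>i\<in>A. f i x)"
  by (induction A rule: finite_induct) (simp_all add: trig_poly_const trig_poly_add)

lemma trig_poly_mult:
  assumes "trig_poly \<beta> f" "trig_poly \<beta> g"
  shows "trig_poly \<beta> (\<lambda>x. f x * g x)"
proof -
  obtain F a where F: "finite F" "F \<subseteq> int_lattice" "\<And>x. f x = (\<Sum>j\<in>F. a j * trig_exp \<beta> j x)"
    using assms(1) unfolding trig_poly_def by blast
  obtain K b where K: "finite K" "K \<subseteq> int_lattice" "\<And>x. g x = (\<Sum>j\<in>K. b j * trig_exp \<beta> j x)"
    using assms(2) unfolding trig_poly_def by blast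
  have "f x * g x = (\<Sum>j\<in>F. \<Sum>k\<in>K. (a j * b k) * trig_exp \<beta> (j + k) x)" for x
    unfolding F(3) K(3) sum_product trig_exp_add by (simp add: mult_ac)
  moreover have "trig_poly \<beta> (\<lambda>x. \<Sum>j\<in>F. \<Sum>k\<in>K. (a j * b k) * trig_exp \<beta> (j + k) x)"
    using F K by (intro trig_poly_sum trig_poly_monomial int_lattice_add) auto
  ultimately show ?thesis by simp
qed

lemma trig_poly_cos: "i \<in> Basis \<Longrightarrow> trig_poly \<beta> (\<lambda>x. complex_of_real (cos (\<beta> * (x \<bullet> i))))"
  and trig_poly_sin: "i \<in> Basis \<Longrightarrow> trig_poly \<beta> (\<lambda>x. complex_of_real (sin (\<beta> * (x \<bullet> i))))"
proof -
  assume i: "i \<in> Basis"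
  have "trig_poly \<beta> (\<lambda>x. (1 / 2) * trig_exp \<beta> i x + (1 / 2) * trig_exp \<beta> (- i) x)"
    "trig_poly \<beta> (\<lambda>x. (\<i> / 2) * trig_exp \<beta> i x + (- \<i> / 2) * trig_exp \<beta> (- i) x)"
    by (intro trig_poly_add trig_poly_monomial int_lattice_uminus Basis_subset_int_lattice i)+
  moreover have "(1 / 2) * trig_exp \<beta> i x + (1 / 2) * trig_exp \<beta> (- i) x = complex_of_real (cos (\<beta> * (x \<bullet> i)))"
    "(\<i> / 2) * trig_exp \<beta> i x + (- \<i> / 2) * trig_exp \<beta> (- i) x = complex_of_real (sin (\<beta> * (x \<bullet> i)))" for x
    unfolding cos_of_real[symmetric] sin_of_real[symmetric] cos_exp_eq sin_exp_eq trig_exp_def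
    by (simp_all add: inner_commute field_simps)
  ultimately show "trig_poly \<beta> (\<lambda>x. complex_of_real (cos (\<beta> * (x \<bullet> i))))"
    "trig_poly \<beta> (\<lambda>x. complex_of_real (sin (\<beta> * (x \<bullet> i))))" by simp_all
qed

text \<open>Stone-Weierstrass on a torus. The torus identifies opposite faces of the cube, and since
  \<open>g\<close> vanishes on all faces it descends to a continuous function there.\<close>

lemma trig_poly_dense_real:
  fixes g :: "'a::euclidean_space \<Rightarrow> real"
  assumes \<beta>: "\<beta> > 0" and g: "continuous_on (cube (pi / \<beta>)) g"
    and g0: "\<And>x i. x \<in> cube (pi / \<beta>) \<Longrightarrow> i \<in> Basis \<Longrightarrow> \<bar>x \<bullet> i\<bar> = pi / \<beta> \<Longrightarrow> g x = 0"
    and e: "e > 0"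
  obtains f where "trig_poly \<beta> (\<lambda>x. complex_of_real (f x))" "\<And>x. x \<in> cube (pi / \<beta>) \<Longrightarrow> \<bar>g x - f x\<bar> < e"
proof -
  let ?Q = "cube (pi / \<beta>) :: 'a set"
  \<comment> \<open>The torus is embedded in \<open>'a \<times> 'a\<close> by the cosines and sines
    of the coordinates, which are themselves trigonometric polynomials.\<close>
  define W :: "'a \<Rightarrow> 'a \<times> 'a" where
    "W x = (\<Sum>i\<in>Basis. cos (\<beta> * (x \<bullet> i)) *\<^sub>R i, \<Sum>i\<in>Basis. sin (\<beta> * (x \<bullet> i)) *\<^sub>R i)" for x
  have W1: "fst (W x) \<bullet> i = cos (\<beta> * (x \<bullet> i))" "snd (W x) \<bullet> i = sin (\<beta> * (x \<bullet> i))" if "i \<in> Basis" for x i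
    using that by (simp_all add: W_def inner_sum_left inner_Basis if_distrib sum.delta cong: if_cong)
  have Wc: "continuous_on A W" for A unfolding W_def by (intro continuous_intros)
  have Qc: "compact ?Q" by (simp add: cube_def compact_cbox)
  \<comment> \<open>Distinct points of the cube with the same image differ in some coordinate by a
    nonzero multiple of the period \<open>2 * pi / \<beta>\<close>; the size of the cube then forces
    both onto faces, where \<open>g\<close> vanishes.\<close>
  have inj: "g x = g y" if x: "x \<in> ?Q" and y: "y \<in> ?Q" and W: "W x = W y" for x y
  proof (cases "x = y")
    case False
    then obtain i where i: "i \<in> Basis" "x \<bullet> i \<noteq> y \<bullet> i" using euclidean_eq_iff[of x y] by blast
    have "sin (\<beta> * (x \<bullet> i)) = sin (\<beta> * (y \<bullet> i)) \<and> cos (\<beta> * (x \<bullet> i)) = cos (\<beta> * (y \<bullet> i))"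
      using W W1[OF i(1), of x] W1[OF i(1), of y] by simp
    then obtain n :: int where n: "\<beta> * (x \<bullet> i) = \<beta> * (y \<bullet> i) + 2 * pi * of_int n"
      unfolding sin_cos_eq_iff by auto
    have b: "\<bar>x \<bullet> i\<bar> \<le> pi / \<beta>" "\<bar>y \<bullet> i\<bar> \<le> pi / \<beta>" using x y i by (auto simp: mem_cube)
    then have b': "\<bar>\<beta> * (x \<bullet> i)\<bar> \<le> pi" "\<bar>\<beta> * (y \<bullet> i)\<bar> \<le> pi"
      using \<beta> by (auto simp: abs_mult field_simps)
    have n0: "n \<noteq> 0" using n i \<beta> by auto
    then have "\<bar>real_of_int n\<bar> \<ge> 1" by linarith
    then have "2 * pi * \<bar>real_of_int n\<bar> \<ge> 2 * pi" by simp
    then have "\<bar>2 * pi * real_of_int n\<bar> \<ge> 2 * pi" by (simp add: abs_mult)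
    then have "\<bar>\<beta> * (x \<bullet> i)\<bar> = pi \<and> \<bar>\<beta> * (y \<bullet> i)\<bar> = pi" using n b' by linarith
    then have "\<bar>x \<bullet> i\<bar> = pi / \<beta>" "\<bar>y \<bullet> i\<bar> = pi / \<beta>" using \<beta> by (auto simp: abs_mult field_simps)
    then show ?thesis using g0[OF x i(1)] g0[OF y i(1)] by simp
  qed simp
  \<comment> \<open>\<open>h\<close> is \<open>g\<close> transported to the torus; by
    \<open>inj\<close> the choice of the preimage does not matter.\<close>
  define h where "h p = g (SOME x. x \<in> ?Q \<and> W x = p)" for p
  have h: "h (W x) = g x" if "x \<in> ?Q" for x
  proof -
    let ?y = "SOME y. y \<in> ?Q \<and> W y = W x"
    have "?y \<in> ?Q \<and> W ?y = W x" by (rule someI[of _ x]) (use that in simp)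
    then show ?thesis unfolding h_def using inj[of ?y x] that by blast
  qed
  have Sc: "compact (W ` ?Q)" by (rule compact_continuous_image[OF Wc Qc])
  \<comment> \<open>The preimage under \<open>h\<close> of a closed set is the image under
    \<open>W\<close> of a compact set, hence closed. This gives continuity without inverting
    \<open>W\<close> locally.\<close>
  have hc: "continuous_on (W ` ?Q) h"
    unfolding continuous_on_closed_vimage[OF compact_imp_closed[OF Sc]]
  proof (intro allI impI)
    fix B :: "real set" assume "closed B"
    then have "closed (g -` B \<inter> ?Q)"
      using g continuous_on_closed_vimage[OF compact_imp_closed[OF Qc], of g] by blast
    then have "compact (?Q \<inter> (g -` B \<inter> ?Q))" using Qc by (intro compact_Int_closed)
    then have "compact (W ` (?Q \<inter> (g -` B \<inter> ?Q)))" by (rule compact_continuous_image[OF Wc])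
    moreover have "W ` (?Q \<inter> (g -` B \<inter> ?Q)) = h -` B \<inter> W ` ?Q" using h by auto
    ultimately show "closed (h -` B \<inter> W ` ?Q)" using compact_imp_closed by metis
  qed
  \<comment> \<open>The algebra of continuous functions on the torus whose pullback along
    \<open>W\<close> is a trigonometric polynomial; the coordinate functions belong to it and
    separate points.\<close>
  let ?P = "\<lambda>f. continuous_on (W ` ?Q) f \<and> trig_poly \<beta> (\<lambda>x. complex_of_real (f (W x)))"
  have "\<exists>f. ?P f \<and> (\<forall>p\<in>W ` ?Q. \<bar>h p - f p\<bar> < e)"
  proof (rule Stone_Weierstrass_HOL[OF Sc _ _ _ _ _ hc e])
    fix p q assume pq: "p \<in> W ` ?Q \<and> q \<in> W ` ?Q \<and> p \<noteq> q"
    then have "fst p \<noteq> fst q \<or> snd p \<noteq> snd q" by (auto simp: prod_eq_iff)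
    then show "\<exists>f. ?P f \<and> f p \<noteq> f q"
    proof
      assume "fst p \<noteq> fst q"
      then obtain i where "i \<in> Basis" "fst p \<bullet> i \<noteq> fst q \<bullet> i" using euclidean_eq_iff[of "fst p"] by blast
      then show ?thesis
        by (intro exI[of _ "\<lambda>p. fst p \<bullet> i"]) (auto simp: W1 intro!: continuous_intros trig_poly_cos)
    next
      assume "snd p \<noteq> snd q"
      then obtain i where "i \<in> Basis" "snd p \<bullet> i \<noteq> snd q \<bullet> i" using euclidean_eq_iff[of "snd p"] by blast
      then show ?thesis
        by (intro exI[of _ "\<lambda>p. snd p \<bullet> i"]) (auto simp: W1 intro!: continuous_intros trig_poly_sin)
    qed
  qed (auto intro!: continuous_intros trig_poly_const trig_poly_add trig_poly_mult)
  then obtain f where "trig_poly \<beta> (\<lambda>x. complex_of_real (f (W x)))" "\<And>p. p \<in> W ` ?Q \<Longrightarrow> \<bar>h p - f p\<bar> < e"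
    by blast
  then show ?thesis by (intro that[of "\<lambda>x. f (W x)"]) (simp_all flip: h)
qed

lemma trig_poly_dense:
  fixes G :: "'a::euclidean_space \<Rightarrow> complex"
  assumes \<beta>: "\<beta> > 0" and G: "continuous_on (cube (pi / \<beta>)) G"
    and G0: "\<And>x i. x \<in> cube (pi / \<beta>) \<Longrightarrow> i \<in> Basis \<Longrightarrow> \<bar>x \<bullet> i\<bar> = pi / \<beta> \<Longrightarrow> G x = 0"
    and e: "e > 0"
  obtains f where "trig_poly \<beta> f" "\<And>x. x \<in> cube (pi / \<beta>) \<Longrightarrow> norm (G x - f x) < e"
proof -
  obtain p where p: "trig_poly \<beta> (\<lambda>x. complex_of_real (p x))" "\<And>x. x \<in> cube (pi / \<beta>) \<Longrightarrow> \<bar>Re (G x) - p x\<bar> < e / 2"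
    by (rule trig_poly_dense_real[OF \<beta>, of "\<lambda>x. Re (G x)" "e / 2"]) (use G G0 e in \<open>auto intro!: continuous_intros\<close>)
  obtain q where q: "trig_poly \<beta> (\<lambda>x. complex_of_real (q x))" "\<And>x. x \<in> cube (pi / \<beta>) \<Longrightarrow> \<bar>Im (G x) - q x\<bar> < e / 2"
    by (rule trig_poly_dense_real[OF \<beta>, of "\<lambda>x. Im (G x)" "e / 2"]) (use G G0 e in \<open>auto intro!: continuous_intros\<close>)
  show ?thesis
  proof (rule that)
    show "trig_poly \<beta> (\<lambda>x. complex_of_real (p x) + \<i> * complex_of_real (q x))"
      by (intro trig_poly_add trig_poly_mult trig_poly_const p q)
    fix x :: 'a assume x: "x \<in> cube (pi / \<beta>)"
    show "norm (G x - (complex_of_real (p x) + \<i> * complex_of_real (q x))) < e"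
      using cmod_le[of "G x - (complex_of_real (p x) + \<i> * complex_of_real (q x))"] p(2)[OF x] q(2)[OF x] by simp
  qed
qed

text \<open>Bessel's inequality bounds all finite sums and gives summability. Conversely,
  \<open>G\<close> vanishes on the faces, so some trigonometric polynomial is uniformly close to it
  on the cube, and the squared L2 distance of the two dominates the Bessel defect for the
  frequencies of the polynomial.\<close>

theorem parseval:
  fixes G :: "'a::euclidean_space \<Rightarrow> complex"
  assumes \<beta>: "\<beta> > 0" and G: "continuous_on (cube (pi / \<beta>)) G"
    and G0: "\<And>x i. x \<in> cube (pi / \<beta>) \<Longrightarrow> i \<in> Basis \<Longrightarrow> \<bar>x \<bullet> i\<bar> = pi / \<beta> \<Longrightarrow> G x = 0"
  shows "((\<lambda>j. (norm (integral (cube (pi / \<beta>)) (\<lambda>x. G x * cnj (trig_exp \<beta> j x))))\<^sup>2) has_sum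
           (2 * pi / \<beta>) ^ DIM('a) * integral (cube (pi / \<beta>)) (\<lambda>x. (norm (G x))\<^sup>2)) int_lattice"
proof -
  let ?Q = "cube (pi / \<beta>) :: 'a set"
  define V where "V = (2 * pi / \<beta>) ^ DIM('a)"
  define c where "c j = integral ?Q (\<lambda>x. G x * cnj (trig_exp \<beta> j x))" for j
  define E where "E = integral ?Q (\<lambda>x. (norm (G x))\<^sup>2)"
  have V: "V > 0" using \<beta> by (simp add: V_def)
  have ctr: "(\<lambda>x. f x) integrable_on ?Q" if "continuous_on ?Q f" for f :: "'a \<Rightarrow> real"
    using that unfolding cube_def by (rule integrable_continuous)
  note dist = L2_distance_trig_sum[OF \<beta> G, folded V_def c_def E_def]
  have bessel: "(\<Sum>j\<in>F. (norm (c j))\<^sup>2) \<le> V * E" if F: "finite F" "F \<subseteq> int_lattice" for F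
  proof -
    have "0 \<le> integral ?Q (\<lambda>x. (norm (G x - (\<Sum>j\<in>F. (c j / V) * trig_exp \<beta> j x)))\<^sup>2)"
      by (intro integral_nonneg ctr continuous_intros G) auto
    also have "\<dots> = E - (\<Sum>j\<in>F. (norm (c j))\<^sup>2) / V"
      by (subst dist[OF F]) simp
    finally show ?thesis using V by (simp add: field_simps)
  qed
  have sm: "(\<lambda>j. (norm (c j))\<^sup>2) summable_on int_lattice"
    by (rule nonneg_bdd_above_summable_on) (use bessel in \<open>auto intro!: bdd_aboveI2\<close>)
  have "V * E \<le> (\<Sum>\<^sub>\<infinity>j\<in>int_lattice. (norm (c j))\<^sup>2)"
  proof (rule field_le_epsilon)
    fix e :: real assume e: "e > 0"
    \<comment> \<open>Uniform distance \<delta> on a cube of volume \<open>V\<close> gives squared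
      L2 distance at most \<open>\<delta>\<^sup>2 * V = e / V\<close>, which multiplication by
      \<open>V\<close> turns into \<open>e\<close>.\<close>
    define \<delta> where "\<delta> = sqrt (e / V ^ 2)"
    have \<delta>: "\<delta> > 0" "\<delta>\<^sup>2 * V = e / V" using e V by (auto simp: \<delta>_def power2_eq_square)
    obtain f where f: "trig_poly \<beta> f" "\<And>x. x \<in> ?Q \<Longrightarrow> norm (G x - f x) < \<delta>"
      by (rule trig_poly_dense[OF \<beta> G _ \<delta>(1)]) (use G0 in auto)
    obtain F a where F: "finite F" "F \<subseteq> int_lattice" "\<And>x. f x = (\<Sum>j\<in>F. a j * trig_exp \<beta> j x)"
      using f(1) unfolding trig_poly_def by blast
    have "E - (\<Sum>j\<in>F. (norm (c j))\<^sup>2) / V \<le> integral ?Q (\<lambda>x. (norm (G x - f x))\<^sup>2)"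
      unfolding F(3) dist[OF F(1,2)] using V by (auto intro!: mult_nonneg_nonneg sum_nonneg)
    also have "\<dots> \<le> integral ?Q (\<lambda>x. \<delta>\<^sup>2)"
    proof (rule integral_le)
      show "(\<lambda>x. (norm (G x - f x))\<^sup>2) integrable_on ?Q"
        unfolding F(3) by (intro ctr continuous_intros G)
      show "(\<lambda>x. \<delta>\<^sup>2) integrable_on ?Q" by (intro ctr continuous_intros)
      show "(norm (G x - f x))\<^sup>2 \<le> \<delta>\<^sup>2" if "x \<in> ?Q" for x
        using f(2)[OF that] by (intro power_mono) auto
    qed
    also have "integral ?Q (\<lambda>x. \<delta>\<^sup>2) = \<delta>\<^sup>2 * V"
    proof -
      have "measure lborel ?Q = (\<Prod>b\<in>(Basis::'a set). ((pi / \<beta>) *\<^sub>R One :: 'a) \<bullet> b - (- ((pi / \<beta>) *\<^sub>R One)) \<bullet> b)"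
        unfolding cube_def using \<beta> by (intro content_cbox) auto
      then have "measure lborel ?Q = V" unfolding V_def by simp
      then show ?thesis by (simp add: cube_def)
    qed
    finally have "E - (\<Sum>j\<in>F. (norm (c j))\<^sup>2) / V \<le> e / V" unfolding \<delta>(2) .
    then have "V * (E - (\<Sum>j\<in>F. (norm (c j))\<^sup>2) / V) \<le> V * (e / V)"
      by (rule mult_left_mono) (use V in simp)
    then have "V * E \<le> (\<Sum>j\<in>F. (norm (c j))\<^sup>2) + e"
      using V by (simp add: right_diff_distrib)
    also have "(\<Sum>j\<in>F. (norm (c j))\<^sup>2) \<le> (\<Sum>\<^sub>\<infinity>j\<in>int_lattice. (norm (c j))\<^sup>2)"
      by (rule finite_sum_le_infsum[OF sm F(1,2)]) auto
    finally show "V * E \<le> (\<Sum>\<^sub>\<infinity>j\<in>int_lattice. (norm (c j))\<^sup>2) + e" by simp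
  qed
  moreover have "(\<Sum>\<^sub>\<infinity>j\<in>int_lattice. (norm (c j))\<^sup>2) \<le> V * E"
    by (rule infsum_le_finite_sums[OF sm bessel])
  ultimately have "(\<Sum>\<^sub>\<infinity>j\<in>int_lattice. (norm (c j))\<^sup>2) = V * E" by simp
  then show ?thesis
    using has_sum_infsum[OF sm] unfolding V_def c_def E_def by simp
qed

section \<open>Derivatives of modulated test functions\<close>

lemma bracket_ge_1: "bracket x \<ge> 1"
  by (simp add: bracket_def)

lemma bracket_pos: "bracket x > 0"
  using bracket_ge_1[of x] by linarith

lemma norm_le_bracket: "norm x \<le> bracket x"
  unfolding bracket_def by (rule real_le_rsqrt) simp

lemma continuous_on_bracket [continuous_intros]: "continuous_on A bracket"
  unfolding bracket_def by (intro continuous_intros)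

lemma partial_deriv_eqI: "(f has_derivative f') (at x) \<Longrightarrow> partial_deriv i f x = f' i"
  unfolding partial_deriv_def using frechet_derivative_at by metis

lemma smooth_fun_has_derivative:
  assumes "smooth_fun f" "is \<in> lists Basis"
  shows "(iter_partial is f has_derivative frechet_derivative (iter_partial is f) (at x)) (at x)"
  using assms unfolding smooth_fun_def by (simp add: frechet_derivative_works[symmetric])

lemma smooth_fun_continuous_on:
  assumes "smooth_fun f" "is \<in> lists Basis"
  shows "continuous_on A (iter_partial is f)"
  using assms unfolding smooth_fun_def
  by (meson continuous_at_imp_continuous_on differentiable_imp_continuous_within)

section \<open>Linear operations on smooth and Schwartz functions\<close>

lemma
  assumes f: "smooth_fun f" and g: "smooth_fun g"
  shows iter_partial_add:
      "is \<in> lists Basis \<Longrightarrow> iter_partial is (\<lambda>t. f t + g t) = (\<lambda>t. iter_partial is f t + iter_partial is g t)"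
    and smooth_fun_add: "smooth_fun (\<lambda>t. f t + g t)"
proof -
  show *: "iter_partial is (\<lambda>t. f t + g t) = (\<lambda>t. iter_partial is f t + iter_partial is g t)" if "is \<in> lists Basis" for "is"
    using that
  proof (induction "is")
    case (Cons i "is")
    show ?case
      unfolding iter_partial.simps using Cons
      by (intro ext partial_deriv_eqI[THEN trans])
         (auto intro!: derivative_eq_intros smooth_fun_has_derivative f g simp: partial_deriv_def)
  qed simp
  show "smooth_fun (\<lambda>t. f t + g t)"
    unfolding smooth_fun_def using f g by (auto simp: * smooth_fun_def)
qed

lemma
  assumes f: "smooth_fun f"
  shows iter_partial_cmult:
      "is \<in> lists Basis \<Longrightarrow> iter_partial is (\<lambda>t. c * f t) = (\<lambda>t. c * iter_partial is f t)"
    and smooth_fun_cmult: "smooth_fun (\<lambda>t. c * f t)"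
proof -
  show *: "iter_partial is (\<lambda>t. c * f t) = (\<lambda>t. c * iter_partial is f t)" if "is \<in> lists Basis" for "is"
    using that
  proof (induction "is")
    case (Cons i "is")
    show ?case
      unfolding iter_partial.simps using Cons
      by (intro ext partial_deriv_eqI[THEN trans])
         (auto intro!: derivative_eq_intros smooth_fun_has_derivative f simp: partial_deriv_def)
  qed simp
  show "smooth_fun (\<lambda>t. c * f t)"
    unfolding smooth_fun_def using f by (auto simp: * smooth_fun_def intro!: derivative_intros)
qed

lemma schwartz_add:
  assumes f: "schwartz f" and g: "schwartz g"
  shows "schwartz (\<lambda>t. f t + g t)"
  unfolding schwartz_def
proof (intro conjI ballI allI)
  have s: "smooth_fun f" "smooth_fun g" using f g by (auto simp: schwartz_def)
  then show "smooth_fun (\<lambda>t. f t + g t)" by (rule smooth_fun_add)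
  fix "is" N assume i: "is \<in> lists (Basis :: 'a set)"
  obtain C where C: "\<And>x. bracket x ^ N * norm (iter_partial is f x) \<le> C"
    using f i unfolding schwartz_def by blast
  obtain D where D: "\<And>x. bracket x ^ N * norm (iter_partial is g x) \<le> D"
    using g i unfolding schwartz_def by blast
  show "\<exists>C. \<forall>x. bracket x ^ N * norm (iter_partial is (\<lambda>t. f t + g t) x) \<le> C"
  proof (intro exI[of _ "C + D"] allI)
    fix x
    have "bracket x ^ N * norm (iter_partial is (\<lambda>t. f t + g t) x)
        \<le> bracket x ^ N * (norm (iter_partial is f x) + norm (iter_partial is g x))"
      unfolding iter_partial_add[OF s i] using bracket_pos[of x]
      by (intro mult_left_mono norm_triangle_ineq) auto
    then show "bracket x ^ N * norm (iter_partial is (\<lambda>t. f t + g t) x) \<le> C + D"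
      using C[of x] D[of x] by (simp add: distrib_left)
  qed
qed

lemma schwartz_cmult:
  assumes f: "schwartz f"
  shows "schwartz (\<lambda>t. c * f t)"
  unfolding schwartz_def
proof (intro conjI ballI allI)
  have s: "smooth_fun f" using f by (auto simp: schwartz_def)
  then show "smooth_fun (\<lambda>t. c * f t)" by (rule smooth_fun_cmult)
  fix "is" N assume i: "is \<in> lists (Basis :: 'a set)"
  obtain C where C: "\<And>x. bracket x ^ N * norm (iter_partial is f x) \<le> C"
    using f i unfolding schwartz_def by blast
  show "\<exists>C. \<forall>x. bracket x ^ N * norm (iter_partial is (\<lambda>t. c * f t) x) \<le> C"
    unfolding iter_partial_cmult[OF s i]
    using mult_left_mono[OF C, of "norm c"] by (intro exI[of _ "norm c * C"]) (auto simp: norm_mult mult_ac)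
qed

text \<open>The Schwartz property, the derivatives and the action of a distribution go through one
  induction on the index set. Nonempty sets suffice, as the sums of interest run over tagged
  divisions of nonempty boxes.\<close>

lemma
  fixes f :: "'b \<Rightarrow> 'a::euclidean_space \<Rightarrow> complex"
  assumes "finite A" "\<And>k. k \<in> A \<Longrightarrow> schwartz (f k)"
  shows schwartz_sum: "A \<noteq> {} \<Longrightarrow> schwartz (\<lambda>t. \<Sum>k\<in>A. f k t)"
    and iter_partial_sum: "A \<noteq> {} \<Longrightarrow> is \<in> lists Basis \<Longrightarrow>
      iter_partial is (\<lambda>t. \<Sum>k\<in>A. f k t) = (\<lambda>t. \<Sum>k\<in>A. iter_partial is (f k) t)"
    and tempered_distribution_sum: "A \<noteq> {} \<Longrightarrow> tempered_distribution u \<Longrightarrow>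
      u (\<lambda>t. \<Sum>k\<in>A. f k t) = (\<Sum>k\<in>A. u (f k))"
proof -
  have "A \<noteq> {} \<longrightarrow> schwartz (\<lambda>t. \<Sum>k\<in>A. f k t) \<and>
     (is \<in> lists Basis \<longrightarrow> iter_partial is (\<lambda>t. \<Sum>k\<in>A. f k t) = (\<lambda>t. \<Sum>k\<in>A. iter_partial is (f k) t)) \<and>
     (tempered_distribution u \<longrightarrow> u (\<lambda>t. \<Sum>k\<in>A. f k t) = (\<Sum>k\<in>A. u (f k)))"
    using assms
  proof (induction A rule: finite_induct)
    case (insert a A)
    then have fa: "schwartz (f a)" by simp
    show ?case
    proof (cases "A = {}")
      case False
      with insert have IH: "schwartz (\<lambda>t. \<Sum>k\<in>A. f k t)"
        "is \<in> lists Basis \<longrightarrow> iter_partial is (\<lambda>t. \<Sum>k\<in>A. f k t) = (\<lambda>t. \<Sum>k\<in>A. iter_partial is (f k) t)"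
        "tempered_distribution u \<longrightarrow> u (\<lambda>t. \<Sum>k\<in>A. f k t) = (\<Sum>k\<in>A. u (f k))" by auto
      have "u (\<lambda>t. f a t + (\<Sum>k\<in>A. f k t)) = u (f a) + u (\<lambda>t. \<Sum>k\<in>A. f k t)" if "tempered_distribution u"
        using that fa IH(1) unfolding tempered_distribution_def by blast
      then show ?thesis
        using insert.hyps IH fa schwartz_add[OF fa IH(1)] iter_partial_add[of "f a" "\<lambda>t. \<Sum>k\<in>A. f k t" "is"]
        by (auto simp: schwartz_def)
    qed (use fa in simp)
  qed simp
  then show "A \<noteq> {} \<Longrightarrow> schwartz (\<lambda>t. \<Sum>k\<in>A. f k t)"
    "A \<noteq> {} \<Longrightarrow> is \<in> lists Basis \<Longrightarrow>
      iter_partial is (\<lambda>t. \<Sum>k\<in>A. f k t) = (\<lambda>t. \<Sum>k\<in>A. iter_partial is (f k) t)"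
    "A \<noteq> {} \<Longrightarrow> tempered_distribution u \<Longrightarrow> u (\<lambda>t. \<Sum>k\<in>A. f k t) = (\<Sum>k\<in>A. u (f k))" by blast+
qed

text \<open>The complement of the closed support is open, so at each of its points one
  differentiates a function that vanishes nearby.\<close>

lemma iter_partial_outside_supp:
  assumes "is \<in> lists Basis" "t \<notin> supp f"
  shows "iter_partial is f t = 0"
  using assms
proof (induction "is" arbitrary: t)
  case Nil
  then show ?case using closure_subset[of "{x. f x \<noteq> 0}"] by (auto simp: supp_def)
next
  case (Cons i "is")
  have "open (- supp f)" by (simp add: supp_def open_Compl)
  then have "(iter_partial is f has_derivative (\<lambda>h. 0)) (at t)"
    using Cons by (intro has_derivative_transform_within_open[OF has_derivative_const[of 0]]) auto
  then show ?case by (simp add: partial_deriv_eqI)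
qed

lemma test_function_iter_partial_bounded:
  assumes \<psi>: "test_function \<psi>" and "is": "is \<in> lists Basis"
  shows "\<exists>C\<ge>0. \<forall>t. bracket t ^ N * norm (iter_partial is \<psi> t) \<le> C"
proof -
  have sm: "smooth_fun \<psi>" and cp: "compact (supp \<psi>)" using \<psi> by (auto simp: test_function_def)
  have "continuous_on (supp \<psi>) (\<lambda>t. bracket t ^ N * norm (iter_partial is \<psi> t))"
    by (intro continuous_intros smooth_fun_continuous_on[OF sm "is"])
  then have "bounded ((\<lambda>t. bracket t ^ N * norm (iter_partial is \<psi> t)) ` supp \<psi>)"
    using cp compact_continuous_image compact_imp_bounded by blast
  then obtain C where C: "C > 0" "\<And>t. t \<in> supp \<psi> \<Longrightarrow> norm (bracket t ^ N * norm (iter_partial is \<psi> t)) \<le> C"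
    unfolding bounded_pos by blast
  have "bracket t ^ N * norm (iter_partial is \<psi> t) \<le> C" for t
  proof (cases "t \<in> supp \<psi>")
    case True
    from C(2)[OF this] show ?thesis by (simp add: abs_le_iff)
  next
    case False
    then show ?thesis using iter_partial_outside_supp[OF "is", of t \<psi>] C(1) by simp
  qed
  then show ?thesis using C(1) by (intro exI[of _ C]) auto
qed

section \<open>Test functions modulated by characters\<close>

definition osc :: "'a::euclidean_space \<Rightarrow> 'a \<Rightarrow> complex" where
  "osc \<eta> t = exp (- (\<i> * complex_of_real (t \<bullet> \<eta>)))"

lemma norm_osc [simp]: "norm (osc \<eta> t) = 1"
  by (simp add: osc_def)

lemma has_derivative_osc:
  "(osc \<eta> has_derivative (\<lambda>h. osc \<eta> t * (- (\<i> * complex_of_real (h \<bullet> \<eta>))))) (at t)"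
proof -
  have "((\<lambda>t. - (\<i> * complex_of_real (t \<bullet> \<eta>))) has_derivative (\<lambda>h. - (\<i> * complex_of_real (h \<bullet> \<eta>)))) (at t)"
    by (auto intro!: derivative_eq_intros)
  from has_derivative_compose[OF this DERIV_exp[unfolded has_field_derivative_def]]
  show ?thesis unfolding osc_def .
qed

text \<open>The bound of |exp (i s) - 1| by |s|. Its price is the factor \<open>norm t\<close>,
  which must be paid for by one more power of the weight.\<close>

lemma norm_osc_diff: "norm (osc \<eta> t - osc \<eta>' t) \<le> norm t * norm (\<eta> - \<eta>')"
proof -
  have "osc \<eta> t - osc \<eta>' t = osc \<eta>' t * (exp (\<i> * complex_of_real (t \<bullet> (\<eta>' - \<eta>))) - 1)"
    by (simp add: osc_def inner_diff_right algebra_simps flip: exp_add)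
  then have "norm (osc \<eta> t - osc \<eta>' t) = norm (exp (\<i> * complex_of_real (t \<bullet> (\<eta>' - \<eta>))) - 1)"
    by (simp add: norm_mult)
  also have "\<dots> \<le> \<bar>t \<bullet> (\<eta>' - \<eta>)\<bar>"
    using iexp_approx1[of "t \<bullet> (\<eta>' - \<eta>)" 0] by simp
  also have "\<dots> \<le> norm t * norm (\<eta>' - \<eta>)" by (rule Cauchy_Schwarz_ineq2)
  finally show ?thesis by (simp add: norm_minus_commute)
qed

text \<open>The derivatives in \<open>t\<close> of \<open>\<psi> t * osc \<eta> t\<close> lie in the following class.\<close>

inductive modulated :: "('a::euclidean_space \<Rightarrow> complex) \<Rightarrow> ('a \<Rightarrow> 'a \<Rightarrow> complex) \<Rightarrow> bool"
  for \<psi> where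
  base: "is \<in> lists Basis \<Longrightarrow> modulated \<psi> (\<lambda>\<eta> t. iter_partial is \<psi> t * osc \<eta> t)"
| mult: "modulated \<psi> K \<Longrightarrow> i \<in> Basis \<Longrightarrow> modulated \<psi> (\<lambda>\<eta> t. c * complex_of_real (\<eta> \<bullet> i) * K \<eta> t)"
| add: "modulated \<psi> K \<Longrightarrow> modulated \<psi> L \<Longrightarrow> modulated \<psi> (\<lambda>\<eta> t. K \<eta> t + L \<eta> t)"

text \<open>The class is closed under partial derivatives, with one member \<open>L\<close> that
  serves all frequencies at once. Estimates for iterated derivatives can thus be proved by induction
  on the class, in place of a Leibniz formula.\<close>

lemma modulated_partial_deriv:
  assumes "modulated \<psi> K" "smooth_fun \<psi>"
  shows "K \<eta> differentiable (at t)"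
    and "i \<in> Basis \<Longrightarrow> \<exists>L. modulated \<psi> L \<and> (\<forall>\<eta>. partial_deriv i (K \<eta>) = L \<eta>)"
proof -
  have "(\<forall>\<eta> t. K \<eta> differentiable (at t)) \<and>
    (\<forall>i\<in>Basis. \<exists>L. modulated \<psi> L \<and> (\<forall>\<eta>. partial_deriv i (K \<eta>) = L \<eta>))"
    using assms
  proof (induction rule: modulated.induct)
    case (base "is")
    have d: "((\<lambda>t. iter_partial is \<psi> t * osc \<eta> t) has_derivative
      (\<lambda>h. iter_partial is \<psi> t * (osc \<eta> t * (- (\<i> * complex_of_real (h \<bullet> \<eta>)))) +
         frechet_derivative (iter_partial is \<psi>) (at t) h * osc \<eta> t)) (at t)" for \<eta> t
      by (intro has_derivative_mult has_derivative_osc smooth_fun_has_derivative base)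
    have "\<exists>L. modulated \<psi> L \<and> (\<forall>\<eta>. partial_deriv i (\<lambda>t. iter_partial is \<psi> t * osc \<eta> t) = L \<eta>)"
      if i: "i \<in> Basis" for i
    proof (intro exI conjI allI)
      show "modulated \<psi> (\<lambda>\<eta> t. - \<i> * complex_of_real (\<eta> \<bullet> i) * (iter_partial is \<psi> t * osc \<eta> t) + iter_partial (i # is) \<psi> t * osc \<eta> t)"
        using i base by (intro modulated.intros) auto
      show "partial_deriv i (\<lambda>t. iter_partial is \<psi> t * osc \<eta> t) =
          (\<lambda>t. - \<i> * complex_of_real (\<eta> \<bullet> i) * (iter_partial is \<psi> t * osc \<eta> t) + iter_partial (i # is) \<psi> t * osc \<eta> t)" for \<eta>
        by (rule ext, subst partial_deriv_eqI[OF d]) (simp add: partial_deriv_def inner_commute)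
    qed
    moreover note d
    ultimately show ?case unfolding differentiable_def by blast
  next
    case (mult K j c)
    have d: "((\<lambda>t. c * complex_of_real (\<eta> \<bullet> j) * K \<eta> t) has_derivative
       (\<lambda>h. c * complex_of_real (\<eta> \<bullet> j) * frechet_derivative (K \<eta>) (at t) h)) (at t)" for \<eta> t
      using mult by (intro has_derivative_mult_right) (auto simp: frechet_derivative_works)
    have "\<exists>L. modulated \<psi> L \<and> (\<forall>\<eta>. partial_deriv i (\<lambda>t. c * complex_of_real (\<eta> \<bullet> j) * K \<eta> t) = L \<eta>)"
      if i: "i \<in> Basis" for i
    proof -
      obtain L where L: "modulated \<psi> L" "\<And>\<eta>. partial_deriv i (K \<eta>) = L \<eta>" using mult i by blast
      have "partial_deriv i (\<lambda>t. c * complex_of_real (\<eta> \<bullet> j) * K \<eta> t) = (\<lambda>t. c * complex_of_real (\<eta> \<bullet> j) * L \<eta> t)" for \<eta>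
        by (rule ext, subst partial_deriv_eqI[OF d]) (simp add: partial_deriv_def flip: L(2))
      then show ?thesis using modulated.mult[OF L(1) mult(2), of c] by blast
    qed
    moreover note d
    ultimately show ?case unfolding differentiable_def by blast
  next
    case (add K M)
    have d: "((\<lambda>t. K \<eta> t + M \<eta> t) has_derivative
       (\<lambda>h. frechet_derivative (K \<eta>) (at t) h + frechet_derivative (M \<eta>) (at t) h)) (at t)" for \<eta> t
      using add by (intro has_derivative_add) (auto simp: frechet_derivative_works)
    have "\<exists>L. modulated \<psi> L \<and> (\<forall>\<eta>. partial_deriv i (\<lambda>t. K \<eta> t + M \<eta> t) = L \<eta>)"
      if i: "i \<in> Basis" for i
    proof -
      obtain L where L: "modulated \<psi> L" "\<And>\<eta>. partial_deriv i (K \<eta>) = L \<eta>" using add i by blast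
      obtain L' where L': "modulated \<psi> L'" "\<And>\<eta>. partial_deriv i (M \<eta>) = L' \<eta>" using add i by blast
      have "partial_deriv i (\<lambda>t. K \<eta> t + M \<eta> t) = (\<lambda>t. L \<eta> t + L' \<eta> t)" for \<eta>
        by (rule ext, subst partial_deriv_eqI[OF d]) (simp add: partial_deriv_def flip: L(2) L'(2))
      then show ?thesis using modulated.add[OF L(1) L'(1)] by blast
    qed
    moreover note d
    ultimately show ?case unfolding differentiable_def by blast
  qed
  then show "K \<eta> differentiable (at t)"
    "i \<in> Basis \<Longrightarrow> \<exists>L. modulated \<psi> L \<and> (\<forall>\<eta>. partial_deriv i (K \<eta>) = L \<eta>)" by blast+
qed

lemma modulated_iter_partial:
  assumes "smooth_fun \<psi>" "is \<in> lists Basis"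
  shows "\<exists>K. modulated \<psi> K \<and> (\<forall>\<eta>. iter_partial is (\<lambda>t. \<psi> t * osc \<eta> t) = K \<eta>)"
  using assms(2)
proof (induction "is")
  case Nil
  show ?case using modulated.base[of "[]" \<psi>] by auto
next
  case (Cons i "is")
  then obtain K where K: "modulated \<psi> K" "\<And>\<eta>. iter_partial is (\<lambda>t. \<psi> t * osc \<eta> t) = K \<eta>" by auto
  from modulated_partial_deriv(2)[OF K(1) assms(1), of i] Cons(1) show ?case by (simp add: K(2))
qed

text \<open>Continuity is joint in frequency and position because differentiation under the
  frequency integral asks for it in this form.\<close>

lemma modulated_continuous_on:
  assumes "modulated \<psi> K" "smooth_fun \<psi>"
  shows "continuous_on A (\<lambda>x. K (fst x) (snd x))"
  using assms
proof (induction rule: modulated.induct)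
  case (base "is")
  have "continuous_on A (\<lambda>x. iter_partial is \<psi> (snd x))"
    by (rule continuous_on_compose2[OF smooth_fun_continuous_on[OF base(2,1), of UNIV]]) (auto intro!: continuous_intros)
  then show ?case unfolding osc_def by (intro continuous_intros)
qed (auto intro!: continuous_intros)

text \<open>Growth and Lipschitz dependence in the frequency, uniformly in the position and with the
  Schwartz weight. Both estimates share one factor in the two frequencies, so that monotonicity and
  sums treat them alike.\<close>

definition poly_lipschitz :: "nat \<Rightarrow> ('a::euclidean_space \<Rightarrow> 'a \<Rightarrow> complex) \<Rightarrow> real \<Rightarrow> nat \<Rightarrow> bool" where
  "poly_lipschitz N K C L \<longleftrightarrow> (\<forall>\<eta> \<eta>' t.
     bracket t ^ N * norm (K \<eta> t) \<le> C * (1 + norm \<eta> + norm \<eta>') ^ L \<and>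
     bracket t ^ N * norm (K \<eta> t - K \<eta>' t) \<le> C * (1 + norm \<eta> + norm \<eta>') ^ L * norm (\<eta> - \<eta>'))"

lemma poly_lipschitz_nonneg: "poly_lipschitz N K C L \<Longrightarrow> C \<ge> 0"
proof -
  assume "poly_lipschitz N K C L"
  then have "bracket (0::'a) ^ N * norm (K 0 0) \<le> C * (1 + norm (0::'a) + norm (0::'a)) ^ L"
    unfolding poly_lipschitz_def by blast
  moreover have "0 \<le> bracket (0::'a) ^ N * norm (K 0 0)" using bracket_pos[of "0::'a"] by auto
  ultimately show ?thesis by simp
qed

lemma poly_lipschitz_mono:
  assumes K: "poly_lipschitz N K C L" and "C \<le> C'" "L \<le> L'"
  shows "poly_lipschitz N K C' L'"
proof -
  have "C * (1 + norm \<eta> + norm \<eta>') ^ L \<le> C' * (1 + norm \<eta> + norm \<eta>') ^ L'" for \<eta> \<eta>' :: 'a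
    using poly_lipschitz_nonneg[OF K] assms(2,3) by (intro mult_mono power_increasing) auto
  moreover from this have "C * (1 + norm \<eta> + norm \<eta>') ^ L * norm (\<eta> - \<eta>') \<le> C' * (1 + norm \<eta> + norm \<eta>') ^ L' * norm (\<eta> - \<eta>')" for \<eta> \<eta>' :: 'a
    by (intro mult_right_mono) auto
  ultimately show ?thesis
    using K unfolding poly_lipschitz_def by (meson order_trans)
qed

text \<open>Base functions are bounded because \<psi> has compact support; each factor
  \<open>\<eta> \<bullet> i\<close> raises the exponent by one, and a sum is brought to the common
  exponent \<open>L + L'\<close>.\<close>

lemma modulated_poly_lipschitz:
  assumes "modulated \<psi> K" "test_function \<psi>"
  shows "\<exists>C L. poly_lipschitz N K C L"
  using assms
proof (induction rule: modulated.induct)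
  case (base "is")
  obtain C where C: "C \<ge> 0" "\<And>t. bracket t ^ N * norm (iter_partial is \<psi> t) \<le> C"
    using test_function_iter_partial_bounded[OF base(2,1), of N] by blast
  \<comment> \<open>The weight \<open>Suc N\<close> absorbs the factor \<open>norm t\<close> from
    \<open>norm_osc_diff\<close>.\<close>
  obtain D where D: "D \<ge> 0" "\<And>t. bracket t ^ Suc N * norm (iter_partial is \<psi> t) \<le> D"
    using test_function_iter_partial_bounded[OF base(2,1), of "Suc N"] by blast
  have "poly_lipschitz N (\<lambda>\<eta> t. iter_partial is \<psi> t * osc \<eta> t) (C + D) 0"
    unfolding poly_lipschitz_def
  proof (intro allI conjI)
    fix \<eta> \<eta>' t :: 'a
    show "bracket t ^ N * norm (iter_partial is \<psi> t * osc \<eta> t) \<le> (C + D) * (1 + norm \<eta> + norm \<eta>') ^ 0"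
      using C(2)[of t] D(1) by (simp add: norm_mult)
    have "bracket t ^ N * norm (iter_partial is \<psi> t * osc \<eta> t - iter_partial is \<psi> t * osc \<eta>' t)
        = bracket t ^ N * norm (iter_partial is \<psi> t) * norm (osc \<eta> t - osc \<eta>' t)"
      by (simp add: norm_mult flip: right_diff_distrib)
    also have "\<dots> \<le> bracket t ^ N * norm (iter_partial is \<psi> t) * (bracket t * norm (\<eta> - \<eta>'))"
      using bracket_pos[of t]
      by (intro mult_left_mono order_trans[OF norm_osc_diff] mult_right_mono norm_le_bracket) auto
    also have "\<dots> = bracket t ^ Suc N * norm (iter_partial is \<psi> t) * norm (\<eta> - \<eta>')" by simp
    also have "\<dots> \<le> (C + D) * norm (\<eta> - \<eta>')"
      using D(2)[of t] C(1) by (intro mult_right_mono) auto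
    finally show "bracket t ^ N * norm (iter_partial is \<psi> t * osc \<eta> t - iter_partial is \<psi> t * osc \<eta>' t)
        \<le> (C + D) * (1 + norm \<eta> + norm \<eta>') ^ 0 * norm (\<eta> - \<eta>')" by simp
  qed
  then show ?case by blast
next
  case (mult K i c)
  obtain C L where CL: "poly_lipschitz N K C L" using mult by blast
  have b: "bracket t ^ N * norm (K \<eta> t) \<le> C * (1 + norm \<eta> + norm \<eta>') ^ L"
    "bracket t ^ N * norm (K \<eta> t - K \<eta>' t) \<le> C * (1 + norm \<eta> + norm \<eta>') ^ L * norm (\<eta> - \<eta>')" for \<eta> \<eta>' t
    using CL unfolding poly_lipschitz_def by blast+
  have C0: "C \<ge> 0" using poly_lipschitz_nonneg[OF CL] .
  have "poly_lipschitz N (\<lambda>\<eta> t. c * complex_of_real (\<eta> \<bullet> i) * K \<eta> t) (2 * (norm c * C)) (Suc L)"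
    unfolding poly_lipschitz_def
  proof (intro allI conjI)
    fix \<eta> \<eta>' t :: 'a
    define W where "W = 1 + norm \<eta> + norm \<eta>'"
    have W: "W \<ge> 0" "\<bar>\<eta> \<bullet> i\<bar> \<le> W" "\<bar>(\<eta> - \<eta>') \<bullet> i\<bar> \<le> norm (\<eta> - \<eta>')" "W \<ge> 1"
      using Basis_le_norm[OF mult(2), of \<eta>] Basis_le_norm[OF mult(2), of "\<eta> - \<eta>'"]
      by (auto simp: W_def intro: order_trans)
    have p: "bracket t ^ N \<ge> 0" using bracket_pos[of t] by simp
    have "bracket t ^ N * norm (c * complex_of_real (\<eta> \<bullet> i) * K \<eta> t) = norm c * \<bar>\<eta> \<bullet> i\<bar> * (bracket t ^ N * norm (K \<eta> t))"
      by (simp add: norm_mult)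
    also have "\<dots> \<le> norm c * W * (C * W ^ L)"
      by (rule mult_mono) (use W b(1)[of t \<eta> \<eta>', folded W_def] p in \<open>auto intro!: mult_left_mono\<close>)
    also have "\<dots> = norm c * C * W ^ Suc L" by simp
    also have "\<dots> \<le> 2 * (norm c * C) * W ^ Suc L" using C0 W by (intro mult_right_mono) auto
    finally show "bracket t ^ N * norm (c * complex_of_real (\<eta> \<bullet> i) * K \<eta> t) \<le> 2 * (norm c * C) * (1 + norm \<eta> + norm \<eta>') ^ Suc L"
      unfolding W_def .
    \<comment> \<open>The difference of products is telescoped: one summand varies \<open>K\<close>,
      the other the linear factor. Adding the two bounds leads to \<open>W + 1 \<le> W + W\<close>,
      the origin of the constant 2.\<close>
    have "c * complex_of_real (\<eta> \<bullet> i) * K \<eta> t - c * complex_of_real (\<eta>' \<bullet> i) * K \<eta>' t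
        = c * (complex_of_real (\<eta> \<bullet> i) * (K \<eta> t - K \<eta>' t) + complex_of_real ((\<eta> - \<eta>') \<bullet> i) * K \<eta>' t)"
      by (simp add: inner_diff_left algebra_simps)
    then have "norm (c * complex_of_real (\<eta> \<bullet> i) * K \<eta> t - c * complex_of_real (\<eta>' \<bullet> i) * K \<eta>' t)
        \<le> norm c * (\<bar>\<eta> \<bullet> i\<bar> * norm (K \<eta> t - K \<eta>' t) + \<bar>(\<eta> - \<eta>') \<bullet> i\<bar> * norm (K \<eta>' t))"
      by (auto simp: norm_mult intro!: mult_left_mono order_trans[OF norm_triangle_ineq])
    then have "bracket t ^ N * norm (c * complex_of_real (\<eta> \<bullet> i) * K \<eta> t - c * complex_of_real (\<eta>' \<bullet> i) * K \<eta>' t)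
        \<le> bracket t ^ N * (norm c * (\<bar>\<eta> \<bullet> i\<bar> * norm (K \<eta> t - K \<eta>' t) + \<bar>(\<eta> - \<eta>') \<bullet> i\<bar> * norm (K \<eta>' t)))"
      by (rule mult_left_mono[OF _ p])
    also have "\<dots> = norm c * (\<bar>\<eta> \<bullet> i\<bar> * (bracket t ^ N * norm (K \<eta> t - K \<eta>' t)) + \<bar>(\<eta> - \<eta>') \<bullet> i\<bar> * (bracket t ^ N * norm (K \<eta>' t)))"
      by (simp add: algebra_simps)
    also have "\<dots> \<le> norm c * (W * (C * W ^ L * norm (\<eta> - \<eta>')) + norm (\<eta> - \<eta>') * (C * W ^ L))"
    proof (intro mult_left_mono[OF add_mono])
      show "\<bar>\<eta> \<bullet> i\<bar> * (bracket t ^ N * norm (K \<eta> t - K \<eta>' t)) \<le> W * (C * W ^ L * norm (\<eta> - \<eta>'))"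
        by (rule mult_mono[OF W(2) b(2)[of t \<eta> \<eta>', folded W_def]]) (use W p in auto)
      have "W = 1 + norm \<eta>' + norm \<eta>" by (simp add: W_def)
      then show "\<bar>(\<eta> - \<eta>') \<bullet> i\<bar> * (bracket t ^ N * norm (K \<eta>' t)) \<le> norm (\<eta> - \<eta>') * (C * W ^ L)"
        using b(1)[of t \<eta>' \<eta>] p by (intro mult_mono[OF W(3)]) auto
    qed auto
    also have "\<dots> = norm c * C * W ^ L * norm (\<eta> - \<eta>') * (W + 1)" by (simp add: algebra_simps)
    also have "\<dots> \<le> norm c * C * W ^ L * norm (\<eta> - \<eta>') * (W + W)"
      using W C0 by (intro mult_left_mono) auto
    also have "\<dots> = 2 * (norm c * C) * W ^ Suc L * norm (\<eta> - \<eta>')" by (simp add: algebra_simps)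
    finally show "bracket t ^ N * norm (c * complex_of_real (\<eta> \<bullet> i) * K \<eta> t - c * complex_of_real (\<eta>' \<bullet> i) * K \<eta>' t)
        \<le> 2 * (norm c * C) * (1 + norm \<eta> + norm \<eta>') ^ Suc L * norm (\<eta> - \<eta>')" unfolding W_def .
  qed
  then show ?case by blast
next
  case (add K M)
  obtain C L where "poly_lipschitz N K C L" using add by blast
  then have K: "poly_lipschitz N K C (L + L')" for L' by (rule poly_lipschitz_mono) auto
  obtain C' L' where "poly_lipschitz N M C' L'" using add by blast
  then have M: "poly_lipschitz N M C' (L + L')" for L by (rule poly_lipschitz_mono) auto
  have "poly_lipschitz N (\<lambda>\<eta> t. K \<eta> t + M \<eta> t) (C + C') (L + L')"
    unfolding poly_lipschitz_def
  proof (intro allI conjI)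
    fix \<eta> \<eta>' t :: 'a
    have p: "bracket t ^ N \<ge> 0" using bracket_pos[of t] by simp
    have "bracket t ^ N * norm (K \<eta> t + M \<eta> t) \<le> bracket t ^ N * (norm (K \<eta> t) + norm (M \<eta> t))"
      by (intro mult_left_mono norm_triangle_ineq p)
    also have "\<dots> \<le> (C + C') * (1 + norm \<eta> + norm \<eta>') ^ (L + L')"
      unfolding distrib_left distrib_right
      by (intro add_mono) (use K[of L'] M[of L] in \<open>auto simp: poly_lipschitz_def\<close>)
    finally show "bracket t ^ N * norm (K \<eta> t + M \<eta> t) \<le> (C + C') * (1 + norm \<eta> + norm \<eta>') ^ (L + L')" .
    have "bracket t ^ N * norm (K \<eta> t + M \<eta> t - (K \<eta>' t + M \<eta>' t))
        \<le> bracket t ^ N * (norm (K \<eta> t - K \<eta>' t) + norm (M \<eta> t - M \<eta>' t))"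
      by (intro mult_left_mono norm_diff_triangle_ineq p)
    also have "\<dots> \<le> (C + C') * (1 + norm \<eta> + norm \<eta>') ^ (L + L') * norm (\<eta> - \<eta>')"
      unfolding distrib_left distrib_right
      by (intro add_mono) (use K[of L'] M[of L] in \<open>auto simp: poly_lipschitz_def\<close>)
    finally show "bracket t ^ N * norm (K \<eta> t + M \<eta> t - (K \<eta>' t + M \<eta>' t))
        \<le> (C + C') * (1 + norm \<eta> + norm \<eta>') ^ (L + L') * norm (\<eta> - \<eta>')" .
  qed
  then show ?case by blast
qed

text \<open>Only finitely many lists of basis vectors have length at most \<open>N\<close>, so
  maxima of their constants serve all of them. The same \<open>N\<close> limits the order and the
  weight, as in \<open>schwartz_seminorm\<close>.\<close>

lemma iter_partial_osc_poly_lipschitz: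
  fixes \<psi> :: "'a::euclidean_space \<Rightarrow> complex"
  assumes \<psi>: "test_function \<psi>"
  shows "\<exists>C L. \<forall>is. is \<in> lists Basis \<and> length is \<le> N \<longrightarrow>
    poly_lipschitz N (\<lambda>\<eta>. iter_partial is (\<lambda>t. \<psi> t * osc \<eta> t)) C L"
proof -
  have *: "\<exists>C L. poly_lipschitz N (\<lambda>\<eta>. iter_partial is (\<lambda>t. \<psi> t * osc \<eta> t)) C L" if "is": "is \<in> lists Basis" for "is"
  proof -
    obtain K where "modulated \<psi> K" "\<And>\<eta>. iter_partial is (\<lambda>t. \<psi> t * osc \<eta> t) = K \<eta>"
      using modulated_iter_partial[OF _ "is", of \<psi>] \<psi> unfolding test_function_def by blast
    then show ?thesis using modulated_poly_lipschitz[of \<psi> K N] \<psi> by auto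
  qed
  let ?S = "{is. set is \<subseteq> (Basis::'a set) \<and> length is \<le> N}"
  have "finite ?S" by (rule finite_lists_length_le) simp
  moreover have "\<exists>C L. \<forall>is\<in>A. poly_lipschitz N (\<lambda>\<eta>. iter_partial is (\<lambda>t. \<psi> t * osc \<eta> t)) C L"
    if "finite A" "A \<subseteq> lists Basis" for A
    using that
  proof (induction A rule: finite_induct)
    case (insert a A)
    then obtain C L where CL: "\<And>is. is \<in> A \<Longrightarrow> poly_lipschitz N (\<lambda>\<eta>. iter_partial is (\<lambda>t. \<psi> t * osc \<eta> t)) C L"
      by auto
    obtain C' L' where CL': "poly_lipschitz N (\<lambda>\<eta>. iter_partial a (\<lambda>t. \<psi> t * osc \<eta> t)) C' L'"
      using *[of a] insert by auto
    have "poly_lipschitz N (\<lambda>\<eta>. iter_partial is (\<lambda>t. \<psi> t * osc \<eta> t)) (max C C') (max L L')" if "is \<in> insert a A" for "is"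
      using that poly_lipschitz_mono[OF CL'] poly_lipschitz_mono[OF CL] by auto
    then show ?case by blast
  qed simp
  moreover have "?S \<subseteq> lists Basis" by (auto simp: lists_eq_set)
  ultimately have "\<exists>C L. \<forall>is\<in>?S. poly_lipschitz N (\<lambda>\<eta>. iter_partial is (\<lambda>t. \<psi> t * osc \<eta> t)) C L"
    by blast
  then show ?thesis by (auto simp: lists_eq_set)
qed

lemma schwartz_test_osc:
  fixes \<psi> :: "'a::euclidean_space \<Rightarrow> complex"
  assumes \<psi>: "test_function \<psi>"
  shows "schwartz (\<lambda>t. \<psi> t * osc \<eta> t)"
  unfolding schwartz_def
proof (intro conjI ballI allI)
  have sm: "smooth_fun \<psi>" using \<psi> by (simp add: test_function_def)
  show "smooth_fun (\<lambda>t. \<psi> t * osc \<eta> t)"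
    unfolding smooth_fun_def
    using modulated_iter_partial[OF sm] modulated_partial_deriv(1)[OF _ sm] by metis
  fix "is" N assume "is": "is \<in> lists (Basis :: 'a set)"
  obtain K where K: "modulated \<psi> K" "\<And>\<eta>. iter_partial is (\<lambda>t. \<psi> t * osc \<eta> t) = K \<eta>"
    using modulated_iter_partial[OF sm "is"] by blast
  obtain C L where "poly_lipschitz N K C L" using modulated_poly_lipschitz[OF K(1) \<psi>] by blast
  then have "\<forall>x. bracket x ^ N * norm (iter_partial is (\<lambda>t. \<psi> t * osc \<eta> t) x) \<le> C * (1 + norm \<eta> + norm \<eta>) ^ L"
    unfolding K(2) poly_lipschitz_def by blast
  then show "\<exists>C. \<forall>x. bracket x ^ N * norm (iter_partial is (\<lambda>t. \<psi> t * osc \<eta> t) x) \<le> C" by blast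
qed

section \<open>Superpositions of modulated test functions\<close>

text \<open>Differentiation under the integral sign. It takes place in \<open>t\<close>, so
  continuity is enough for the map \<open>p\<close>, which attaches a frequency to the integration
  variable.\<close>

lemma
  fixes a b :: "'b::euclidean_space" and K :: "'a::euclidean_space \<Rightarrow> 'a \<Rightarrow> complex"
  assumes K: "modulated \<psi> K" and sm: "smooth_fun \<psi>"
    and g: "continuous_on (cbox a b) g" and p: "continuous_on (cbox a b) p"
  shows differentiable_integral_modulated:
      "(\<lambda>t. integral (cbox a b) (\<lambda>\<zeta>. g \<zeta> * K (p \<zeta>) t)) differentiable (at t)"
    and partial_deriv_integral_modulated: "i \<in> Basis \<Longrightarrow>
      partial_deriv i (\<lambda>t. integral (cbox a b) (\<lambda>\<zeta>. g \<zeta> * K (p \<zeta>) t)) =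
      (\<lambda>t. integral (cbox a b) (\<lambda>\<zeta>. g \<zeta> * partial_deriv i (K (p \<zeta>)) t))"
proof -
  \<comment> \<open>The total derivative of the integrand as a bounded linear map, the form in which
    the Leibniz rule wants it to be continuous. Continuity is checked on basis vectors, where the
    components come from modulated functions again.\<close>
  define fx where "fx t \<zeta> = Blinfun (\<lambda>v. g \<zeta> * frechet_derivative (K (p \<zeta>)) (at t) v)" for t \<zeta>
  have d: "(K \<eta> has_derivative frechet_derivative (K \<eta>) (at t)) (at t)" for \<eta> t
    using modulated_partial_deriv(1)[OF K sm] by (simp add: frechet_derivative_works)
  have fx: "blinfun_apply (fx t \<zeta>) = (\<lambda>v. g \<zeta> * frechet_derivative (K (p \<zeta>)) (at t) v)" for t \<zeta>
    unfolding fx_def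
    by (intro bounded_linear_Blinfun_apply bounded_linear_const_mult has_derivative_bounded_linear[OF d])
  have df: "((\<lambda>t. g \<zeta> * K (p \<zeta>) t) has_derivative blinfun_apply (fx t \<zeta>)) (at t within UNIV)" for t \<zeta>
    unfolding fx using d by (intro has_derivative_mult_right) simp
  have gm: "continuous_on (UNIV \<times> cbox a b) (\<lambda>x. g (snd x) * M (p (snd x)) (fst x))" if M: "modulated \<psi> M" for M
  proof (intro continuous_on_mult)
    show "continuous_on (UNIV \<times> cbox a b) (\<lambda>x. g (snd x))"
      by (rule continuous_on_compose2[OF g]) (auto intro!: continuous_intros)
    have "continuous_on (UNIV \<times> cbox a b) (\<lambda>x. p (snd x))"
      by (rule continuous_on_compose2[OF p]) (auto intro!: continuous_intros)
    then have "continuous_on (UNIV \<times> cbox a b) (\<lambda>x. (p (snd x), fst x))"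
      by (intro continuous_intros)
    from continuous_on_compose2[OF modulated_continuous_on[OF M sm, of UNIV] this]
    show "continuous_on (UNIV \<times> cbox a b) (\<lambda>x. M (p (snd x)) (fst x))" by simp
  qed
  have gi: "(\<lambda>\<zeta>. g \<zeta> * M (p \<zeta>) t) integrable_on cbox a b" if M: "modulated \<psi> M" for M t
    by (rule integrable_continuous, rule continuous_on_compose2[OF gm[OF M], of _ "\<lambda>\<zeta>. (t, \<zeta>)", simplified])
       (auto intro!: continuous_intros)
  have fxL: "blinfun_apply (fx t \<zeta>) i = g \<zeta> * partial_deriv i (K (p \<zeta>)) t" for t \<zeta> i
    unfolding fx by (simp add: partial_deriv_def)
  have cfx: "continuous_on (UNIV \<times> cbox a b) (\<lambda>(t, \<zeta>). fx t \<zeta>)"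
  proof (rule continuous_on_blinfun_componentwise)
    fix i :: 'a assume "i \<in> Basis"
    then obtain L where L: "modulated \<psi> L" "\<And>\<eta>. partial_deriv i (K \<eta>) = L \<eta>"
      using modulated_partial_deriv(2)[OF K sm] by blast
    have "(\<lambda>x. blinfun_apply (case x of (t, \<zeta>) \<Rightarrow> fx t \<zeta>) i) = (\<lambda>x. g (snd x) * L (p (snd x)) (fst x))"
      by (auto simp: fxL L(2) split_beta)
    then show "continuous_on (UNIV \<times> cbox a b) (\<lambda>x. blinfun_apply (case x of (t, \<zeta>) \<Rightarrow> fx t \<zeta>) i)"
      using gm[OF L(1)] by (simp only:)
  qed
  have D: "((\<lambda>t. integral (cbox a b) (\<lambda>\<zeta>. g \<zeta> * K (p \<zeta>) t)) has_derivative
      blinfun_apply (integral (cbox a b) (fx t))) (at t)" for t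
    using leibniz_rule[of UNIV a b "\<lambda>t \<zeta>. g \<zeta> * K (p \<zeta>) t" fx t, OF df gi[OF K] cfx] by simp
  then show "(\<lambda>t. integral (cbox a b) (\<lambda>\<zeta>. g \<zeta> * K (p \<zeta>) t)) differentiable (at t)"
    unfolding differentiable_def by blast
  show "partial_deriv i (\<lambda>t. integral (cbox a b) (\<lambda>\<zeta>. g \<zeta> * K (p \<zeta>) t)) =
      (\<lambda>t. integral (cbox a b) (\<lambda>\<zeta>. g \<zeta> * partial_deriv i (K (p \<zeta>)) t))" if "i \<in> Basis"
  proof
    fix t
    have "fx t integrable_on cbox a b"
      by (rule integrable_continuous, rule continuous_on_compose2[OF cfx, of _ "\<lambda>\<zeta>. (t, \<zeta>)", simplified])
         (auto intro!: continuous_intros)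
    from integral_linear[OF this blinfun.bounded_linear_left[of i]]
    have "blinfun_apply (integral (cbox a b) (fx t)) i = integral (cbox a b) (\<lambda>\<zeta>. blinfun_apply (fx t \<zeta>) i)"
      by (simp add: o_def)
    then show "partial_deriv i (\<lambda>t. integral (cbox a b) (\<lambda>\<zeta>. g \<zeta> * K (p \<zeta>) t)) t =
      integral (cbox a b) (\<lambda>\<zeta>. g \<zeta> * partial_deriv i (K (p \<zeta>)) t)"
      unfolding partial_deriv_eqI[OF D] fxL .
  qed
qed

text \<open>Each derivative of the modulated function stays in the modulated class, so the result
  for a single derivative applies at every stage of an induction on the multi-index.\<close>

lemma
  fixes a b :: "'b::euclidean_space" and \<psi> :: "'a::euclidean_space \<Rightarrow> complex"
  assumes sm: "smooth_fun \<psi>"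
    and g: "continuous_on (cbox a b) g" and p: "continuous_on (cbox a b) p"
  shows iter_partial_superposition: "is \<in> lists Basis \<Longrightarrow>
      iter_partial is (\<lambda>t. integral (cbox a b) (\<lambda>\<zeta>. g \<zeta> * (\<psi> t * osc (p \<zeta>) t))) =
      (\<lambda>t. integral (cbox a b) (\<lambda>\<zeta>. g \<zeta> * iter_partial is (\<lambda>t. \<psi> t * osc (p \<zeta>) t) t))"
    and smooth_fun_superposition:
      "smooth_fun (\<lambda>t. integral (cbox a b) (\<lambda>\<zeta>. g \<zeta> * (\<psi> t * osc (p \<zeta>) t)))"
proof -
  let ?f = "\<lambda>t. integral (cbox a b) (\<lambda>\<zeta>. g \<zeta> * (\<psi> t * osc (p \<zeta>) t))"
  have *: "iter_partial is ?f =
      (\<lambda>t. integral (cbox a b) (\<lambda>\<zeta>. g \<zeta> * iter_partial is (\<lambda>t. \<psi> t * osc (p \<zeta>) t) t))"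
    if "is \<in> lists Basis" for "is"
    using that
  proof (induction "is")
    case (Cons i "is")
    obtain K where K: "modulated \<psi> K" "\<And>\<eta>. iter_partial is (\<lambda>t. \<psi> t * osc \<eta> t) = K \<eta>"
      using modulated_iter_partial[OF sm, of "is"] Cons by blast
    have "iter_partial is ?f = (\<lambda>t. integral (cbox a b) (\<lambda>\<zeta>. g \<zeta> * K (p \<zeta>) t))"
      using Cons by (simp add: K(2))
    then show ?case
      using partial_deriv_integral_modulated[OF K(1) sm g p, of i] Cons by (simp add: K(2))
  qed simp
  then show "is \<in> lists Basis \<Longrightarrow> iter_partial is ?f =
      (\<lambda>t. integral (cbox a b) (\<lambda>\<zeta>. g \<zeta> * iter_partial is (\<lambda>t. \<psi> t * osc (p \<zeta>) t) t))" .
  show "smooth_fun ?f"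
    unfolding smooth_fun_def
  proof (intro ballI allI)
    fix "is" x assume i: "is \<in> lists (Basis :: 'a set)"
    obtain K where K: "modulated \<psi> K" "\<And>\<eta>. iter_partial is (\<lambda>t. \<psi> t * osc \<eta> t) = K \<eta>"
      using modulated_iter_partial[OF sm i] by blast
    show "iter_partial is ?f differentiable at x"
      unfolding *[OF i] K(2) by (rule differentiable_integral_modulated[OF K(1) sm g p])
  qed
qed

lemma superposition_integrand_continuous:
  fixes a b :: "'b::euclidean_space" and \<psi> :: "'a::euclidean_space \<Rightarrow> complex"
  assumes sm: "smooth_fun \<psi>" and p: "continuous_on S p" and "is": "is \<in> lists Basis"
  shows "continuous_on S (\<lambda>\<zeta>. iter_partial is (\<lambda>t. \<psi> t * osc (p \<zeta>) t) t)"
proof -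
  obtain K where K: "modulated \<psi> K" "\<And>\<eta>. iter_partial is (\<lambda>t. \<psi> t * osc \<eta> t) = K \<eta>"
    using modulated_iter_partial[OF sm "is"] by blast
  have "continuous_on S (\<lambda>\<zeta>. (p \<zeta>, t))" using p by (intro continuous_intros)
  from continuous_on_compose2[OF modulated_continuous_on[OF K(1) sm, of UNIV] this]
  show ?thesis by (simp add: K(2))
qed

text \<open>The weight \<open>g\<close> is integrated exactly over each cell and only
  \<open>F\<close> is frozen at the tag. Hence the error involves the oscillation of
  \<open>F\<close> alone, and \<open>g\<close> enters through its bound \<open>M\<close>.\<close>

lemma riemann_sum_product_error:
  fixes a b :: "'a::euclidean_space" and F g :: "'a \<Rightarrow> complex"
  assumes g: "continuous_on (cbox a b) g" and F: "continuous_on (cbox a b) F"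
    and M: "\<And>\<zeta>. \<zeta> \<in> cbox a b \<Longrightarrow> norm (g \<zeta>) \<le> M" and \<omega>: "M \<ge> 0" "\<omega> \<ge> 0"
    and D: "D tagged_division_of cbox a b"
    and osc: "\<And>x k \<zeta>. (x, k) \<in> D \<Longrightarrow> \<zeta> \<in> k \<Longrightarrow> norm (F \<zeta> - F x) \<le> \<omega>"
  shows "norm (integral (cbox a b) (\<lambda>\<zeta>. g \<zeta> * F \<zeta>) - (\<Sum>d\<in>D. integral (snd d) g * F (fst d)))
           \<le> M * \<omega> * measure lborel (cbox a b)"
proof -
  have sub: "k \<subseteq> cbox a b" "\<exists>c e. k = cbox c e" if "(x, k) \<in> D" for x k
    using tagged_division_ofD(3,4)[OF D that] by auto
  have gk: "g integrable_on k" "(\<lambda>\<zeta>. g \<zeta> * F \<zeta>) integrable_on k" if "(x, k) \<in> D" for x k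
    using sub[OF that] g F
    by (auto intro!: integrable_continuous continuous_on_mult intro: continuous_on_subset)
  have "integral (cbox a b) (\<lambda>\<zeta>. g \<zeta> * F \<zeta>) = (\<Sum>d\<in>D. integral (snd d) (\<lambda>\<zeta>. g \<zeta> * F \<zeta>))"
    using integral_combine_tagged_division_topdown[OF _ D, of "\<lambda>\<zeta>. g \<zeta> * F \<zeta>"] g F
    by (simp add: integrable_continuous continuous_on_mult split_beta)
  then have "norm (integral (cbox a b) (\<lambda>\<zeta>. g \<zeta> * F \<zeta>) - (\<Sum>d\<in>D. integral (snd d) g * F (fst d)))
     = norm (\<Sum>d\<in>D. integral (snd d) (\<lambda>\<zeta>. g \<zeta> * F \<zeta>) - integral (snd d) g * F (fst d))"
    by (simp add: sum_subtractf)
  also have "\<dots> \<le> (\<Sum>d\<in>D. M * \<omega> * measure lborel (snd d))"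
  proof (rule sum_norm_le)
    fix d assume "d \<in> D"
    then obtain x k where d: "d = (x, k)" "(x, k) \<in> D" by (cases d) auto
    obtain c e where k: "k = cbox c e" using sub[OF d(2)] by blast
    have h: "((\<lambda>\<zeta>. g \<zeta> * F \<zeta> - g \<zeta> * F x) has_integral
        (integral k (\<lambda>\<zeta>. g \<zeta> * F \<zeta>) - integral k g * F x)) k"
      by (intro has_integral_diff has_integral_mult_left integrable_integral gk[OF d(2)])
    have "norm (integral k (\<lambda>\<zeta>. g \<zeta> * F \<zeta>) - integral k g * F x) \<le> M * \<omega> * measure lborel k"
      unfolding k
    proof (rule has_integral_bound[OF _ h[unfolded k]])
      fix \<zeta> assume z: "\<zeta> \<in> cbox c e"
      have "norm (g \<zeta> * F \<zeta> - g \<zeta> * F x) = norm (g \<zeta>) * norm (F \<zeta> - F x)"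
        by (simp add: norm_mult flip: right_diff_distrib)
      also have "\<dots> \<le> M * \<omega>"
        using z k sub[OF d(2)] by (intro mult_mono M osc[OF d(2)] \<omega>) auto
      finally show "norm (g \<zeta> * F \<zeta> - g \<zeta> * F x) \<le> M * \<omega>" .
    qed (use \<omega> in simp)
    then show "norm (integral (snd d) (\<lambda>\<zeta>. g \<zeta> * F \<zeta>) - integral (snd d) g * F (fst d)) \<le> M * \<omega> * measure lborel (snd d)"
      using d by simp
  qed
  also have "\<dots> = M * \<omega> * measure lborel (cbox a b)"
    using additive_content_tagged_division[OF D] by (simp add: split_beta flip: sum_distrib_left)
  finally show ?thesis .
qed

text \<open>\<open>schwartz_seminorm\<close> is a supremum in a conditionally complete order; a
  pointwise bound \<open>B\<close> supplies the boundedness and takes its place. The value at the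
  origin shows that the seminorm is nonnegative, which allows the continuity constant to be replaced
  by its absolute value.\<close>

lemma tempered_distribution_bound:
  fixes u :: "('a::euclidean_space \<Rightarrow> complex) \<Rightarrow> complex"
  assumes "tempered_distribution u"
  obtains N C where "C \<ge> 0"
    "\<And>f B. schwartz f \<Longrightarrow>
      (\<And>is t. is \<in> lists Basis \<Longrightarrow> length is \<le> N \<Longrightarrow> bracket t ^ N * norm (iter_partial is f t) \<le> B) \<Longrightarrow>
      norm (u f) \<le> C * B"
proof -
  obtain N C where NC: "\<And>f. schwartz f \<Longrightarrow> norm (u f) \<le> C * schwartz_seminorm N f"
    using assms unfolding tempered_distribution_def by blast
  show ?thesis
  proof (rule that[of "\<bar>C\<bar>" N])
    fix f :: "'a \<Rightarrow> complex" and B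
    assume f: "schwartz f"
      and B: "\<And>is t. is \<in> lists Basis \<Longrightarrow> length is \<le> N \<Longrightarrow> bracket t ^ N * norm (iter_partial is f t) \<le> B"
    let ?I = "{is \<in> lists (Basis::'a set). length is \<le> N} \<times> (UNIV::'a set)"
    have mem: "([], 0) \<in> ?I" by simp
    have le: "schwartz_seminorm N f \<le> B"
      unfolding schwartz_seminorm_def
    proof (rule cSUP_least)
      show "?I \<noteq> {}" using mem by blast
    qed (use B in auto)
    have bdd: "bdd_above ((\<lambda>(is, x). bracket x ^ N * norm (iter_partial is f x)) ` ?I)"
      by (rule bdd_aboveI2[of _ _ B]) (use B in auto)
    have "bracket (0::'a) ^ N * norm (iter_partial [] f 0) \<le> schwartz_seminorm N f"
      using cSUP_upper[OF mem bdd] unfolding schwartz_seminorm_def prod.case .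
    moreover have "0 \<le> bracket (0::'a) ^ N * norm (iter_partial [] f 0)" using bracket_pos[of "0::'a"] by simp
    ultimately have ge: "0 \<le> schwartz_seminorm N f" by simp
    have "norm (u f) \<le> C * schwartz_seminorm N f" by (rule NC[OF f])
    also have "\<dots> \<le> \<bar>C\<bar> * B" using le ge by (intro mult_mono) auto
    finally show "norm (u f) \<le> \<bar>C\<bar> * B" .
  qed simp
qed

lemma fourier_dist_dist_mult: "fourier_dist (dist_mult \<psi> u) \<eta> = u (\<lambda>t. \<psi> t * osc \<eta> t)"
  by (simp add: fourier_dist_def dist_mult_def osc_def)

lemma tempered_distribution_diff:
  assumes "tempered_distribution u" "schwartz f" "schwartz g"
  shows "u (\<lambda>t. f t - g t) = u f - u g"
proof -
  have "u (\<lambda>t. f t + (-1) * g t) = u f + u (\<lambda>t. (-1) * g t)"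
    using assms schwartz_cmult[of g "-1"] unfolding tempered_distribution_def by blast
  moreover have "u (\<lambda>t. (-1) * g t) = (-1) * u g"
    using assms unfolding tempered_distribution_def by blast
  ultimately show ?thesis by simp
qed

lemma
  assumes "schwartz f" "schwartz g"
  shows schwartz_diff: "schwartz (\<lambda>t. f t - g t)"
    and iter_partial_diff: "is \<in> lists Basis \<Longrightarrow>
      iter_partial is (\<lambda>t. f t - g t) = (\<lambda>t. iter_partial is f t - iter_partial is g t)"
  using schwartz_add[OF assms(1) schwartz_cmult[OF assms(2), of "-1"]]
    iter_partial_add[of f "\<lambda>t. (-1) * g t" "is"] iter_partial_cmult[of g "is" "-1"]
    smooth_fun_cmult[of g "-1"] assms by (auto simp: schwartz_def)

text \<open>A weak form of the Paley-Wiener-Schwartz theorem: \<open>u\<close> is applied to the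
  uniform estimates for \<open>\<psi> t * osc \<eta> t\<close> and for differences of two such
  functions.\<close>

lemma fourier_dist_poly_lipschitz:
  fixes u :: "('a::euclidean_space \<Rightarrow> complex) \<Rightarrow> complex"
  assumes u: "tempered_distribution u" and \<psi>: "test_function \<psi>"
  obtains C L where "C \<ge> 0"
    "\<And>\<eta>. norm (fourier_dist (dist_mult \<psi> u) \<eta>) \<le> C * (1 + norm \<eta> + norm \<eta>) ^ L"
    "\<And>\<eta> \<eta>'. norm (fourier_dist (dist_mult \<psi> u) \<eta> - fourier_dist (dist_mult \<psi> u) \<eta>')
        \<le> C * (1 + norm \<eta> + norm \<eta>') ^ L * norm (\<eta> - \<eta>')"
proof -
  obtain N C where C: "C \<ge> 0" and ub: "\<And>f B. schwartz f \<Longrightarrow>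
      (\<And>is t. is \<in> lists Basis \<Longrightarrow> length is \<le> N \<Longrightarrow> bracket t ^ N * norm (iter_partial is f t) \<le> B) \<Longrightarrow>
      norm (u f) \<le> C * B"
    using tempered_distribution_bound[OF u] by metis
  obtain D L where pl: "\<And>is. is \<in> lists Basis \<Longrightarrow> length is \<le> N \<Longrightarrow>
      poly_lipschitz N (\<lambda>\<eta>. iter_partial is (\<lambda>t. \<psi> t * osc \<eta> t)) D L"
    using iter_partial_osc_poly_lipschitz[OF \<psi>, of N] by blast
  have D: "D \<ge> 0" using poly_lipschitz_nonneg[OF pl[of "[]"]] by simp
  note sch = schwartz_test_osc[OF \<psi>]
  show ?thesis
  proof (rule that[of "C * D" L])
    show "C * D \<ge> 0" using C D by simp
    fix \<eta> \<eta>' :: 'a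
    show "norm (fourier_dist (dist_mult \<psi> u) \<eta>) \<le> C * D * (1 + norm \<eta> + norm \<eta>) ^ L"
      unfolding fourier_dist_dist_mult mult.assoc
      by (rule ub[OF sch]) (use pl in \<open>unfold poly_lipschitz_def, blast\<close>)
    have "fourier_dist (dist_mult \<psi> u) \<eta> - fourier_dist (dist_mult \<psi> u) \<eta>'
        = u (\<lambda>t. \<psi> t * osc \<eta> t - \<psi> t * osc \<eta>' t)"
      unfolding fourier_dist_dist_mult by (rule tempered_distribution_diff[OF u sch sch, symmetric])
    also have "norm \<dots> \<le> C * (D * (1 + norm \<eta> + norm \<eta>') ^ L * norm (\<eta> - \<eta>'))"
    proof (rule ub[OF schwartz_diff[OF sch sch]])
      fix "is" :: "'a list" and t :: 'a
      assume "is": "is \<in> lists Basis" "length is \<le> N"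
      show "bracket t ^ N * norm (iter_partial is (\<lambda>t. \<psi> t * osc \<eta> t - \<psi> t * osc \<eta>' t) t)
          \<le> D * (1 + norm \<eta> + norm \<eta>') ^ L * norm (\<eta> - \<eta>')"
        unfolding iter_partial_diff[OF sch sch "is"(1)]
        using pl[OF "is"] unfolding poly_lipschitz_def by blast
    qed
    finally show "norm (fourier_dist (dist_mult \<psi> u) \<eta> - fourier_dist (dist_mult \<psi> u) \<eta>')
        \<le> C * D * (1 + norm \<eta> + norm \<eta>') ^ L * norm (\<eta> - \<eta>')" by (simp add: mult_ac)
  qed
qed

lemma continuous_on_fourier_dist:
  fixes u :: "('a::euclidean_space \<Rightarrow> complex) \<Rightarrow> complex"
  assumes "tempered_distribution u" and "test_function \<psi>"
  shows "continuous_on A (fourier_dist (dist_mult \<psi> u))"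
proof -
  let ?V = "fourier_dist (dist_mult \<psi> u)"
  obtain C L where V: "\<And>\<eta> \<eta>'. norm (?V \<eta> - ?V \<eta>') \<le> C * (1 + norm \<eta> + norm \<eta>') ^ L * norm (\<eta> - \<eta>')"
    using fourier_dist_poly_lipschitz[OF assms] by metis
  have "?V \<midarrow>\<eta>\<rightarrow> ?V \<eta>" for \<eta>
  proof (rule Lim_null[THEN iffD2], rule Lim_null_comparison[OF always_eventually])
    show "\<forall>x. norm (?V x - ?V \<eta>) \<le> C * (1 + norm x + norm \<eta>) ^ L * norm (x - \<eta>)" using V by blast
    have "(\<lambda>x. C * (1 + norm x + norm \<eta>) ^ L * norm (x - \<eta>)) \<midarrow>\<eta>\<rightarrow> C * (1 + norm \<eta> + norm \<eta>) ^ L * norm (\<eta> - \<eta>)"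
      by (intro tendsto_intros)
    then show "(\<lambda>x. C * (1 + norm x + norm \<eta>) ^ L * norm (x - \<eta>)) \<midarrow>\<eta>\<rightarrow> 0" by simp
  qed
  then show ?thesis by (intro continuous_at_imp_continuous_on) (simp add: isCont_def)
qed

text \<open>The frequencies \<open>p \<zeta>\<close> stay bounded on the compact box, so the
  integrand is bounded in each weighted seminorm uniformly over the box.\<close>

lemma schwartz_superposition:
  fixes a b :: "'b::euclidean_space" and \<psi> :: "'a::euclidean_space \<Rightarrow> complex"
  assumes \<psi>: "test_function \<psi>" and g: "continuous_on (cbox a b) g" and p: "continuous_on (cbox a b) p"
  shows "schwartz (\<lambda>t. integral (cbox a b) (\<lambda>\<zeta>. g \<zeta> * (\<psi> t * osc (p \<zeta>) t)))"
  unfolding schwartz_def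
proof (intro conjI ballI allI)
  have sm: "smooth_fun \<psi>" using \<psi> by (simp add: test_function_def)
  show "smooth_fun (\<lambda>t. integral (cbox a b) (\<lambda>\<zeta>. g \<zeta> * (\<psi> t * osc (p \<zeta>) t)))"
    by (rule smooth_fun_superposition[OF sm g p])
  fix "is" N assume "is": "is \<in> lists (Basis :: 'a set)"
  obtain K where K: "modulated \<psi> K" "\<And>\<eta>. iter_partial is (\<lambda>t. \<psi> t * osc \<eta> t) = K \<eta>"
    using modulated_iter_partial[OF sm "is"] by blast
  obtain C L where CL: "poly_lipschitz N (\<lambda>\<eta>. iter_partial is (\<lambda>t. \<psi> t * osc \<eta> t)) C L"
    using modulated_poly_lipschitz[OF K(1) \<psi>, of N] unfolding K(2) by blast
  have "bounded ((\<lambda>\<zeta>. norm (g \<zeta>) * (C * (1 + norm (p \<zeta>) + norm (p \<zeta>)) ^ L)) ` cbox a b)"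
    by (intro compact_imp_bounded compact_continuous_image compact_cbox continuous_intros g p)
  then obtain B where B: "B > 0"
    "\<And>\<zeta>. \<zeta> \<in> cbox a b \<Longrightarrow> norm (norm (g \<zeta>) * (C * (1 + norm (p \<zeta>) + norm (p \<zeta>)) ^ L)) \<le> B"
    unfolding bounded_pos by blast
  have "bracket t ^ N * norm (iter_partial is (\<lambda>t. integral (cbox a b) (\<lambda>\<zeta>. g \<zeta> * (\<psi> t * osc (p \<zeta>) t))) t)
      \<le> B * measure lborel (cbox a b)" for t
  proof -
    let ?I = "\<lambda>\<zeta>. bracket t ^ N *\<^sub>R (g \<zeta> * iter_partial is (\<lambda>t. \<psi> t * osc (p \<zeta>) t) t)"
    have I: "(?I has_integral bracket t ^ N *\<^sub>R integral (cbox a b) (\<lambda>\<zeta>. g \<zeta> * iter_partial is (\<lambda>t. \<psi> t * osc (p \<zeta>) t) t)) (cbox a b)"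
      by (intro has_integral_cmul integrable_integral integrable_continuous continuous_on_mult g
          superposition_integrand_continuous sm p "is")
    have "norm (bracket t ^ N *\<^sub>R integral (cbox a b) (\<lambda>\<zeta>. g \<zeta> * iter_partial is (\<lambda>t. \<psi> t * osc (p \<zeta>) t) t))
      \<le> B * measure lborel (cbox a b)"
    proof (rule has_integral_bound[OF _ I])
      fix \<zeta> assume z: "\<zeta> \<in> cbox a b"
      have "norm (?I \<zeta>) = norm (g \<zeta>) * (bracket t ^ N * norm (iter_partial is (\<lambda>t. \<psi> t * osc (p \<zeta>) t) t))"
        using bracket_pos[of t] by (simp add: norm_mult)
      also have "\<dots> \<le> norm (g \<zeta>) * (C * (1 + norm (p \<zeta>) + norm (p \<zeta>)) ^ L)"
        by (rule mult_left_mono) (use CL in \<open>unfold poly_lipschitz_def, blast, simp\<close>)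
      also have "\<dots> \<le> B" using B(2)[OF z] by simp
      finally show "norm (?I \<zeta>) \<le> B" .
    qed (use B in simp)
    then show ?thesis
      unfolding iter_partial_superposition[OF sm g p "is"] using bracket_pos[of t] by simp
  qed
  then show "\<exists>C. \<forall>x. bracket x ^ N * norm (iter_partial is (\<lambda>t. integral (cbox a b) (\<lambda>\<zeta>. g \<zeta> * (\<psi> t * osc (p \<zeta>) t))) x) \<le> C"
    by blast
qed

text \<open>The pairing is exchanged with the integral through Riemann sums, which converge in every
  Schwartz seminorm.\<close>

theorem tempered_distribution_superposition:
  fixes a b :: "'b::euclidean_space" and \<psi> :: "'a::euclidean_space \<Rightarrow> complex"
  assumes u: "tempered_distribution u" and \<psi>: "test_function \<psi>"
    and g: "continuous_on (cbox a b) g"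
    and p: "\<And>\<zeta> \<zeta>'. norm (p \<zeta> - p \<zeta>') \<le> H * norm (\<zeta> - \<zeta>')"
  shows "u (\<lambda>t. integral (cbox a b) (\<lambda>\<zeta>. g \<zeta> * (\<psi> t * osc (p \<zeta>) t)))
           = integral (cbox a b) (\<lambda>\<zeta>. g \<zeta> * fourier_dist (dist_mult \<psi> u) (p \<zeta>))"
proof -
  let ?V = "fourier_dist (dist_mult \<psi> u)"
  define f where "f t = integral (cbox a b) (\<lambda>\<zeta>. g \<zeta> * (\<psi> t * osc (p \<zeta>) t))" for t
  have sm: "smooth_fun \<psi>" using \<psi> by (simp add: test_function_def)
  have H: "H \<ge> 0"
  proof -
    obtain i :: 'b where "i \<in> Basis" using nonempty_Basis by blast
    then show ?thesis using order_trans[OF norm_ge_zero p[of i 0]] by simp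
  qed
  have pc: "continuous_on A p" for A
    by (rule lipschitz_on_continuous_on[OF lipschitz_onI[of _ _ H]]) (use p H in \<open>auto simp: dist_norm\<close>)
  obtain N C where C: "C \<ge> 0" and ub: "\<And>f B. schwartz f \<Longrightarrow>
      (\<And>is t. is \<in> lists Basis \<Longrightarrow> length is \<le> N \<Longrightarrow> bracket t ^ N * norm (iter_partial is f t) \<le> B) \<Longrightarrow>
      norm (u f) \<le> C * B"
    using tempered_distribution_bound[OF u] by metis
  obtain D L where pl: "\<And>is. is \<in> lists Basis \<Longrightarrow> length is \<le> N \<Longrightarrow>
      poly_lipschitz N (\<lambda>\<eta>. iter_partial is (\<lambda>t. \<psi> t * osc \<eta> t)) D L"
    using iter_partial_osc_poly_lipschitz[OF \<psi>, of N] by blast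
  have D: "D \<ge> 0" using poly_lipschitz_nonneg[OF pl[of "[]"]] by simp
  obtain E L' where E: "E \<ge> 0"
    and VL: "\<And>\<eta> \<eta>'. norm (?V \<eta> - ?V \<eta>') \<le> E * (1 + norm \<eta> + norm \<eta>') ^ L' * norm (\<eta> - \<eta>')"
    using fourier_dist_poly_lipschitz[OF u \<psi>] by metis
  obtain P where P: "P > 0" "\<And>\<zeta>. \<zeta> \<in> cbox a b \<Longrightarrow> norm (p \<zeta>) \<le> P"
    using compact_imp_bounded[OF compact_continuous_image[OF pc compact_cbox[of a b]]] unfolding bounded_pos by blast
  obtain M where M: "M > 0" "\<And>\<zeta>. \<zeta> \<in> cbox a b \<Longrightarrow> norm (g \<zeta>) \<le> M"
    using compact_imp_bounded[OF compact_continuous_image[OF g compact_cbox[of a b]]] unfolding bounded_pos by blast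
  note sch = schwartz_test_osc[OF \<psi>]
  have fs: "schwartz f" unfolding f_def by (rule schwartz_superposition[OF \<psi> g pc])
  \<comment> \<open>\<open>Z\<close> collects two Riemann sum errors, both linear in the mesh: that
    of \<open>f\<close> in the seminorm bounding \<open>u\<close>, and that of the scalar integral
    on the right.\<close>
  define Z where "Z = M * H * measure lborel (cbox a b) * (C * (D * (1 + P + P) ^ L) + E * (1 + P + P) ^ L')"
  have W: "(1 + norm (p x) + norm (p y)) ^ m \<le> (1 + P + P) ^ m" if "x \<in> cbox a b" "y \<in> cbox a b" for x y m
    using P(2)[OF that(1)] P(2)[OF that(2)] by (intro power_mono) auto
  have main: "norm (u f - integral (cbox a b) (\<lambda>\<zeta>. g \<zeta> * ?V (p \<zeta>))) \<le> Z * \<delta>" if \<delta>: "\<delta> > 0" for \<delta>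
  proof (cases "cbox a b = {}")
    case True
    \<comment> \<open>On an empty box \<open>f\<close> is zero; writing it as a zero multiple of a
      Schwartz function lets homogeneity give \<open>u f = 0\<close>.\<close>
    then have "f = (\<lambda>t. 0 * (\<psi> t * osc 0 t))" by (simp add: f_def fun_eq_iff)
    then have "u f = u (\<lambda>t. 0 * (\<psi> t * osc 0 t))" by simp
    also have "\<dots> = 0 * u (\<lambda>t. \<psi> t * osc 0 t)"
      using u sch[of 0] unfolding tempered_distribution_def by blast
    finally show ?thesis using True by (simp add: Z_def)
  next
    case False
    obtain \<D> where \<D>: "\<D> tagged_division_of cbox a b" "(\<lambda>x. ball x \<delta>) fine \<D>"
      using fine_division_exists[OF gauge_ball[OF \<delta>], of a b] by blast
    have fin: "finite \<D>" using \<D>(1) by blast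
    have ne: "\<D> \<noteq> {}" using \<D>(1) False by auto
    define S where "S t = (\<Sum>d\<in>\<D>. integral (snd d) g * (\<psi> t * osc (p (fst d)) t))" for t
    have Ss: "schwartz S" unfolding S_def by (intro schwartz_sum fin schwartz_cmult sch ne)
    have close: "norm (p \<zeta> - p x) \<le> H * \<delta>" "\<zeta> \<in> cbox a b" "x \<in> cbox a b" if "(x, k) \<in> \<D>" "\<zeta> \<in> k" for x k \<zeta>
    proof -
      have "k \<subseteq> ball x \<delta>" using \<D>(2) that(1) unfolding fine_def by auto
      then have "norm (\<zeta> - x) \<le> \<delta>" using that(2) by (auto simp: dist_norm norm_minus_commute)
      then show "norm (p \<zeta> - p x) \<le> H * \<delta>"
        using order_trans[OF p[of \<zeta> x] mult_left_mono[OF _ H]] by blast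
      show "\<zeta> \<in> cbox a b" "x \<in> cbox a b" using tagged_division_ofD(2,3)[OF \<D>(1) that(1)] that(2) by auto
    qed
    have b1: "norm (u (\<lambda>t. f t - S t)) \<le> C * (M * (D * (1 + P + P) ^ L * (H * \<delta>)) * measure lborel (cbox a b))"
    proof (rule ub[OF schwartz_diff[OF fs Ss]])
      fix "is" :: "'a list" and t :: 'a
      assume "is": "is \<in> lists Basis" "length is \<le> N"
      let ?K = "\<lambda>\<eta>. iter_partial is (\<lambda>t. \<psi> t * osc \<eta> t) t"
      \<comment> \<open>The weight is put into \<open>?F\<close>, so that the error bound concerns
        the weighted derivative itself, uniformly in \<open>t\<close>.\<close>
      let ?F = "\<lambda>\<zeta>. complex_of_real (bracket t ^ N) * ?K (p \<zeta>)"
      have "norm (integral (cbox a b) (\<lambda>\<zeta>. g \<zeta> * ?F \<zeta>) - (\<Sum>d\<in>\<D>. integral (snd d) g * ?F (fst d)))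
          \<le> M * (D * (1 + P + P) ^ L * (H * \<delta>)) * measure lborel (cbox a b)"
      proof (rule riemann_sum_product_error[OF g _ M(2) _ _ \<D>(1)])
        show "continuous_on (cbox a b) ?F"
          by (intro continuous_intros superposition_integrand_continuous[OF sm pc "is"(1)])
        show "0 \<le> D * (1 + P + P) ^ L * (H * \<delta>)" using D P H \<delta> by simp
        fix x k \<zeta> assume xk: "(x, k) \<in> \<D>" "\<zeta> \<in> k"
        note cl = close[OF xk]
        have "norm (?F \<zeta> - ?F x) = bracket t ^ N * norm (?K (p \<zeta>) - ?K (p x))"
          using bracket_pos[of t] by (simp add: norm_mult norm_power flip: right_diff_distrib)
        also have "\<dots> \<le> D * (1 + norm (p \<zeta>) + norm (p x)) ^ L * norm (p \<zeta> - p x)"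
          using pl[OF "is"] unfolding poly_lipschitz_def by blast
        also have "\<dots> \<le> D * (1 + P + P) ^ L * (H * \<delta>)"
          using W[OF cl(2,3)] cl(1) D P by (intro mult_mono) auto
        finally show "norm (?F \<zeta> - ?F x) \<le> D * (1 + P + P) ^ L * (H * \<delta>)" .
      qed (use M in auto)
      also have "integral (cbox a b) (\<lambda>\<zeta>. g \<zeta> * ?F \<zeta>) = complex_of_real (bracket t ^ N) * iter_partial is f t"
      proof -
        have "integral (cbox a b) (\<lambda>\<zeta>. g \<zeta> * ?F \<zeta>) = integral (cbox a b) (\<lambda>\<zeta>. complex_of_real (bracket t ^ N) * (g \<zeta> * ?K (p \<zeta>)))"
          by (simp add: mult_ac)
        also have "\<dots> = complex_of_real (bracket t ^ N) * integral (cbox a b) (\<lambda>\<zeta>. g \<zeta> * ?K (p \<zeta>))"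
          by (rule integral_mult_right)
        finally show ?thesis
          unfolding f_def[abs_def] iter_partial_superposition[OF sm g pc "is"(1)] .
      qed
      also have "(\<Sum>d\<in>\<D>. integral (snd d) g * ?F (fst d)) = complex_of_real (bracket t ^ N) * iter_partial is S t"
      proof -
        have "iter_partial is S t = (\<Sum>d\<in>\<D>. iter_partial is (\<lambda>t. integral (snd d) g * (\<psi> t * osc (p (fst d)) t)) t)"
          unfolding S_def[abs_def] by (subst iter_partial_sum[OF fin _ ne "is"(1)]) (auto intro: schwartz_cmult sch)
        also have "\<dots> = (\<Sum>d\<in>\<D>. integral (snd d) g * ?K (p (fst d)))"
          by (subst iter_partial_cmult[OF _ "is"(1)]) (use sch in \<open>auto simp: schwartz_def\<close>)
        finally show ?thesis by (simp add: sum_distrib_left mult_ac)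
      qed
      finally show "bracket t ^ N * norm (iter_partial is (\<lambda>t. f t - S t) t)
          \<le> M * (D * (1 + P + P) ^ L * (H * \<delta>)) * measure lborel (cbox a b)"
        unfolding iter_partial_diff[OF fs Ss "is"(1)]
        using bracket_pos[of t] by (simp add: norm_mult norm_power flip: right_diff_distrib)
    qed
    have b2: "norm (integral (cbox a b) (\<lambda>\<zeta>. g \<zeta> * ?V (p \<zeta>)) - (\<Sum>d\<in>\<D>. integral (snd d) g * ?V (p (fst d))))
        \<le> M * (E * (1 + P + P) ^ L' * (H * \<delta>)) * measure lborel (cbox a b)"
    proof (rule riemann_sum_product_error[OF g _ M(2) _ _ \<D>(1)])
      show "continuous_on (cbox a b) (\<lambda>\<zeta>. ?V (p \<zeta>))"
        by (rule continuous_on_compose2[OF continuous_on_fourier_dist[OF u \<psi>, of UNIV] pc]) auto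
      show "0 \<le> E * (1 + P + P) ^ L' * (H * \<delta>)" using E P H \<delta> by simp
      fix x k \<zeta> assume xk: "(x, k) \<in> \<D>" "\<zeta> \<in> k"
      note cl = close[OF xk]
      have "norm (?V (p \<zeta>) - ?V (p x)) \<le> E * (1 + norm (p \<zeta>) + norm (p x)) ^ L' * norm (p \<zeta> - p x)"
        by (rule VL)
      also have "\<dots> \<le> E * (1 + P + P) ^ L' * (H * \<delta>)"
        using W[OF cl(2,3)] cl(1) E P by (intro mult_mono) auto
      finally show "norm (?V (p \<zeta>) - ?V (p x)) \<le> E * (1 + P + P) ^ L' * (H * \<delta>)" .
    qed (use M in auto)
    \<comment> \<open>\<open>u\<close> acts termwise on the finite sum \<open>S\<close>, and the
      result is exactly the Riemann sum of the scalar integral.\<close>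
    have b3: "u S = (\<Sum>d\<in>\<D>. integral (snd d) g * ?V (p (fst d)))"
    proof -
      have "u S = (\<Sum>d\<in>\<D>. u (\<lambda>t. integral (snd d) g * (\<psi> t * osc (p (fst d)) t)))"
        unfolding S_def[abs_def] by (rule tempered_distribution_sum[OF fin _ ne u]) (auto intro: schwartz_cmult sch)
      also have "\<dots> = (\<Sum>d\<in>\<D>. integral (snd d) g * ?V (p (fst d)))"
        unfolding fourier_dist_dist_mult
        using u sch unfolding tempered_distribution_def by (intro sum.cong refl) blast
      finally show ?thesis .
    qed
    have tri: "norm (x - z) \<le> A + B" if "norm (x - y) \<le> A" "norm (z - y) \<le> B" for x y z :: complex and A B
      using norm_triangle_ineq4[of "x - y" "z - y"] that by simp
    have "norm (u f - integral (cbox a b) (\<lambda>\<zeta>. g \<zeta> * ?V (p \<zeta>)))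
        \<le> C * (M * (D * (1 + P + P) ^ L * (H * \<delta>)) * measure lborel (cbox a b))
          + M * (E * (1 + P + P) ^ L' * (H * \<delta>)) * measure lborel (cbox a b)"
      using b1 b2 unfolding tempered_distribution_diff[OF u fs Ss] b3[symmetric] by (rule tri)
    also have "\<dots> = Z * \<delta>" by (simp add: Z_def algebra_simps)
    finally show ?thesis .
  qed
  have Z: "Z \<ge> 0" unfolding Z_def using M H C D E P by (intro mult_nonneg_nonneg add_nonneg_nonneg) auto
  \<comment> \<open>The estimate \<open>main\<close> holds for every mesh size, which leaves 0 on
    the right; \<open>Z + 1\<close> avoids a division by zero.\<close>
  have "norm (u f - integral (cbox a b) (\<lambda>\<zeta>. g \<zeta> * ?V (p \<zeta>))) \<le> 0"
  proof (rule field_le_epsilon)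
    fix e :: real assume "e > 0"
    then have "Z * (e / (Z + 1)) \<le> e" using Z by (simp add: field_simps)
    then show "norm (u f - integral (cbox a b) (\<lambda>\<zeta>. g \<zeta> * ?V (p \<zeta>))) \<le> 0 + e"
      using main[of "e / (Z + 1)"] Z \<open>e > 0\<close> by simp
  qed
  then show ?thesis by (simp add: f_def[abs_def])
qed

section \<open>Block energies as integrals\<close>

lemma integrable_inverse_one_plus_square: "integrable lborel (\<lambda>x::real. inverse (1 + x\<^sup>2))"
proof -
  have "einterval (- \<infinity>) \<infinity> = UNIV" by (auto simp: einterval_def)
  then show ?thesis
    using integrable_inverse_1_plus_square by (simp add: set_integrable_def)
qed

lemma schwartz_continuous_on: "schwartz f \<Longrightarrow> continuous_on A f"
  using smooth_fun_continuous_on[of f "[]"] by (simp add: schwartz_def)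

lemma schwartz_bounded:
  assumes "schwartz f"
  obtains C where "\<And>x. norm (f x) \<le> C"
proof -
  have "\<exists>C. \<forall>x. bracket x ^ 0 * norm (iter_partial [] f x) \<le> C"
    using assms unfolding schwartz_def by blast
  then show ?thesis using that by auto
qed

text \<open>The power \<open>2 * DIM('a)\<close> of the bracket dominates the product of
  \<open>1 + (x \<bullet> i)\<^sup>2\<close> over the coordinates, so \<open>f\<close> is dominated
  by a product of integrable functions of one variable.\<close>

lemma schwartz_integrable:
  fixes f :: "'a::euclidean_space \<Rightarrow> complex"
  assumes "schwartz f"
  shows "integrable lborel f"
proof -
  have "\<exists>C. \<forall>x. bracket x ^ (2 * DIM('a)) * norm (iter_partial [] f x) \<le> C"
    using assms unfolding schwartz_def by blast
  then obtain C where C: "\<And>x. bracket x ^ (2 * DIM('a)) * norm (f x) \<le> C" by auto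
  have C0: "C \<ge> 0" using order_trans[OF _ C[of 0]] bracket_pos[of "0::'a"] by simp
  have "norm (f x) \<le> norm (C * (\<Prod>i\<in>Basis. inverse (1 + (x \<bullet> i)\<^sup>2)))" for x
  proof -
    have pos: "0 < (\<Prod>i\<in>Basis. 1 + (x \<bullet> i)\<^sup>2)"
      by (intro prod_pos) (auto intro: add_pos_nonneg)
    have "(\<Prod>i\<in>Basis. 1 + (x \<bullet> i)\<^sup>2) \<le> (\<Prod>i\<in>(Basis::'a set). (bracket x)\<^sup>2)"
    proof (intro prod_mono conjI)
      fix i :: 'a assume "i \<in> Basis"
      then have "\<bar>x \<bullet> i\<bar>\<^sup>2 \<le> (norm x)\<^sup>2" by (intro power_mono Basis_le_norm) auto
      then show "1 + (x \<bullet> i)\<^sup>2 \<le> (bracket x)\<^sup>2" by (simp add: bracket_def)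
    qed (auto intro: add_nonneg_nonneg)
    also have "\<dots> = bracket x ^ (2 * DIM('a))" by (simp add: power_mult)
    finally have "(\<Prod>i\<in>Basis. 1 + (x \<bullet> i)\<^sup>2) * norm (f x) \<le> C"
      using C[of x] mult_right_mono[OF _ norm_ge_zero[of "f x"]] by (meson order_trans)
    then have "norm (f x) \<le> C / (\<Prod>i\<in>Basis. 1 + (x \<bullet> i)\<^sup>2)"
      using pos by (simp add: pos_le_divide_eq mult.commute)
    also have "\<dots> = C * (\<Prod>i\<in>Basis. inverse (1 + (x \<bullet> i)\<^sup>2))"
      by (simp add: divide_inverse flip: prod_inversef[unfolded o_def])
    finally show ?thesis by simp
  qed
  moreover have int: "integrable lborel (\<lambda>x::'a. C * (\<Prod>i\<in>Basis. inverse (1 + (x \<bullet> i)\<^sup>2)))"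
    by (intro integrable_mult_right integrable_lborel_prod integrable_inverse_one_plus_square)
  moreover have "f \<in> borel_measurable lborel"
    using schwartz_continuous_on[OF assms] by (simp add: borel_measurable_continuous_onI)
  ultimately show ?thesis by (intro Bochner_Integration.integrable_bound[OF int]) auto
qed

lemma outside_supp: "t \<notin> supp f \<Longrightarrow> f t = 0"
  using iter_partial_outside_supp[of "[]"] by simp

text \<open>A bridge between the Lebesgue integral of Fourier inversion and the integral over a box
  used for Parseval's identity and for superpositions.\<close>

lemma
  fixes f :: "'a::euclidean_space \<Rightarrow> complex"
  assumes "continuous_on UNIV f" "\<And>x. x \<notin> cbox a b \<Longrightarrow> f x = 0"
  shows integrable_lborel_supp_cbox: "integrable lborel f"
    and integral_lborel_supp_cbox: "(\<integral>x. f x \<partial>lborel) = integral (cbox a b) f"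
proof -
  have eq: "(\<lambda>x. indicat_real (cbox a b) x *\<^sub>R f x) = f"
    using assms(2) by (auto simp: indicator_def fun_eq_iff)
  have "integrable lborel (\<lambda>x. indicat_real (cbox a b) x *\<^sub>R f x)"
    by (intro borel_integrable_compact compact_cbox continuous_on_subset[OF assms(1)]) auto
  then show i: "integrable lborel f" unfolding eq .
  have "set_integrable lborel (cbox a b) f" unfolding set_integrable_def eq by (rule i)
  from set_borel_integral_eq_integral(2)[OF this]
  show "(\<integral>x. f x \<partial>lborel) = integral (cbox a b) f"
    unfolding set_lebesgue_integral_def eq .
qed

lemma ball_subset_cube:
  assumes "R \<le> T"
  shows "ball 0 R \<subseteq> cube T"
proof
  fix x :: 'a assume "x \<in> ball 0 R"
  then have "norm x \<le> T" using assms by simp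
  then show "x \<in> cube T" using Basis_le_norm[of _ x] by (fastforce simp: mem_cube)
qed

text \<open>Retained points are candidates, and candidates lie in their annuli. For positive
  \<alpha> this bound makes \<open>norm (\<xi> k) powr (1 - \<alpha>)\<close> at most
  \<open>norm (\<xi> k)\<close>.\<close>

lemma subdyadic_centers_norm_ge_1:
  assumes "subdyadic_centers \<alpha> \<rho> a \<xi>"
  shows "norm (\<xi> k) \<ge> 1"
proof -
  obtain P sel c where
    sel: "\<forall>n. \<forall>Q\<in>P n. Q \<inter> annulus n \<noteq> {} \<longrightarrow> sel n Q \<in> Q \<inter> annulus n"
    and c: "bij_betw c UNIV (candidates P sel)"
    and \<xi>: "bij_betw \<xi> UNIV (retained_points \<alpha> \<rho> a c)"
    using assms unfolding subdyadic_centers_def by (elim exE conjE) (rule that)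
  have "\<xi> k \<in> retained_points \<alpha> \<rho> a c" using \<xi> by (auto simp: bij_betw_def)
  then have "\<xi> k \<in> range c" unfolding retained_points_def by blast
  then have "\<xi> k \<in> candidates P sel" using c by (simp add: bij_betw_def)
  then obtain n Q where "\<xi> k = sel n Q" "Q \<in> P n" "Q \<inter> annulus n \<noteq> {}"
    unfolding candidates_def by blast
  then have "\<xi> k \<in> annulus n" using sel by auto
  then have "2 ^ n \<le> norm (\<xi> k)" by (simp add: annulus_def)
  moreover have "(1::real) \<le> 2 ^ n" by simp
  ultimately show ?thesis by linarith
qed

text \<open>\<open>u\<close> is exchanged with the frequency integral separately for each
  \<open>j\<close>, with the weight
  \<open>fourier \<phi> \<zeta> * cnj (trig_exp \<beta> j \<zeta>)\<close>; what remains is a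
  coefficient of the function \<open>G\<close>, which does not depend on \<open>j\<close>.
  Summability comes with Parseval's identity, without any assumption of decay.\<close>

lemma
  fixes \<phi> :: "'a::euclidean_space \<Rightarrow> complex" and \<alpha> :: real
  assumes \<phi>: "schwartz \<phi>" "\<And>t. \<phi> t \<in> \<real>" "\<And>t. \<phi> (- t) = \<phi> t" "test_function (fourier \<phi>)"
    and supp: "supp (fourier \<phi>) \<subseteq> ball 0 R\<^sub>1"
    and b: "b > 0" and \<rho>: "\<rho> > 0" and bR: "b * \<rho> * R\<^sub>1 < pi"
    and \<xi>: "norm (\<xi> k) \<ge> 1"
    and u: "tempered_distribution u" and \<psi>: "test_function \<psi>"
  defines "\<beta> \<equiv> b * \<rho>" and "h \<equiv> norm (\<xi> k) powr (1 - \<alpha>)"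
  shows packet_coeff_summable:
      "(\<lambda>j. (norm (packet_coeff \<alpha> b \<phi> \<rho> \<xi> (dist_mult \<psi> u) k j))\<^sup>2) summable_on int_lattice"
    and block_energy_square: "(block_energy \<alpha> b \<phi> \<rho> \<xi> (dist_mult \<psi> u) k)\<^sup>2 =
      (h / (2 * pi * \<beta>)) ^ DIM('a) * integral (cube (pi / \<beta>))
        (\<lambda>\<zeta>. (norm (fourier \<phi> \<zeta> * fourier_dist (dist_mult \<psi> u) (\<xi> k + h *\<^sub>R \<zeta>)))\<^sup>2)"
proof -
  let ?V = "fourier_dist (dist_mult \<psi> u)"
  let ?Q = "cube (pi / \<beta>) :: 'a set"
  define p where "p \<zeta> = \<xi> k + h *\<^sub>R \<zeta>" for \<zeta>
  define G where "G \<zeta> = fourier \<phi> \<zeta> * ?V (p \<zeta>)" for \<zeta>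
  \<comment> \<open>The amplitude of the packet divided by the factor of Fourier inversion.\<close>
  define \<kappa> where "\<kappa> = norm (\<xi> k) powr (real DIM('a) / 2 * (1 - \<alpha>)) / (2 * pi) ^ DIM('a)"
  have \<beta>: "\<beta> > 0" using b \<rho> by (simp add: \<beta>_def)
  have "\<xi> k \<noteq> 0" using \<xi> by auto
  then have h: "h > 0" by (simp add: h_def)
  have RT: "R\<^sub>1 < pi / \<beta>" using bR \<beta> by (simp add: \<beta>_def field_simps)
  have fc: "continuous_on A (fourier \<phi>)" for A
    using smooth_fun_continuous_on[of "fourier \<phi>" "[]"] \<phi>(4) by (simp add: test_function_def)
  \<comment> \<open>Parseval's identity asks for zeros on the faces as well; the faces too lie
    outside the ball of radius \<open>R\<^sub>1\<close> that contains the support.\<close>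
  have f0: "fourier \<phi> \<zeta> = 0" if "\<zeta> \<notin> ?Q \<or> (\<exists>i\<in>Basis. \<bar>\<zeta> \<bullet> i\<bar> = pi / \<beta>)" for \<zeta>
  proof (rule outside_supp[of _ "fourier \<phi>"])
    have "\<not> norm \<zeta> < R\<^sub>1"
      using that
    proof
      assume "\<zeta> \<notin> ?Q"
      then show ?thesis using ball_subset_cube[of R\<^sub>1 "pi / \<beta>"] RT by auto
    next
      assume "\<exists>i\<in>Basis. \<bar>\<zeta> \<bullet> i\<bar> = pi / \<beta>"
      then show ?thesis using Basis_le_norm[of _ \<zeta>] RT by fastforce
    qed
    then show "\<zeta> \<notin> supp (fourier \<phi>)" using supp by auto
  qed
  have pl: "norm (p \<zeta> - p \<zeta>') \<le> h * norm (\<zeta> - \<zeta>')" for \<zeta> \<zeta>'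
    using h by (simp add: p_def flip: scaleR_diff_right)
  have pc: "continuous_on A p" for A unfolding p_def by (intro continuous_intros)
  have Gc: "continuous_on A G" for A
    unfolding G_def
    by (intro continuous_on_mult fc continuous_on_compose2[OF continuous_on_fourier_dist[OF u \<psi>, of UNIV] pc]) auto
  have fi: "integrable lborel (fourier \<phi>)"
    by (rule integrable_lborel_supp_cbox[OF fc]) (use f0 in \<open>auto simp: cube_def\<close>)
  obtain B where B: "\<And>x. norm (\<phi> x) \<le> B" using schwartz_bounded[OF \<phi>(1)] by blast
  note inv = fourier_inversion[OF schwartz_integrable[OF \<phi>(1)] schwartz_continuous_on[OF \<phi>(1)] B fi]
  have coeff: "packet_coeff \<alpha> b \<phi> \<rho> \<xi> (dist_mult \<psi> u) k j
      = complex_of_real \<kappa> * integral ?Q (\<lambda>\<zeta>. G \<zeta> * cnj (trig_exp \<beta> j \<zeta>))" for j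
  proof -
    let ?x = "node \<alpha> b \<rho> \<xi> k j"
    let ?g = "\<lambda>\<zeta>. fourier \<phi> \<zeta> * cnj (trig_exp \<beta> j \<zeta>)"
    have gc: "continuous_on A ?g" for A by (intro continuous_intros fc)
    \<comment> \<open>Dilation by \<open>h\<close> undoes the spacing of the nodes, so the phases
      are the characters \<open>trig_exp \<beta> j\<close> whatever \<open>k\<close> is.\<close>
    have "h * (b * \<rho> * norm (\<xi> k) powr (\<alpha> - 1)) = \<beta> * (norm (\<xi> k) powr (1 - \<alpha>) * norm (\<xi> k) powr (\<alpha> - 1))"
      by (simp add: h_def \<beta>_def)
    also have "norm (\<xi> k) powr (1 - \<alpha>) * norm (\<xi> k) powr (\<alpha> - 1) = 1"
      using \<xi> by (auto simp flip: powr_add)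
    finally have hx: "h *\<^sub>R ?x = \<beta> *\<^sub>R j" by (simp add: node_def)
    have real: "cnj (\<phi> y) = \<phi> y" for y using \<phi>(2)[of y] by (simp add: Reals_cnj_iff)
    have "\<psi> t * cnj (packet \<alpha> \<phi> ?x (\<xi> k) t)
        = complex_of_real \<kappa> * integral ?Q (\<lambda>\<zeta>. ?g \<zeta> * (\<psi> t * osc (p \<zeta>) t))" for t
    proof -
      \<comment> \<open>Inversion is evaluated at the reflected point: as \<phi> is even, the value
        is the same, and the exponent gets the sign of \<open>osc\<close>. As \<phi> is real,
        conjugating the packet only conjugates its exponential.\<close>
      let ?y = "- (h *\<^sub>R (t - ?x))"
      have e: "exp (\<i> * complex_of_real (?y \<bullet> \<zeta>)) = cnj (trig_exp \<beta> j \<zeta>) * osc (h *\<^sub>R \<zeta>) t" for \<zeta>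
      proof -
        have "?y \<bullet> \<zeta> = \<beta> * (j \<bullet> \<zeta>) - h * (t \<bullet> \<zeta>)"
          by (simp add: algebra_simps inner_diff_left hx)
        then show ?thesis
          by (simp add: trig_exp_def osc_def exp_cnj algebra_simps flip: exp_add)
      qed
      have "complex_of_real ((2 * pi) ^ DIM('a)) * \<phi> (h *\<^sub>R (t - ?x)) = (\<integral>\<zeta>. fourier \<phi> \<zeta> * exp (\<i> * complex_of_real (?y \<bullet> \<zeta>)) \<partial>lborel)"
        unfolding inv \<phi>(3) ..
      also have "\<dots> = integral ?Q (\<lambda>\<zeta>. fourier \<phi> \<zeta> * exp (\<i> * complex_of_real (?y \<bullet> \<zeta>)))"
        unfolding cube_def
        by (rule integral_lborel_supp_cbox) (use f0 in \<open>auto intro!: continuous_intros fc simp: cube_def\<close>)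
      also have "\<dots> = integral ?Q (\<lambda>\<zeta>. ?g \<zeta> * osc (h *\<^sub>R \<zeta>) t)" unfolding e by (simp add: mult.assoc)
      finally have \<phi>i: "\<phi> (h *\<^sub>R (t - ?x)) = integral ?Q (\<lambda>\<zeta>. ?g \<zeta> * osc (h *\<^sub>R \<zeta>) t) / complex_of_real ((2 * pi) ^ DIM('a))"
        by (simp add: field_simps)
      have "cnj (packet \<alpha> \<phi> ?x (\<xi> k) t)
          = complex_of_real (norm (\<xi> k) powr (real DIM('a) / 2 * (1 - \<alpha>))) * \<phi> (h *\<^sub>R (t - ?x)) * osc (\<xi> k) t"
        by (simp add: packet_def real exp_cnj osc_def h_def)
      then have "\<psi> t * cnj (packet \<alpha> \<phi> ?x (\<xi> k) t)
          = complex_of_real \<kappa> * ((\<psi> t * osc (\<xi> k) t) * integral ?Q (\<lambda>\<zeta>. ?g \<zeta> * osc (h *\<^sub>R \<zeta>) t))"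
        unfolding \<phi>i by (simp add: \<kappa>_def)
      also have "(\<psi> t * osc (\<xi> k) t) * integral ?Q (\<lambda>\<zeta>. ?g \<zeta> * osc (h *\<^sub>R \<zeta>) t)
          = integral ?Q (\<lambda>\<zeta>. (\<psi> t * osc (\<xi> k) t) * (?g \<zeta> * osc (h *\<^sub>R \<zeta>) t))"
        by (rule integral_mult_right[symmetric])
      also have "(\<lambda>\<zeta>. (\<psi> t * osc (\<xi> k) t) * (?g \<zeta> * osc (h *\<^sub>R \<zeta>) t)) = (\<lambda>\<zeta>. ?g \<zeta> * (\<psi> t * osc (p \<zeta>) t))"
      proof
        fix \<zeta>
        have "osc (p \<zeta>) t = osc (\<xi> k) t * osc (h *\<^sub>R \<zeta>) t"
          by (simp add: osc_def p_def inner_add_right algebra_simps flip: exp_add)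
        then show "(\<psi> t * osc (\<xi> k) t) * (?g \<zeta> * osc (h *\<^sub>R \<zeta>) t) = ?g \<zeta> * (\<psi> t * osc (p \<zeta>) t)" by simp
      qed
      finally show ?thesis .
    qed
    then have "packet_coeff \<alpha> b \<phi> \<rho> \<xi> (dist_mult \<psi> u) k j
        = u (\<lambda>t. complex_of_real \<kappa> * integral ?Q (\<lambda>\<zeta>. ?g \<zeta> * (\<psi> t * osc (p \<zeta>) t)))"
      by (simp add: packet_coeff_def pairing_def dist_mult_def)
    also have "\<dots> = complex_of_real \<kappa> * u (\<lambda>t. integral ?Q (\<lambda>\<zeta>. ?g \<zeta> * (\<psi> t * osc (p \<zeta>) t)))"
      using u schwartz_superposition[OF \<psi> gc pc] unfolding tempered_distribution_def cube_def by blast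
    also have "u (\<lambda>t. integral ?Q (\<lambda>\<zeta>. ?g \<zeta> * (\<psi> t * osc (p \<zeta>) t))) = integral ?Q (\<lambda>\<zeta>. ?g \<zeta> * ?V (p \<zeta>))"
      unfolding cube_def by (rule tempered_distribution_superposition[OF u \<psi> gc pl])
    finally show ?thesis by (simp add: G_def mult_ac)
  qed
  have "((\<lambda>j. \<kappa>\<^sup>2 * (norm (integral ?Q (\<lambda>\<zeta>. G \<zeta> * cnj (trig_exp \<beta> j \<zeta>))))\<^sup>2) has_sum
      \<kappa>\<^sup>2 * ((2 * pi / \<beta>) ^ DIM('a) * integral ?Q (\<lambda>\<zeta>. (norm (G \<zeta>))\<^sup>2))) int_lattice"
    by (intro has_sum_cmult_right parseval \<beta> Gc) (use f0 in \<open>auto simp: G_def\<close>)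
  moreover have "\<kappa>\<^sup>2 * (2 * pi / \<beta>) ^ DIM('a) = (h / (2 * pi * \<beta>)) ^ DIM('a)"
  proof -
    have "(norm (\<xi> k) powr (real DIM('a) / 2 * (1 - \<alpha>)))\<^sup>2 = norm (\<xi> k) powr ((1 - \<alpha>) * real DIM('a))"
      by (simp add: power2_eq_square flip: powr_add)
    also have "\<dots> = h ^ DIM('a)"
      using h by (simp add: h_def powr_realpow flip: powr_powr)
    finally show ?thesis
      by (simp add: \<kappa>_def power_divide power_mult_distrib power2_eq_square)
  qed
  ultimately have hs: "((\<lambda>j. (norm (packet_coeff \<alpha> b \<phi> \<rho> \<xi> (dist_mult \<psi> u) k j))\<^sup>2) has_sum
      (h / (2 * pi * \<beta>)) ^ DIM('a) * integral ?Q (\<lambda>\<zeta>. (norm (G \<zeta>))\<^sup>2)) int_lattice"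
    by (simp add: coeff norm_mult power_mult_distrib flip: mult.assoc)
  then show "(\<lambda>j. (norm (packet_coeff \<alpha> b \<phi> \<rho> \<xi> (dist_mult \<psi> u) k j))\<^sup>2) summable_on int_lattice"
    by (rule has_sum_imp_summable)
  have "infsum (\<lambda>j. (norm (packet_coeff \<alpha> b \<phi> \<rho> \<xi> (dist_mult \<psi> u) k j))\<^sup>2) int_lattice \<ge> 0"
    by (rule infsum_nonneg) simp
  then show "(block_energy \<alpha> b \<phi> \<rho> \<xi> (dist_mult \<psi> u) k)\<^sup>2 =
      (h / (2 * pi * \<beta>)) ^ DIM('a) * integral ?Q (\<lambda>\<zeta>. (norm (fourier \<phi> \<zeta> * ?V (\<xi> k + h *\<^sub>R \<zeta>)))\<^sup>2)"
    unfolding block_energy_def using infsumI[OF hs] by (simp add: G_def p_def)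
qed

section \<open>Cones, sublinear radii and comparable brackets\<close>

lemma open_cone_shrink:
  fixes \<Gamma> :: "'a::euclidean_space set"
  assumes \<Gamma>: "open_cone \<Gamma>" "\<xi>\<^sub>0 \<in> \<Gamma>"
  obtains \<Gamma>' \<epsilon> where "open_cone \<Gamma>'" "\<xi>\<^sub>0 \<in> \<Gamma>'" "0 < \<epsilon>" "\<epsilon> \<le> 1 / 2"
    "\<And>\<xi> \<eta>. \<xi> \<in> \<Gamma>' \<Longrightarrow> norm (\<eta> - \<xi>) \<le> \<epsilon> * norm \<xi> \<Longrightarrow> \<eta> \<in> \<Gamma>"
proof -
  have \<xi>0: "\<xi>\<^sub>0 \<noteq> 0" using \<Gamma> by (auto simp: open_cone_def)
  have scale: "c *\<^sub>R \<xi> \<in> \<Gamma>" if "\<xi> \<in> \<Gamma>" "c > 0" for \<xi> c using \<Gamma> that by (auto simp: open_cone_def)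
  define \<omega> where "\<omega> = (1 / norm \<xi>\<^sub>0) *\<^sub>R \<xi>\<^sub>0"
  have "\<omega> \<in> \<Gamma>" unfolding \<omega>_def using \<xi>0 by (intro scale \<Gamma>) auto
  then obtain d where d: "d > 0" "ball \<omega> d \<subseteq> \<Gamma>"
    using \<Gamma>(1) unfolding open_cone_def by (meson open_contains_ball)
  \<comment> \<open>Half of the opening \<open>d\<close> is spent on the aperture of the smaller
    cone, half on the displacement from \<xi> to \<eta>. The cap 1/2 keeps the norms of displaced
    points comparable.\<close>
  define \<epsilon> where "\<epsilon> = min (d / 2) (1 / 2)"
  \<comment> \<open>A circular cone around the direction of \<open>\<xi>\<^sub>0\<close>; the strict
    inequality excludes the origin.\<close>
  define \<Gamma>' where "\<Gamma>' = {\<xi>. norm (\<xi> - norm \<xi> *\<^sub>R \<omega>) < \<epsilon> * norm \<xi>}"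
  have \<epsilon>: "\<epsilon> > 0" "\<epsilon> \<le> 1 / 2" "2 * \<epsilon> \<le> d" using d by (auto simp: \<epsilon>_def)
  show ?thesis
  proof (rule that)
    have "open \<Gamma>'" unfolding \<Gamma>'_def by (intro open_Collect_less continuous_intros)
    moreover have "c *\<^sub>R \<xi> \<in> \<Gamma>'" if "\<xi> \<in> \<Gamma>'" "c > 0" for c \<xi>
    proof -
      have "c *\<^sub>R \<xi> - norm (c *\<^sub>R \<xi>) *\<^sub>R \<omega> = c *\<^sub>R (\<xi> - norm \<xi> *\<^sub>R \<omega>)"
        using that by (simp add: algebra_simps)
      then have "norm (c *\<^sub>R \<xi> - norm (c *\<^sub>R \<xi>) *\<^sub>R \<omega>) = c * norm (\<xi> - norm \<xi> *\<^sub>R \<omega>)" using that by simp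
      then show ?thesis using that by (simp add: \<Gamma>'_def mult.left_commute)
    qed
    ultimately show "open_cone \<Gamma>'" unfolding open_cone_def by (auto simp: \<Gamma>'_def)
    show "\<xi>\<^sub>0 \<in> \<Gamma>'" using \<xi>0 \<epsilon> by (simp add: \<Gamma>'_def \<omega>_def)
    fix \<xi> \<eta> assume \<xi>: "\<xi> \<in> \<Gamma>'" and \<eta>: "norm (\<eta> - \<xi>) \<le> \<epsilon> * norm \<xi>"
    have n: "norm \<xi> > 0" using \<xi> \<epsilon> by (auto simp: \<Gamma>'_def)
    have "norm (\<eta> - norm \<xi> *\<^sub>R \<omega>) \<le> norm (\<eta> - \<xi>) + norm (\<xi> - norm \<xi> *\<^sub>R \<omega>)"
      using norm_triangle_ineq[of "\<eta> - \<xi>" "\<xi> - norm \<xi> *\<^sub>R \<omega>"] by simp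
    also have "\<dots> < 2 * \<epsilon> * norm \<xi>" using \<xi> \<eta> by (simp add: \<Gamma>'_def)
    also have "\<dots> \<le> d * norm \<xi>" using \<epsilon> n by (intro mult_right_mono) auto
    finally have "norm (\<eta> - norm \<xi> *\<^sub>R \<omega>) < d * norm \<xi>" .
    moreover have "norm \<xi> *\<^sub>R ((1 / norm \<xi>) *\<^sub>R \<eta> - \<omega>) = \<eta> - norm \<xi> *\<^sub>R \<omega>" using n by (simp add: algebra_simps)
    then have "norm \<xi> * norm ((1 / norm \<xi>) *\<^sub>R \<eta> - \<omega>) = norm (\<eta> - norm \<xi> *\<^sub>R \<omega>)"
      by (metis norm_scaleR abs_norm_cancel)
    ultimately have "norm ((1 / norm \<xi>) *\<^sub>R \<eta> - \<omega>) < d" using n by (metis mult.commute mult_less_cancel_left_pos)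
    then have "(1 / norm \<xi>) *\<^sub>R \<eta> \<in> \<Gamma>" using d by (auto simp: dist_norm norm_minus_commute)
    from scale[OF this n] n show "\<eta> \<in> \<Gamma>" by simp
  qed (use \<epsilon> in auto)
qed

text \<open>Positivity of \<alpha> makes \<open>x powr (1 - \<alpha>)\<close> of lower order than
  \<open>x\<close>, which is what confines the block of a large centre to a thin cone.
  \<open>R\<close> solves \<open>c = \<epsilon> * R powr \<alpha>\<close>, up to the floor
  1.\<close>

lemma powr_sublinear:
  assumes \<alpha>: "\<alpha> > 0" and "c > 0" "\<epsilon> > (0::real)"
  obtains R where "R \<ge> 1" "\<And>x. x \<ge> R \<Longrightarrow> c * x powr (1 - \<alpha>) \<le> \<epsilon> * x"
proof (rule that)
  define R where "R = max 1 ((c / \<epsilon>) powr (1 / \<alpha>))"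
  show "R \<ge> 1" by (simp add: R_def)
  fix x assume x: "x \<ge> R"
  then have x1: "x \<ge> 1" "(c / \<epsilon>) powr (1 / \<alpha>) \<le> x" by (auto simp: R_def)
  have "c / \<epsilon> = ((c / \<epsilon>) powr (1 / \<alpha>)) powr \<alpha>" using assms by (simp add: powr_powr)
  also have "\<dots> \<le> x powr \<alpha>" using x1 \<alpha> by (intro powr_mono2) auto
  finally have "c \<le> \<epsilon> * x powr \<alpha>" using assms by (simp add: field_simps)
  then have "c * x powr (1 - \<alpha>) \<le> \<epsilon> * x powr \<alpha> * x powr (1 - \<alpha>)"
    by (intro mult_right_mono) auto
  also have "\<dots> = \<epsilon> * x" using x1 by (simp add: mult.assoc flip: powr_add)
  finally show "c * x powr (1 - \<alpha>) \<le> \<epsilon> * x" .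
qed

lemma bracket_le_double:
  assumes "norm x \<le> 2 * norm y"
  shows "bracket x \<le> 2 * bracket y"
proof -
  have "(norm x)\<^sup>2 \<le> (2 * norm y)\<^sup>2" using assms by (intro power_mono) auto
  then have "1 + (norm x)\<^sup>2 \<le> 4 * (1 + (norm y)\<^sup>2)" by (simp add: power_mult_distrib)
  then have "bracket x \<le> sqrt (4 * (1 + (norm y)\<^sup>2))" unfolding bracket_def by (rule real_sqrt_le_mono)
  also have "\<dots> = 2 * bracket y" unfolding bracket_def real_sqrt_mult by simp
  finally show ?thesis .
qed

lemma bracket_powr_le_double:
  assumes "norm x \<le> 2 * norm y" "M \<ge> 0"
  shows "bracket y powr (- M) \<le> 2 powr M * bracket x powr (- M)"
proof -
  have "bracket y powr (- M) \<le> (bracket x / 2) powr (- M)"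
    using bracket_le_double[OF assms(1)] bracket_pos[of x] assms(2) by (intro powr_mono2') auto
  also have "\<dots> = 2 powr M * bracket x powr (- M)"
    using bracket_pos[of x] by (simp add: powr_divide powr_minus field_simps)
  finally show ?thesis .
qed

section \<open>Comparison of the wavefront sets\<close>

lemma measure_cube: "T \<ge> 0 \<Longrightarrow> measure lborel (cbox (x - T *\<^sub>R One) (x + T *\<^sub>R One)) = (2 * T) ^ DIM('a)"
  for x :: "'a::euclidean_space"
  by (subst content_cbox) (auto simp: algebra_simps)

text \<open>For a large centre the points \<open>\<xi> k + h *\<^sub>R \<zeta>\<close> with
  \<open>norm \<zeta> < R\<^sub>1\<close> are within \<open>\<epsilon> * norm (\<xi> k)\<close> of
  the centre, hence in \<Gamma> and of comparable norm. The supremum bound for \<open>V\<close>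
  there bounds the integral.\<close>

lemma decay_imp_block_energy_decay:
  fixes \<phi> :: "'a::euclidean_space \<Rightarrow> complex" and \<alpha> :: real
  assumes \<alpha>: "\<alpha> > 0"
    and \<phi>: "schwartz \<phi>" "\<And>t. \<phi> t \<in> \<real>" "\<And>t. \<phi> (- t) = \<phi> t" "test_function (fourier \<phi>)"
    and supp: "supp (fourier \<phi>) \<subseteq> ball 0 R\<^sub>1" and R1: "R\<^sub>1 > 0"
    and b: "b > 0" and \<rho>: "\<rho> > 0" and bR: "b * \<rho> * R\<^sub>1 < pi"
    and \<xi>: "\<And>k. norm (\<xi> k) \<ge> 1"
    and u: "tempered_distribution u" and \<psi>: "test_function \<psi>"
    and \<epsilon>: "0 < \<epsilon>" "\<epsilon> \<le> 1 / 2"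
    and near: "\<And>\<xi> \<eta>. \<xi> \<in> \<Gamma>' \<Longrightarrow> norm (\<eta> - \<xi>) \<le> \<epsilon> * norm \<xi> \<Longrightarrow> \<eta> \<in> \<Gamma>"
    and decay: "\<And>M. M > 0 \<Longrightarrow> \<exists>C. \<forall>\<eta>\<in>\<Gamma>. norm (fourier_dist (dist_mult \<psi> u) \<eta>) \<le> C * bracket \<eta> powr (- M)"
  shows "\<exists>R>0. \<forall>N>0. \<exists>C>0. \<forall>k. \<xi> k \<in> \<Gamma>' \<longrightarrow> norm (\<xi> k) \<ge> R \<longrightarrow>
    block_energy \<alpha> b \<phi> \<rho> \<xi> (dist_mult \<psi> u) k \<le> C * bracket (\<xi> k) powr (- N)"
proof -
  let ?V = "fourier_dist (dist_mult \<psi> u)"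
  define \<beta> where "\<beta> = b * \<rho>"
  let ?Q = "cube (pi / \<beta>) :: 'a set"
  define d where "d = DIM('a)"
  have \<beta>: "\<beta> > 0" using b \<rho> by (simp add: \<beta>_def)
  have fc: "continuous_on A (fourier \<phi>)" for A
    using smooth_fun_continuous_on[of "fourier \<phi>" "[]"] \<phi>(4) by (simp add: test_function_def)
  obtain B where B: "B > 0" "\<And>\<zeta>. \<zeta> \<in> ?Q \<Longrightarrow> norm (fourier \<phi> \<zeta>) \<le> B"
    using compact_imp_bounded[OF compact_continuous_image[OF fc compact_cbox]] unfolding bounded_pos cube_def by blast
  obtain R where R: "R \<ge> 1" "\<And>x. x \<ge> R \<Longrightarrow> R\<^sub>1 * x powr (1 - \<alpha>) \<le> \<epsilon> * x"
    using powr_sublinear[OF \<alpha> R1 \<epsilon>(1)] by blast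
  have "\<exists>C>0. \<forall>k. \<xi> k \<in> \<Gamma>' \<longrightarrow> norm (\<xi> k) \<ge> R \<longrightarrow>
    block_energy \<alpha> b \<phi> \<rho> \<xi> (dist_mult \<psi> u) k \<le> C * bracket (\<xi> k) powr (- N)" if N: "N > 0" for N
  proof -
    \<comment> \<open>The prefactor \<open>h ^ d\<close> of the squared energy costs at most
      \<open>y ^ d\<close>, which the additional decay \<open>real d\<close> covers.\<close>
    define M where "M = N + real d"
    have M: "M > 0" using N by (simp add: M_def)
    obtain C0 where C0: "\<And>\<eta>. \<eta> \<in> \<Gamma> \<Longrightarrow> norm (?V \<eta>) \<le> C0 * bracket \<eta> powr (- M)" using decay[OF M] by blast
    define C where "C = \<bar>C0\<bar>"
    define K where "K = (1 / (2 * pi * \<beta>)) ^ d * measure lborel ?Q * (B * (C * 2 powr M))\<^sup>2"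
    have K: "K \<ge> 0" unfolding K_def using \<beta> by (intro mult_nonneg_nonneg) auto
    \<comment> \<open>The summand 1 makes the constant positive, as \<open>gabor_regular\<close>
      demands.\<close>
    have "block_energy \<alpha> b \<phi> \<rho> \<xi> (dist_mult \<psi> u) k \<le> (sqrt K + 1) * bracket (\<xi> k) powr (- N)"
      if k: "\<xi> k \<in> \<Gamma>'" "norm (\<xi> k) \<ge> R" for k
    proof -
      define h where "h = norm (\<xi> k) powr (1 - \<alpha>)"
      define y where "y = bracket (\<xi> k)"
      have y: "y > 0" "y \<ge> 1" using bracket_pos[of "\<xi> k"] bracket_ge_1[of "\<xi> k"] by (auto simp: y_def)
      have "\<xi> k \<noteq> 0" using \<xi>[of k] by auto
      then have h: "h > 0" by (simp add: h_def)
      have hR: "h * R\<^sub>1 \<le> \<epsilon> * norm (\<xi> k)" using R(2)[OF k(2)] by (simp add: h_def mult.commute)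
      have hy: "h \<le> y"
        using norm_powr_le[OF \<alpha> \<xi>[of k]] norm_le_bracket[of "\<xi> k"] unfolding h_def y_def by linarith
      let ?G = "\<lambda>\<zeta>. fourier \<phi> \<zeta> * ?V (\<xi> k + h *\<^sub>R \<zeta>)"
      have Gb: "norm (?G \<zeta>) \<le> B * (C * 2 powr M) * y powr (- M)" if \<zeta>: "\<zeta> \<in> ?Q" for \<zeta>
      proof (cases "norm \<zeta> < R\<^sub>1")
        case True
        let ?\<eta> = "\<xi> k + h *\<^sub>R \<zeta>"
        have "h * norm \<zeta> \<le> h * R\<^sub>1" using True h by (intro mult_left_mono) auto
        also note hR
        finally have le: "norm (?\<eta> - \<xi> k) \<le> \<epsilon> * norm (\<xi> k)" using h by simp
        then have "?\<eta> \<in> \<Gamma>" by (rule near[OF k(1)])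
        then have "norm (?V ?\<eta>) \<le> C0 * bracket ?\<eta> powr (- M)" by (rule C0)
        also have "\<dots> \<le> C * bracket ?\<eta> powr (- M)" unfolding C_def by (intro mult_right_mono) auto
        also have "\<dots> \<le> C * (2 powr M * y powr (- M))"
        proof -
          have "\<epsilon> * norm (\<xi> k) \<le> 1 / 2 * norm (\<xi> k)" using \<epsilon> by (intro mult_right_mono) auto
          then have "norm (\<xi> k) \<le> 2 * norm ?\<eta>"
            using le norm_triangle_ineq2[of "\<xi> k" ?\<eta>] by (simp add: norm_minus_commute)
          then show ?thesis
            unfolding y_def using M by (intro mult_left_mono bracket_powr_le_double) (auto simp: C_def)
        qed
        finally have "norm (?V ?\<eta>) \<le> C * (2 powr M * y powr (- M))" .
        then have "norm (?G \<zeta>) \<le> B * (C * (2 powr M * y powr (- M)))"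
          unfolding norm_mult using B(2)[OF \<zeta>] B(1) by (intro mult_mono) auto
        then show ?thesis by (simp add: mult_ac)
      next
        case False
        then have "\<zeta> \<notin> supp (fourier \<phi>)" using supp by auto
        then have "fourier \<phi> \<zeta> = 0" using outside_supp[of \<zeta> "fourier \<phi>"] by blast
        then show ?thesis using B(1) by (simp add: C_def)
      qed
      have Gc: "continuous_on ?Q (\<lambda>\<zeta>. (norm (?G \<zeta>))\<^sup>2)"
        by (intro continuous_intros fc continuous_on_compose2[OF continuous_on_fourier_dist[OF u \<psi>, of UNIV]]) auto
      have "(block_energy \<alpha> b \<phi> \<rho> \<xi> (dist_mult \<psi> u) k)\<^sup>2
          = (h / (2 * pi * \<beta>)) ^ d * integral ?Q (\<lambda>\<zeta>. (norm (?G \<zeta>))\<^sup>2)"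
        unfolding h_def \<beta>_def d_def by (rule block_energy_square[OF \<phi> supp b \<rho> bR \<xi> u \<psi>])
      also have "integral ?Q (\<lambda>\<zeta>. (norm (?G \<zeta>))\<^sup>2) \<le> integral ?Q (\<lambda>\<zeta>. (B * (C * 2 powr M) * y powr (- M))\<^sup>2)"
        by (intro integral_le power_mono Gb) (use Gc in \<open>auto simp: cube_def intro!: integrable_continuous\<close>)
      also have "\<dots> = (B * (C * 2 powr M) * y powr (- M))\<^sup>2 * measure lborel ?Q"
        by (simp add: cube_def)
      also have "(h / (2 * pi * \<beta>)) ^ d * ((B * (C * 2 powr M) * y powr (- M))\<^sup>2 * measure lborel ?Q)
          = K * (h ^ d * (y powr (- M))\<^sup>2)"
        by (simp add: K_def power_mult_distrib power_divide)
      also have "\<dots> \<le> K * (y powr (- N))\<^sup>2"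
      proof (rule mult_left_mono[OF _ K])
        have "h ^ d * (y powr (- M))\<^sup>2 \<le> y ^ d * (y powr (- M))\<^sup>2"
          using hy h by (intro mult_right_mono power_mono) auto
        also have "\<dots> = y powr (real d - 2 * M)"
          using y by (simp add: power2_eq_square flip: powr_realpow powr_add)
        also have "\<dots> \<le> y powr (- 2 * N)"
          using y by (intro powr_mono) (auto simp: M_def)
        also have "\<dots> = (y powr (- N))\<^sup>2" by (simp add: power2_eq_square flip: powr_add)
        finally show "h ^ d * (y powr (- M))\<^sup>2 \<le> (y powr (- N))\<^sup>2" .
      qed
      also have "\<dots> = (sqrt K * y powr (- N))\<^sup>2" using K by (simp add: power_mult_distrib)
      finally have "(block_energy \<alpha> b \<phi> \<rho> \<xi> (dist_mult \<psi> u) k)\<^sup>2 \<le> (sqrt K * y powr (- N))\<^sup>2"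
        using \<beta> h by (simp add: mult_left_mono)
      then have "block_energy \<alpha> b \<phi> \<rho> \<xi> (dist_mult \<psi> u) k \<le> sqrt K * y powr (- N)"
        by (rule power2_le_imp_le) (use K in simp)
      also have "\<dots> \<le> (sqrt K + 1) * y powr (- N)" by (intro mult_right_mono) auto
      finally show ?thesis unfolding y_def .
    qed
    then show ?thesis using K by (intro exI[of _ "sqrt K + 1"]) (auto intro: add_nonneg_pos)
  qed
  then show ?thesis using R(1) by (intro exI[of _ R]) auto
qed

text \<open>An L2 bound becomes pointwise because \<open>V\<close> cannot drop quickly: around the
  point of the block that represents \<eta>, a cube of side proportional to
  \<open>norm (?V \<eta>)\<close> keeps at least half of that value. The cone shrinks here so that a
  centre whose block covers \<eta> lies in \<Gamma>.\<close>

lemma block_energy_decay_imp_decay: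
  fixes \<phi> :: "'a::euclidean_space \<Rightarrow> complex" and \<alpha> :: real
  assumes \<alpha>: "\<alpha> > 0"
    and \<phi>: "schwartz \<phi>" "\<And>t. \<phi> t \<in> \<real>" "\<And>t. \<phi> (- t) = \<phi> t" "test_function (fourier \<phi>)"
    and supp: "supp (fourier \<phi>) \<subseteq> ball 0 R\<^sub>1" and R01: "R\<^sub>0 > 0" "R\<^sub>0 < R\<^sub>1"
    and m0: "m\<^sub>0 > 0" "\<And>\<zeta>. norm \<zeta> \<le> R\<^sub>0 \<Longrightarrow> norm (fourier \<phi> \<zeta>) \<ge> m\<^sub>0"
    and b: "b > 0" and \<rho>: "\<rho> > 0" and bR: "b * \<rho> * R\<^sub>1 < pi" and AR: "A * \<rho> < R\<^sub>0"
    and \<xi>: "\<And>k. norm (\<xi> k) \<ge> 1"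
    and cover: "\<And>\<eta>. norm \<eta> \<ge> 1 \<Longrightarrow> \<exists>k. norm (\<eta> - \<xi> k) \<le> A * \<rho> * norm (\<xi> k) powr (1 - \<alpha>)"
    and u: "tempered_distribution u" and \<psi>: "test_function \<psi>"
    and \<epsilon>: "0 < \<epsilon>" "\<epsilon> \<le> 1 / 2"
    and near: "\<And>\<xi> \<eta>. \<xi> \<in> \<Gamma>' \<Longrightarrow> norm (\<eta> - \<xi>) \<le> \<epsilon> * norm \<xi> \<Longrightarrow> \<eta> \<in> \<Gamma>"
    and decay: "\<And>N. N > 0 \<Longrightarrow> \<exists>C>0. \<forall>k. \<xi> k \<in> \<Gamma> \<longrightarrow> norm (\<xi> k) \<ge> R \<longrightarrow>
      block_energy \<alpha> b \<phi> \<rho> \<xi> (dist_mult \<psi> u) k \<le> C * bracket (\<xi> k) powr (- N)"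
    and M: "M > 0"
  shows "\<exists>C. \<forall>\<eta>\<in>\<Gamma>'. norm (fourier_dist (dist_mult \<psi> u) \<eta>) \<le> C * bracket \<eta> powr (- M)"
proof -
  let ?V = "fourier_dist (dist_mult \<psi> u)"
  define \<beta> where "\<beta> = b * \<rho>"
  let ?Q = "cube (pi / \<beta>) :: 'a set"
  define d where "d = DIM('a)"
  have d: "d > 0" by (simp add: d_def)
  have \<beta>: "\<beta> > 0" using b \<rho> by (simp add: \<beta>_def)
  have RT: "R\<^sub>1 < pi / \<beta>" using bR \<beta> by (simp add: \<beta>_def field_simps)
  have fc: "continuous_on S (fourier \<phi>)" for S
    using smooth_fun_continuous_on[of "fourier \<phi>" "[]"] \<phi>(4) by (simp add: test_function_def)
  obtain C1 L where C1: "C1 \<ge> 0"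
    and V: "\<And>\<eta>. norm (?V \<eta>) \<le> C1 * (1 + norm \<eta> + norm \<eta>) ^ L"
    and VL: "\<And>\<eta> \<eta>'. norm (?V \<eta> - ?V \<eta>') \<le> C1 * (1 + norm \<eta> + norm \<eta>') ^ L * norm (\<eta> - \<eta>')"
    using fourier_dist_poly_lipschitz[OF u \<psi>] by metis
  \<comment> \<open>\<open>5 ^ L\<close> stems from \<open>1 + s + t \<le> 5 * x\<close> for
    \<open>s\<close> and \<open>t\<close> up to \<open>2 * x\<close> and \<open>x \<ge> 1\<close>;
    the summand 1 makes \<open>C2\<close> positive.\<close>
  define C2 where "C2 = (C1 + 1) * 5 ^ L"
  have C2: "C2 > 0" using C1 by (simp add: C2_def)
  \<comment> \<open>The room between the covering radius and the ball on which
    \<open>fourier \<phi>\<close> is bounded below, capped at 1.\<close>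
  define \<delta> where "\<delta> = min (R\<^sub>0 - A * \<rho>) 1"
  have \<delta>: "\<delta> > 0" "\<delta> \<le> 1" "\<delta> \<le> R\<^sub>0 - A * \<rho>" using AR by (auto simp: \<delta>_def)
  \<comment> \<open>In \<open>2 * N\<close> the first summand pays for the volume of the cube and
    the prefactor \<open>h ^ d\<close>; the second leaves the rate \<open>M\<close> after a root of
    order \<open>d + 2\<close>.\<close>
  define N where "N = ((real L + 1 + \<alpha>) * real d + (real d + 2) * M) / 2"
  have N: "N > 0" unfolding N_def using \<alpha> M by (auto intro!: add_nonneg_pos mult_pos_pos)
  obtain CN where CN: "CN > 0" "\<And>k. \<xi> k \<in> \<Gamma> \<Longrightarrow> norm (\<xi> k) \<ge> R \<Longrightarrow>
      block_energy \<alpha> b \<phi> \<rho> \<xi> (dist_mult \<psi> u) k \<le> CN * bracket (\<xi> k) powr (- N)"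
    using decay[OF N] by blast
  \<comment> \<open>The radius is compared with \<open>\<epsilon> / 2\<close> because the
    displacement is to be measured against \<open>norm \<eta>\<close>, which may be half of
    \<open>norm (\<xi> k)\<close>.\<close>
  obtain R2 where R2: "R2 \<ge> 1" "\<And>x. x \<ge> R2 \<Longrightarrow> R\<^sub>0 * x powr (1 - \<alpha>) \<le> \<epsilon> / 2 * x"
    using powr_sublinear[OF \<alpha> R01(1), of "\<epsilon> / 2"] \<epsilon> by auto
  \<comment> \<open>As \<open>norm \<eta> \<le> (1 + R\<^sub>0) * norm (\<xi> k)\<close> for a
    centre covering \<eta>, this threshold forces \<open>norm (\<xi> k)\<close> above both
    \<open>R\<close> and \<open>R2\<close>.\<close>
  define R3 where "R3 = (1 + R\<^sub>0) * max R R2"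
  have R3: "R3 \<ge> 1" unfolding R3_def using R01 R2(1) mult_mono[of 1 "1 + R\<^sub>0" 1 "max R R2"] by simp
  \<comment> \<open>The constants in \<open>(h / (2 * pi * \<beta>)) ^ d * (m\<^sub>0 * (m /
    2))\<^sup>2 * (2 * s) ^ d\<close>, once the powers of \<open>m\<close>, \<open>h\<close> and
    \<open>x\<close> are split off.\<close>
  define \<kappa> where "\<kappa> = (1 / (2 * pi * \<beta>)) ^ d * m\<^sub>0\<^sup>2 / 4 * (\<delta> / (real d * C2)) ^ d"
  have \<kappa>: "\<kappa> > 0" unfolding \<kappa>_def using \<beta> m0(1) \<delta>(1) d C2 by (intro mult_pos_pos divide_pos_pos zero_less_power) auto
  define K where "K = CN\<^sup>2 / \<kappa>"
  have K: "K \<ge> 0" using \<kappa> by (simp add: K_def)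
  have large: "norm (?V \<eta>) \<le> (K + 1) * 2 powr M * bracket \<eta> powr (- M)"
    if \<eta>: "\<eta> \<in> \<Gamma>'" "norm \<eta> \<ge> R3" for \<eta>
  proof -
    obtain k where k: "norm (\<eta> - \<xi> k) \<le> A * \<rho> * norm (\<xi> k) powr (1 - \<alpha>)"
      using cover[of \<eta>] \<eta>(2) R3 by auto
    define x where "x = norm (\<xi> k)"
    define h where "h = norm (\<xi> k) powr (1 - \<alpha>)"
    define m where "m = norm (?V \<eta>)"
    define y where "y = bracket (\<xi> k)"
    have y: "y > 0" "y \<ge> 1" "x \<le> y"
      using bracket_pos[of "\<xi> k"] bracket_ge_1[of "\<xi> k"] norm_le_bracket[of "\<xi> k"] by (auto simp: y_def x_def)
    have x: "x \<ge> 1" using \<xi> by (simp add: x_def)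
    have "\<xi> k \<noteq> 0" using \<xi>[of k] by auto
    then have h: "h > 0" by (simp add: h_def)
    have hx: "h \<le> x" using norm_powr_le[OF \<alpha> \<xi>[of k]] by (simp add: h_def x_def)
    have "A * \<rho> * h \<le> R\<^sub>0 * h" using AR h by (intro mult_right_mono) auto
    with k have k0: "norm (\<eta> - \<xi> k) \<le> R\<^sub>0 * h" by (simp add: h_def)
    have "norm \<eta> \<le> x + norm (\<eta> - \<xi> k)" unfolding x_def using norm_triangle_ineq[of "\<xi> k" "\<eta> - \<xi> k"] by simp
    also have "\<dots> \<le> x + R\<^sub>0 * x"
      using order_trans[OF k0 mult_left_mono[OF hx, of R\<^sub>0]] R01 by simp
    finally have "(1 + R\<^sub>0) * max R R2 \<le> (1 + R\<^sub>0) * x" using \<eta>(2) by (simp add: R3_def algebra_simps)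
    then have xR: "x \<ge> R" "x \<ge> R2" using R01 by auto
    have Rh: "R\<^sub>0 * h \<le> \<epsilon> / 2 * x" using R2(2)[OF xR(2)] by (simp add: h_def x_def)
    have "\<epsilon> / 2 * x \<le> 1 / 4 * x" using \<epsilon> x by (intro mult_right_mono) auto
    then have Rh4: "R\<^sub>0 * h \<le> x / 4" using Rh by simp
    have nx: "norm \<eta> \<le> 2 * x" "x \<le> 2 * norm \<eta>"
      using k0 Rh4 x norm_triangle_ineq2[of \<eta> "\<xi> k"] norm_triangle_ineq2[of "\<xi> k" \<eta>]
      by (auto simp: x_def norm_minus_commute)
    have "\<xi> k \<in> \<Gamma>"
    proof (rule near[OF \<eta>(1)])
      have "\<epsilon> / 2 * x \<le> \<epsilon> / 2 * (2 * norm \<eta>)" using nx \<epsilon> by (intro mult_left_mono) auto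
      then show "norm (\<xi> k - \<eta>) \<le> \<epsilon> * norm \<eta>" using k0 Rh by (simp add: norm_minus_commute)
    qed
    then have E: "block_energy \<alpha> b \<phi> \<rho> \<xi> (dist_mult \<psi> u) k \<le> CN * y powr (- N)"
      using CN(2)[of k] xR(1) by (simp add: x_def y_def)
    have W: "(1 + s + t) ^ L \<le> 5 ^ L * x ^ L" if "0 \<le> s" "0 \<le> t" "s \<le> 2 * x" "t \<le> 2 * x" for s t :: real
    proof -
      have "(1 + s + t) ^ L \<le> (5 * x) ^ L" using that x by (intro power_mono) auto
      then show ?thesis by (simp add: power_mult_distrib)
    qed
    have C12: "C1 * w \<le> C2 * x ^ L" if "w \<le> 5 ^ L * x ^ L" for w
    proof -
      have "C1 * w \<le> C1 * (5 ^ L * x ^ L)" by (rule mult_left_mono[OF that C1])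
      also have "\<dots> \<le> (C1 + 1) * (5 ^ L * x ^ L)" using x by (intro mult_right_mono) auto
      finally show ?thesis by (simp add: C2_def)
    qed
    have xL: "x ^ L \<le> x ^ Suc L" using x by (intro power_increasing) auto
    have m: "m \<ge> 0" "m \<le> C2 * x ^ Suc L"
    proof -
      have "m \<le> C2 * x ^ L" unfolding m_def
        by (rule order_trans[OF V C12[OF W]]) (use nx in auto)
      also have "\<dots> \<le> C2 * x ^ Suc L" using C2 by (intro mult_left_mono xL) auto
      finally show "m \<le> C2 * x ^ Suc L" .
    qed (simp add: m_def)
    \<comment> \<open>The half side of the cube on which \<open>V\<close> stays above
      \<open>m / 2\<close>: the l1 radius \<open>real d * s\<close>, times \<open>h \<le> x\<close>
      and the Lipschitz constant \<open>C2 * x ^ L\<close>, is at most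
      \<open>\<delta> * m / 2\<close>. For \<open>m = 0\<close> the cube is a point, which the
      argument permits.\<close>
    define s where "s = \<delta> * m / (2 * C2 * x ^ Suc L * real d)"
    have Cx: "C2 * x ^ Suc L > 0" using C2 x by (intro mult_pos_pos zero_less_power) auto
    have s: "s \<ge> 0" "C2 * x ^ Suc L * (real d * s) = \<delta> * m / 2"
      unfolding s_def using \<delta> m(1) Cx C2 x d by (auto simp: field_simps)
    \<comment> \<open>The growth bound for \<open>m\<close> keeps the cube within the margin
      \<delta>.\<close>
    have sd: "real d * s \<le> \<delta> / 2"
    proof -
      have "C2 * x ^ Suc L * (real d * s) \<le> C2 * x ^ Suc L * (\<delta> / 2)"
        unfolding s(2) using mult_left_mono[OF m(2), of \<delta>] \<delta>(1) by simp
      then show ?thesis using Cx by (simp only: mult_le_cancel_left_pos)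
    qed
    define \<zeta>\<^sub>0 where "\<zeta>\<^sub>0 = (1 / h) *\<^sub>R (\<eta> - \<xi> k)"
    have \<zeta>0: "\<xi> k + h *\<^sub>R \<zeta>\<^sub>0 = \<eta>" using h by (simp add: \<zeta>\<^sub>0_def)
    have "h * norm \<zeta>\<^sub>0 = norm (\<eta> - \<xi> k)" using h by (simp add: \<zeta>\<^sub>0_def)
    then have "h * norm \<zeta>\<^sub>0 \<le> h * (A * \<rho>)" using k by (simp add: h_def mult_ac)
    then have n0: "norm \<zeta>\<^sub>0 \<le> A * \<rho>" using h by simp
    let ?S = "cbox (\<zeta>\<^sub>0 - s *\<^sub>R One) (\<zeta>\<^sub>0 + s *\<^sub>R One)"
    let ?G = "\<lambda>\<zeta>. fourier \<phi> \<zeta> * ?V (\<xi> k + h *\<^sub>R \<zeta>)"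
    have S: "norm (\<zeta> - \<zeta>\<^sub>0) \<le> real d * s" if "\<zeta> \<in> ?S" for \<zeta>
    proof -
      have "norm (\<zeta> - \<zeta>\<^sub>0) \<le> (\<Sum>i\<in>Basis. \<bar>(\<zeta> - \<zeta>\<^sub>0) \<bullet> i\<bar>)" by (rule norm_le_l1)
      also have "\<dots> \<le> (\<Sum>i\<in>(Basis::'a set). s)"
        using that by (intro sum_mono) (auto simp: mem_box inner_diff_left inner_add_left abs_le_iff algebra_simps)
      finally show ?thesis by (simp add: d_def)
    qed
    have SR: "norm \<zeta> \<le> R\<^sub>0" if "\<zeta> \<in> ?S" for \<zeta>
      using S[OF that] sd \<delta> n0 norm_triangle_ineq[of \<zeta>\<^sub>0 "\<zeta> - \<zeta>\<^sub>0"] by simp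
    have SQ: "?S \<subseteq> ?Q"
    proof
      fix \<zeta> assume "\<zeta> \<in> ?S"
      then have "\<zeta> \<in> ball 0 R\<^sub>1" using SR[of \<zeta>] R01 by simp
      then show "\<zeta> \<in> ?Q" using ball_subset_cube[of R\<^sub>1 "pi / \<beta>"] RT by auto
    qed
    have Gl: "m\<^sub>0 * (m / 2) \<le> norm (?G \<zeta>)" if \<zeta>: "\<zeta> \<in> ?S" for \<zeta>
    proof -
      have hz: "norm (h *\<^sub>R \<zeta>) \<le> R\<^sub>0 * h" using mult_left_mono[OF SR[OF \<zeta>], of h] h by (simp add: mult.commute)
      have nz: "norm (\<xi> k + h *\<^sub>R \<zeta>) \<le> 2 * x"
        using norm_triangle_ineq[of "\<xi> k" "h *\<^sub>R \<zeta>"] hz Rh4 x by (simp add: x_def)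
      have "norm (?V \<eta> - ?V (\<xi> k + h *\<^sub>R \<zeta>)) \<le> C1 * (1 + norm \<eta> + norm (\<xi> k + h *\<^sub>R \<zeta>)) ^ L * norm (\<eta> - (\<xi> k + h *\<^sub>R \<zeta>))"
        by (rule VL)
      also have "\<dots> \<le> C2 * x ^ L * (x * (real d * s))"
      proof (rule mult_mono)
        show "C1 * (1 + norm \<eta> + norm (\<xi> k + h *\<^sub>R \<zeta>)) ^ L \<le> C2 * x ^ L"
          by (rule C12[OF W]) (use nx nz in auto)
        have "\<eta> - (\<xi> k + h *\<^sub>R \<zeta>) = h *\<^sub>R (\<zeta>\<^sub>0 - \<zeta>)" unfolding \<zeta>0[symmetric] by (simp add: algebra_simps)
        then have "norm (\<eta> - (\<xi> k + h *\<^sub>R \<zeta>)) = h * norm (\<zeta> - \<zeta>\<^sub>0)" using h by (simp add: norm_minus_commute)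
        also have "\<dots> \<le> x * (real d * s)" using hx S[OF \<zeta>] h by (intro mult_mono) auto
        finally show "norm (\<eta> - (\<xi> k + h *\<^sub>R \<zeta>)) \<le> x * (real d * s)" .
      qed (use C2 x in auto)
      also have "\<dots> = C2 * x ^ Suc L * (real d * s)" by simp
      also have "\<dots> \<le> m / 2" unfolding s(2) using \<delta>(2) m(1) mult_right_mono[of \<delta> 1 m] by simp
      finally have "m / 2 \<le> norm (?V (\<xi> k + h *\<^sub>R \<zeta>))"
        unfolding m_def using norm_triangle_ineq2[of "?V \<eta>" "?V (\<xi> k + h *\<^sub>R \<zeta>)"] by simp
      then show ?thesis unfolding norm_mult using m0(2)[OF SR[OF \<zeta>]] m0(1) m(1) by (intro mult_mono) auto
    qed
    have Gc: "continuous_on T (\<lambda>\<zeta>. (norm (?G \<zeta>))\<^sup>2)" for T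
      by (intro continuous_intros fc continuous_on_compose2[OF continuous_on_fourier_dist[OF u \<psi>, of UNIV]]) auto
    have "(m\<^sub>0 * (m / 2))\<^sup>2 * (2 * s) ^ d = integral ?S (\<lambda>\<zeta>. (m\<^sub>0 * (m / 2))\<^sup>2)"
      using measure_cube[OF s(1), of \<zeta>\<^sub>0] by (simp add: d_def)
    also have "\<dots> \<le> integral ?S (\<lambda>\<zeta>. (norm (?G \<zeta>))\<^sup>2)"
      using m0(1) m(1) by (intro integral_le integrable_continuous Gc power_mono Gl) auto
    also have "\<dots> \<le> integral ?Q (\<lambda>\<zeta>. (norm (?G \<zeta>))\<^sup>2)"
      by (intro integral_subset_le SQ) (auto simp: cube_def intro!: integrable_continuous Gc)
    finally have low: "(m\<^sub>0 * (m / 2))\<^sup>2 * (2 * s) ^ d \<le> integral ?Q (\<lambda>\<zeta>. (norm (?G \<zeta>))\<^sup>2)" .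
    have "\<kappa> * (m ^ (d + 2) * (h ^ d / (x ^ Suc L) ^ d))
        = (h / (2 * pi * \<beta>)) ^ d * ((m\<^sub>0 * (m / 2))\<^sup>2 * (2 * s) ^ d)"
      by (simp add: \<kappa>_def s_def power_divide power_mult_distrib power_add field_simps power2_eq_square)
    also have "\<dots> \<le> (h / (2 * pi * \<beta>)) ^ d * integral ?Q (\<lambda>\<zeta>. (norm (?G \<zeta>))\<^sup>2)"
      using h \<beta> by (intro mult_left_mono low) auto
    also have "\<dots> = (block_energy \<alpha> b \<phi> \<rho> \<xi> (dist_mult \<psi> u) k)\<^sup>2"
      unfolding h_def \<beta>_def d_def by (rule block_energy_square[OF \<phi> supp b \<rho> bR \<xi> u \<psi>, symmetric])
    also have "\<dots> \<le> (CN * y powr (- N))\<^sup>2"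
      by (intro power_mono E) (auto simp: block_energy_def intro!: infsum_nonneg)
    also have "\<dots> = \<kappa> * (K * (y powr (- N))\<^sup>2)" using \<kappa> by (simp add: K_def power_mult_distrib)
    finally have main: "m ^ (d + 2) * (h ^ d / (x ^ Suc L) ^ d) \<le> K * (y powr (- N))\<^sup>2"
      using \<kappa> by (simp only: mult_le_cancel_left_pos)
    \<comment> \<open>A polynomial lower bound is all that is wanted: \<open>h\<close> is at least
      \<open>x powr (- \<alpha>)\<close>, and the negative exponent allows \<open>x\<close> to be
      replaced by the larger \<open>y\<close>.\<close>
    have hd: "h ^ d / (x ^ Suc L) ^ d \<ge> y powr (- ((real L + 1 + \<alpha>) * real d))"
    proof -
      have "x powr (- \<alpha>) \<le> h" unfolding h_def x_def[symmetric] using x by (intro powr_mono) auto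
      then have a1: "(x powr (- \<alpha>) / x ^ Suc L) ^ d \<le> (h / x ^ Suc L) ^ d"
        using x by (intro power_mono divide_right_mono) auto
      have a2: "x powr (- \<alpha>) / x ^ Suc L = x powr (- \<alpha> - (real L + 1))"
        using x by (simp add: powr_diff powr_add powr_realpow)
      have a3: "(x powr (- \<alpha> - (real L + 1))) ^ d = x powr ((- \<alpha> - (real L + 1)) * real d)"
        using x by (simp add: powr_powr flip: powr_realpow)
      have a4: "(- \<alpha> - (real L + 1)) * real d = - ((real L + 1 + \<alpha>) * real d)"
        by (simp add: algebra_simps)
      have "y powr (- ((real L + 1 + \<alpha>) * real d)) \<le> x powr (- ((real L + 1 + \<alpha>) * real d))"
        using x y \<alpha> by (intro powr_mono2') auto
      then show ?thesis using a1 unfolding a2 a3 a4 power_divide by (rule order_trans)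
    qed
    have "m ^ (d + 2) * y powr (- ((real L + 1 + \<alpha>) * real d)) \<le> K * (y powr (- N))\<^sup>2"
      using order_trans[OF mult_left_mono[OF hd] main] m(1) by simp
    then have "m ^ (d + 2) * y powr (- ((real L + 1 + \<alpha>) * real d)) * y powr ((real L + 1 + \<alpha>) * real d)
        \<le> K * (y powr (- N))\<^sup>2 * y powr ((real L + 1 + \<alpha>) * real d)"
      by (rule mult_right_mono) simp
    also have "m ^ (d + 2) * y powr (- ((real L + 1 + \<alpha>) * real d)) * y powr ((real L + 1 + \<alpha>) * real d) = m ^ (d + 2)"
      using y by (simp add: mult.assoc flip: powr_add)
    also have "K * (y powr (- N))\<^sup>2 * y powr ((real L + 1 + \<alpha>) * real d) = K * y powr (- (real d + 2) * M)"
    proof -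
      have "(y powr (- N))\<^sup>2 * y powr ((real L + 1 + \<alpha>) * real d) = y powr (- N + - N + (real L + 1 + \<alpha>) * real d)"
        by (simp only: power2_eq_square powr_add)
      also have "- N + - N + (real L + 1 + \<alpha>) * real d = - (real d + 2) * M" by (simp add: N_def field_simps)
      finally show ?thesis by (simp add: mult.assoc)
    qed
    also have "y powr (- (real d + 2) * M) = (y powr (- M)) ^ (d + 2)"
    proof -
      have "(y powr (- M)) ^ (d + 2) = (y powr (- M)) powr real (d + 2)" using y by (intro powr_realpow[symmetric]) simp
      also have "\<dots> = y powr (- (real d + 2) * M)" by (simp add: powr_powr algebra_simps)
      finally show ?thesis by simp
    qed
    \<comment> \<open>With \<open>(K + 1) ^ (d + 2)\<close> both sides are powers of the same order,
      and the root is taken by monotonicity of powers.\<close>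
    also have "K * (y powr (- M)) ^ (d + 2) \<le> (K + 1) ^ (d + 2) * (y powr (- M)) ^ (d + 2)"
    proof (rule mult_right_mono)
      have "K + 1 \<le> (K + 1) ^ (d + 2)" using K by (intro self_le_power) auto
      then show "K \<le> (K + 1) ^ (d + 2)" by simp
    qed simp
    also have "\<dots> = ((K + 1) * y powr (- M)) ^ (d + 2)" by (simp only: power_mult_distrib)
    finally have "m \<le> (K + 1) * y powr (- M)"
      by (rule power_mono_iff[THEN iffD1, rotated 3]) (use m(1) K in auto)
    also have "\<dots> \<le> (K + 1) * (2 powr M * bracket \<eta> powr (- M))"
      unfolding y_def using nx(1) M K by (intro mult_left_mono bracket_powr_le_double) (auto simp: x_def)
    finally show ?thesis by (simp add: m_def mult.assoc)
  qed
  \<comment> \<open>The energies say nothing about small frequencies. There \<open>V\<close> is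
    bounded and \<open>bracket \<eta> powr (- M)\<close> is bounded below, so a constant is
    enough.\<close>
  define C3 where "C3 = C1 * (1 + R3 + R3) ^ L * (sqrt (1 + R3\<^sup>2)) powr M"
  have small: "norm (?V \<eta>) \<le> C3 * bracket \<eta> powr (- M)" if "norm \<eta> \<le> R3" for \<eta>
  proof -
    have "bracket \<eta> \<le> sqrt (1 + R3\<^sup>2)" unfolding bracket_def using that by (intro real_sqrt_le_mono add_left_mono power_mono) auto
    then have "(sqrt (1 + R3\<^sup>2)) powr (- M) \<le> bracket \<eta> powr (- M)"
      using bracket_pos[of \<eta>] M by (intro powr_mono2') auto
    then have "(sqrt (1 + R3\<^sup>2)) powr M * (sqrt (1 + R3\<^sup>2)) powr (- M) \<le> (sqrt (1 + R3\<^sup>2)) powr M * bracket \<eta> powr (- M)"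
      by (rule mult_left_mono) simp
    moreover have "1 + R3\<^sup>2 > 0" by (intro add_pos_nonneg) auto
    then have "sqrt (1 + R3\<^sup>2) \<noteq> 0" by simp
    ultimately have one: "1 \<le> (sqrt (1 + R3\<^sup>2)) powr M * bracket \<eta> powr (- M)"
      by (simp flip: powr_add)
    have "norm (?V \<eta>) \<le> C1 * (1 + norm \<eta> + norm \<eta>) ^ L" by (rule V)
    also have "\<dots> \<le> C1 * (1 + R3 + R3) ^ L" using that C1 by (intro mult_left_mono power_mono) auto
    also have "\<dots> \<le> C1 * (1 + R3 + R3) ^ L * ((sqrt (1 + R3\<^sup>2)) powr M * bracket \<eta> powr (- M))"
      using mult_left_mono[OF one, of "C1 * (1 + R3 + R3) ^ L"] C1 R3 by simp
    finally show ?thesis by (simp add: C3_def mult.assoc)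
  qed
  show ?thesis
  proof (intro exI ballI)
    fix \<eta> assume \<eta>: "\<eta> \<in> \<Gamma>'"
    have "norm (?V \<eta>) \<le> (K + 1) * 2 powr M * bracket \<eta> powr (- M) \<or> norm (?V \<eta>) \<le> C3 * bracket \<eta> powr (- M)"
      using large[OF \<eta>] small[of \<eta>] by linarith
    moreover have "(K + 1) * 2 powr M * bracket \<eta> powr (- M) \<le> max ((K + 1) * 2 powr M) C3 * bracket \<eta> powr (- M)"
      "C3 * bracket \<eta> powr (- M) \<le> max ((K + 1) * 2 powr M) C3 * bracket \<eta> powr (- M)"
      by (intro mult_right_mono; simp)+
    ultimately show "norm (?V \<eta>) \<le> max ((K + 1) * 2 powr M) C3 * bracket \<eta> powr (- M)" by linarith
  qed
qed

theorem theorem6p3: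
  fixes \<alpha> \<rho>\<^sub>0 a b A\<^sub>c\<^sub>o\<^sub>v \<rho> :: real
    and \<phi> :: "'a::euclidean_space \<Rightarrow> complex"
    and \<xi> :: "nat \<Rightarrow> 'a"
    and u :: "('a \<Rightarrow> complex) \<Rightarrow> complex"
  assumes "\<alpha> > 0"
    and "\<rho>\<^sub>0 > 0" and "a > 0" and "b > 0"
    and "covering_constant TYPE('a) \<alpha> \<rho>\<^sub>0 a A\<^sub>c\<^sub>o\<^sub>v"
    and "subdyadic_frame_pair \<alpha> \<rho>\<^sub>0 a b A\<^sub>c\<^sub>o\<^sub>v \<phi> \<rho> \<xi>"
    and "tempered_distribution u"
  shows "WF_Gabor \<alpha> b \<phi> \<rho> \<xi> u = WF u"
proof -
  note \<alpha> = assms(1) and b = assms(4) and u = assms(7)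
  obtain R\<^sub>0 R\<^sub>1 m\<^sub>0 where fp:
    "3 * 2 powr (max (\<alpha> - 1) 0) < R\<^sub>0" and R01: "R\<^sub>0 < R\<^sub>1" and m0: "m\<^sub>0 > 0"
    "\<And>\<zeta>. norm \<zeta> \<le> R\<^sub>0 \<Longrightarrow> norm (fourier \<phi> \<zeta>) \<ge> m\<^sub>0"
    and supp: "supp (fourier \<phi>) \<subseteq> ball 0 R\<^sub>1"
    and AR: "A\<^sub>c\<^sub>o\<^sub>v * \<rho> < R\<^sub>0" and bR: "b * \<rho> * R\<^sub>1 < pi"
    using assms(6) unfolding subdyadic_frame_pair_def by blast
  have \<phi>: "schwartz \<phi>" "\<And>t. \<phi> t \<in> \<real>" "\<And>t. \<phi> (- t) = \<phi> t" "test_function (fourier \<phi>)"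
    and \<rho>: "\<rho> > 0" "\<rho> \<le> \<rho>\<^sub>0" and sc: "subdyadic_centers \<alpha> \<rho> a \<xi>"
    using assms(6) unfolding subdyadic_frame_pair_def by blast+
  have R0: "R\<^sub>0 > 0" using fp by (rule less_trans[rotated]) simp
  have \<xi>: "\<And>k. norm (\<xi> k) \<ge> 1" by (rule subdyadic_centers_norm_ge_1[OF sc])
  have cover: "\<exists>k. norm (\<eta> - \<xi> k) \<le> A\<^sub>c\<^sub>o\<^sub>v * \<rho> * norm (\<xi> k) powr (1 - \<alpha>)" if "norm \<eta> \<ge> 1" for \<eta>
  proof -
    have "{\<eta>. norm \<eta> \<ge> 1} \<subseteq> (\<Union>k. cball (\<xi> k) (A\<^sub>c\<^sub>o\<^sub>v * \<rho> * norm (\<xi> k) powr (1 - \<alpha>)))"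
      using assms(5) \<rho> sc unfolding covering_constant_def by blast
    then have "\<eta> \<in> (\<Union>k. cball (\<xi> k) (A\<^sub>c\<^sub>o\<^sub>v * \<rho> * norm (\<xi> k) powr (1 - \<alpha>)))" using that by blast
    then show ?thesis by (auto simp: dist_norm norm_minus_commute)
  qed
  \<comment> \<open>Both wavefront sets negate an existence statement, so their equality reduces to
    an equivalence of regularity conditions at each point.\<close>
  have "gabor_regular \<alpha> b \<phi> \<rho> \<xi> u x\<^sub>0 \<xi>\<^sub>0 \<longleftrightarrow>
      (\<exists>\<psi> \<Gamma>. cutoff_at x\<^sub>0 \<psi> \<and> open_cone \<Gamma> \<and> \<xi>\<^sub>0 \<in> \<Gamma> \<and>
          (\<forall>M::real. M > 0 \<longrightarrow> (\<exists>C. \<forall>\<eta>\<in>\<Gamma>.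
             norm (fourier_dist (dist_mult \<psi> u) \<eta>) \<le> C * bracket \<eta> powr (- M))))" (is "_ \<longleftrightarrow> ?WF")
    for x\<^sub>0 \<xi>\<^sub>0
  proof
    assume "gabor_regular \<alpha> b \<phi> \<rho> \<xi> u x\<^sub>0 \<xi>\<^sub>0"
    then obtain \<psi> \<Gamma> R where \<psi>: "cutoff_at x\<^sub>0 \<psi>" and \<Gamma>: "open_cone \<Gamma>" "\<xi>\<^sub>0 \<in> \<Gamma>" and R: "R > 0"
      and reg: "\<forall>N::real. N > 0 \<longrightarrow> (\<exists>C>0. \<forall>k. \<xi> k \<in> \<Gamma> \<longrightarrow> norm (\<xi> k) \<ge> R \<longrightarrow>
        (\<lambda>j. (norm (packet_coeff \<alpha> b \<phi> \<rho> \<xi> (dist_mult \<psi> u) k j))\<^sup>2) summable_on int_lattice \<and>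
        block_energy \<alpha> b \<phi> \<rho> \<xi> (dist_mult \<psi> u) k \<le> C * bracket (\<xi> k) powr (- N))"
      unfolding gabor_regular_def by (elim exE conjE) (rule that)
    have decay: "\<exists>C>0. \<forall>k. \<xi> k \<in> \<Gamma> \<longrightarrow> norm (\<xi> k) \<ge> R \<longrightarrow>
        block_energy \<alpha> b \<phi> \<rho> \<xi> (dist_mult \<psi> u) k \<le> C * bracket (\<xi> k) powr (- N)" if "N > 0" for N
    proof -
      obtain C where "C > 0" and C: "\<forall>k. \<xi> k \<in> \<Gamma> \<longrightarrow> norm (\<xi> k) \<ge> R \<longrightarrow>
        (\<lambda>j. (norm (packet_coeff \<alpha> b \<phi> \<rho> \<xi> (dist_mult \<psi> u) k j))\<^sup>2) summable_on int_lattice \<and>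
        block_energy \<alpha> b \<phi> \<rho> \<xi> (dist_mult \<psi> u) k \<le> C * bracket (\<xi> k) powr (- N)"
        using reg[rule_format, OF \<open>N > 0\<close>] by blast
      then show ?thesis by (intro exI[of _ C]) simp
    qed
    have tf: "test_function \<psi>" using \<psi> by (simp add: cutoff_at_def)
    obtain \<Gamma>' \<epsilon> where \<Gamma>': "open_cone \<Gamma>'" "\<xi>\<^sub>0 \<in> \<Gamma>'" and \<epsilon>: "0 < \<epsilon>" "\<epsilon> \<le> 1 / 2"
      and near: "\<And>\<xi> \<eta>. \<xi> \<in> \<Gamma>' \<Longrightarrow> norm (\<eta> - \<xi>) \<le> \<epsilon> * norm \<xi> \<Longrightarrow> \<eta> \<in> \<Gamma>"
      using open_cone_shrink[OF \<Gamma>] by metis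
    have "\<exists>C. \<forall>\<eta>\<in>\<Gamma>'. norm (fourier_dist (dist_mult \<psi> u) \<eta>) \<le> C * bracket \<eta> powr (- M)" if M: "M > 0" for M
      by (rule block_energy_decay_imp_decay[where \<xi> = \<xi> and \<alpha> = \<alpha> and \<phi> = \<phi> and R\<^sub>1 = R\<^sub>1
            and R\<^sub>0 = R\<^sub>0 and m\<^sub>0 = m\<^sub>0 and b = b and \<rho> = \<rho> and A = A\<^sub>c\<^sub>o\<^sub>v and \<epsilon> = \<epsilon> and \<Gamma> = \<Gamma> and R = R]; fact)
    then have "\<forall>M>0. \<exists>C. \<forall>\<eta>\<in>\<Gamma>'. norm (fourier_dist (dist_mult \<psi> u) \<eta>) \<le> C * bracket \<eta> powr (- M)"
      by blast
    then show ?WF by (intro exI[of _ \<psi>] exI[of _ \<Gamma>'] conjI \<psi> \<Gamma>')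
  next
    assume ?WF
    then obtain \<psi> \<Gamma> where \<psi>: "cutoff_at x\<^sub>0 \<psi>" and \<Gamma>: "open_cone \<Gamma>" "\<xi>\<^sub>0 \<in> \<Gamma>"
      and decay: "\<And>M. M > 0 \<Longrightarrow> \<exists>C. \<forall>\<eta>\<in>\<Gamma>. norm (fourier_dist (dist_mult \<psi> u) \<eta>) \<le> C * bracket \<eta> powr (- M)"
      by blast
    have tf: "test_function \<psi>" using \<psi> by (simp add: cutoff_at_def)
    obtain \<Gamma>' \<epsilon> where \<Gamma>': "open_cone \<Gamma>'" "\<xi>\<^sub>0 \<in> \<Gamma>'" and \<epsilon>: "0 < \<epsilon>" "\<epsilon> \<le> 1 / 2"
      and near: "\<And>\<xi> \<eta>. \<xi> \<in> \<Gamma>' \<Longrightarrow> norm (\<eta> - \<xi>) \<le> \<epsilon> * norm \<xi> \<Longrightarrow> \<eta> \<in> \<Gamma>"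
      using open_cone_shrink[OF \<Gamma>] by metis
    have R1: "R\<^sub>1 > 0" using R0 R01 by simp
    have "\<exists>R>0. \<forall>N>0. \<exists>C>0. \<forall>k. \<xi> k \<in> \<Gamma>' \<longrightarrow> norm (\<xi> k) \<ge> R \<longrightarrow>
        block_energy \<alpha> b \<phi> \<rho> \<xi> (dist_mult \<psi> u) k \<le> C * bracket (\<xi> k) powr (- N)"
      by (rule decay_imp_block_energy_decay[where R\<^sub>1 = R\<^sub>1 and \<epsilon> = \<epsilon> and \<Gamma> = \<Gamma>]; fact)
    then obtain R where "R > 0" and "\<forall>N>0. \<exists>C>0. \<forall>k. \<xi> k \<in> \<Gamma>' \<longrightarrow> norm (\<xi> k) \<ge> R \<longrightarrow>
        block_energy \<alpha> b \<phi> \<rho> \<xi> (dist_mult \<psi> u) k \<le> C * bracket (\<xi> k) powr (- N)"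
      by (elim exE conjE) (rule that)
    \<comment> \<open>The summability clause holds for every block by Parseval's identity,
      independently of the decay.\<close>
    then show "gabor_regular \<alpha> b \<phi> \<rho> \<xi> u x\<^sub>0 \<xi>\<^sub>0"
      unfolding gabor_regular_def
      by (intro exI[of _ \<psi>] exI[of _ \<Gamma>'] exI[of _ R] conjI \<psi> \<Gamma>')
         (simp_all add: packet_coeff_summable[OF \<phi> supp b \<rho>(1) bR \<xi> u tf])
  qed
  then show ?thesis unfolding WF_Gabor_def WF_def by simp
qed

end
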